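(* Let $V$ and $E$ be real reflexive Banach spaces, let $X,Y,Z_1,Z_2$ be real Banach spaces, let $C\subset V$ and $D\subset E$ be nonempty, closed and convex, and let $h\in V^*$, $l\in E^*$. Let $\gamma_1\colon V\to X$, $\gamma_2\colon E\to Y$, $\delta_1\colon E\to Z_1$, $\delta_2\colon V\to Z_2$ be bounded, linear and compact operators. Let $\psi\colon V\to\mathbb{R}\cup\{+\infty\}$ and $\theta\colon E\to\mathbb{R}\cup\{+\infty\}$ be convex and lower semicontinuous with $\{u\in V\mid\psi(u)<+\infty\}\cap C\neq\emptyset$ and $\{w\in E\mid\theta(w)<+\infty\}\cap D\neq\emptyset$. Let $J\colon Z_1\times X\to\mathbb{R}$, $H\colon Z_2\times Y\to\mathbb{R}$, $A\colon E\times V\to V^*$ and $B\colon V\times E\to E^*$ satisfy the following hypotheses. Hypotheses on $J$: (J-i) for every $w\in Z_1$ the function $X\ni u\mapsto J(w,u)$ is locally Lipschitz continuous; (J-ii) there is $c_J\ge 0$ with $\|\xi\|_{X^*}\le c_J(1+\|u\|_X+\|w\|_{Z_1})$ for all $\xi\in\partial J(w,u)$, $u\in X$, $w\in Z_1$; (J-iii) $\limsup_{n\to\infty}J^0(w_n,u;v)\le J^0(w,u;v)$ for all $u,v\in X$ and all $\{w_n\}\subset Z_1$, $w\in Z_1$ with $w_n\to w$ in $Z_1$. Hypotheses on $H$: (H-i) for every $u\in Z_2$ the function $Y\ni w\mapsto H(u,w)$ is locally Lipschitz continuous; (H-ii) there is $c_H\ge 0$ with $\|\eta\|_{Y^*}\le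 c_H(1+\|u\|_{Z_2}+\|w\|_Y)$ for all $\eta\in\partial H(u,w)$, $u\in Z_2$, $w\in Y$; (H-iii) $\limsup_{n\to\infty}H^0(u_n,w;z)\le H^0(u,w;z)$ for all $w,z\in Y$ and all $\{u_n\}\subset Z_2$, $u\in Z_2$ with $u_n\to u$ in $Z_2$. Hypotheses on $A$: (A-i) for all $w\in E$ and $u,v\in V$, $\limsup_{t\to0}\langle A(w,tv+(1-t)u),v-u\rangle_V\le\langle A(w,u),v-u\rangle_V$; (A-ii) for each fixed $w\in E$ the multivalued map $V\ni u\mapsto A(w,u)+\gamma_1^*\partial J(\delta_1w,\gamma_1u)\subset V^*$ is stable $\psi$-pseudomonotone with respect to $\{h\}$; (A-iii) if $w_n\to w$ weakly in $E$ and $u_n\to u$ weakly in $V$, then $\limsup_{n\to\infty}\langle A(w_n,v),v-u_n\rangle_V\le\langle A(w,v),v-u\rangle_V$ for all $v\in V$; (A-iv) there is $b_A>0$ with $\|A(w,u)\|_{V^*}\le b_A(1+\|u\|_V+\|w\|_E)$ for all $(w,u)\in E\times V$; (A-v) there is a function $r_A\colon\mathbb{R}_+\times\mathbb{R}_+\to\mathbb{R}$ with property (R) such that $\langle A(w,u),u\rangle_V-J^0(\delta_1w,\gamma_1u;-\gamma_1u)\ge r_A(\|u\|_V,\|w\|_E)\|u\|_V$ for all $u\in V$, $w\in E$. Hypotheses on $B$: (B-i) for all $u\in V$ and $z,w\in E$, $\limsup_{t\to0}\langle B(u,tz+(1-t)w),z-w\rangle_E\le\langle B(u,w),z-w\rangle_E$;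 (B-ii) for each fixed $u\in V$ the multivalued map $E\ni w\mapsto B(u,w)+\gamma_2^*\partial H(\delta_2u,\gamma_2w)\subset E^*$ is stable $\theta$-pseudomonotone with respect to $\{l\}$; (B-iii) if $w_n\to w$ weakly in $E$ and $u_n\to u$ weakly in $V$, then $\limsup_{n\to\infty}\langle B(u_n,z),z-w_n\rangle_E\le\langle B(u,z),z-w\rangle_E$ for all $z\in E$; (B-iv) there is $b_B>0$ with $\|B(u,w)\|_{E^*}\le b_B(1+\|u\|_V+\|w\|_E)$ for all $(w,u)\in E\times V$; (B-v) there is a function $r_B\colon\mathbb{R}_+\times\mathbb{R}_+\to\mathbb{R}$ with property (R) such that $\langle B(u,w),w\rangle_E-H^0(\delta_2u,\gamma_2w;-\gamma_2w)\ge r_B(\|w\|_E,\|u\|_V)\|w\|_E$ for all $u\in V$, $w\in E$. Then the set of all pairs $(u,w)\in C\times D$ such that $$\langle A(w,u),v-u\rangle_V+J^0(\delta_1w,\gamma_1u;\gamma_1(v-u))+\psi(v)-\psi(u)\ge\langle h,v-u\rangle_V\quad\text{for all }v\in C$$ and $$\langle B(u,w),z-w\rangle_E+H^0(\delta_2u,\gamma_2w;\gamma_2(z-w))+\theta(z)-\theta(w)\ge\langle l,z-w\rangle_E\quad\text{for all }z\in D$$ is nonempty and weakly compact in $V\times E$.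
   Context: $\langle\cdot,\cdot\rangle_V$ and $\langle\cdot,\cdot\rangle_E$ are the duality pairings between $V^*$ and $V$, and between $E^*$ and $E$; $\mathbb{R}_+=[0,\infty)$; $\gamma_i^*$ is the adjoint of $\gamma_i$. For a locally Lipschitz function $j\colon X\to\mathbb{R}$ on a Banach space, the Clarke directional derivative is $j^0(u;v)=\limsup_{\lambda\to0^+,\,w\to u}\frac{j(w+\lambda v)-j(w)}{\lambda}$ and the Clarke subgradient is $\partial j(u)=\{\xi\in X^*\mid j^0(u;v)\ge\langle\xi,v\rangle\ \text{for all }v\in X\}$. For functions of two variables, $J^0(w,u;v)$, $\partial J(w,u)$ denote the Clarke directional derivative and subgradient of $J(w,\cdot)$ at $u$; likewise for $H$ (derivative and subgradient with respect to the second variable). Pseudomonotonicity: for a reflexive Banach space $V$ and a proper convex lower semicontinuous $\psi\colon V\to\mathbb{R}\cup\{+\infty\}$, a multivalued operator $F\colon V\to2^{V^*}$ is $\psi$-pseudomonotone if for all $u,v\in V$: whenever there exists $u^*\in F(u)$ with $\langle u^*,v-u\rangle_V+\psi(v)-\psi(u)\ge0$, then $\langle v^*,v-u\rangle_V+\psi(v)-\psi(u)\ge0$ for all $v^*\in F(v)$. $F$ is stable $\psi$-pseudomonotone with respect to a set $W\subset V^*$ if $F$ and, for each $w\in W$, the operator $u\mapsto F(u)-w$ are $\psi$-pseudomonotone. The same definitions apply on $E$ with $\theta$. Convention: any inequality containing $\psi(v)-\psi(u)$ (or $\theta(z)-\theta(w)$) is understood, when values $+\infty$ occur, as the inequality obtained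 by moving $\psi(u)$ (resp. $\theta(w)$) to the other side. In particular solutions $(u,w)$ satisfy $\psi(u)<+\infty$ and $\theta(w)<+\infty$. Property (R) of a function $r\colon\mathbb{R}_+\times\mathbb{R}_+\to\mathbb{R}$: (1) for every nonempty and bounded set $O\subset\mathbb{R}_+$, one has $r(t,s)\to+\infty$ as $t\to+\infty$ for all $s\in O$; (2) for all constants $c_1,c_2\ge0$, $r(t,c_1t+c_2)\to+\infty$ as $t\to+\infty$; (3) for all sequences $\{s_n\},\{t_n\}\subset\mathbb{R}_+$ with $s_n\to+\infty$, $t_n\to+\infty$ and $t_n/s_n\to0$ as $n\to\infty$, one has $r(s_n,t_n)\to+\infty$ as $n\to\infty$.
   Formalization: In property (R)(1), the divergence r(t,s)→+∞ as t→+∞ is taken uniformly in s∈O for each nonempty bounded O; read pointwise in s, the claim is false (the solution set can be unbounded, hence not weakly compact). *)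

theory Defs
  imports "HOL-Analysis.Analysis"
begin

(* The dual of a real normed space 'a is the type of bounded linear functionals
   'a \<Rightarrow>\<^sub>L real with its operator norm; the pairing of f and u is f applied to u. *)

definition reflexive_space :: "'a::real_normed_vector itself \<Rightarrow> bool" where
  "reflexive_space _ \<longleftrightarrow>
     (\<forall>\<phi> :: ('a \<Rightarrow>\<^sub>L real) \<Rightarrow>\<^sub>L real. \<exists>x::'a. \<forall>f. blinfun_apply \<phi> f = blinfun_apply f x)"

definition weak_topology :: "'a::real_normed_vector topology" where
  "weak_topology =
     topology_generated_by {blinfun_apply f -` U | (f :: 'a \<Rightarrow>\<^sub>L real) U. open U}"

definition weakly_tendsto :: "(nat \<Rightarrow> 'a::real_normed_vector) \<Rightarrow> 'a \<Rightarrow> bool" where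
  "weakly_tendsto x a \<longleftrightarrow>
     (\<forall>f :: 'a \<Rightarrow>\<^sub>L real. (\<lambda>n. blinfun_apply f (x n)) \<longlonglongrightarrow> blinfun_apply f a)"

lemma weakly_tendsto_iff_limitin:
  fixes x :: "nat \<Rightarrow> 'a::real_normed_vector"
  shows "weakly_tendsto x a \<longleftrightarrow> limitin weak_topology x a sequentially"
proof
  let ?S = "{blinfun_apply f -` U | (f :: 'a \<Rightarrow>\<^sub>L real) U. open U}"
  assume L: "weakly_tendsto x a"
  have "eventually (\<lambda>n. x n \<in> U) sequentially"
    if "generate_topology_on ?S U" "a \<in> U" for U
    using that
  proof (induction rule: generate_topology_on.induct)
    case Empty
    then show ?case by simp
  next
    case (Int A B)
    then show ?case by (auto intro: eventually_conj)
  next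
    case (UN K)
    then obtain k where "k \<in> K" "a \<in> k" by blast
    then have "eventually (\<lambda>n. x n \<in> k) sequentially" using UN by blast
    then show ?case by (rule eventually_mono) (use \<open>k \<in> K\<close> in blast)
  next
    case (Basis s)
    then obtain f :: "'a \<Rightarrow>\<^sub>L real" and U where s: "s = blinfun_apply f -` U" "open U"
      by blast
    with Basis have "blinfun_apply f a \<in> U" by simp
    with L s show ?case
      unfolding weakly_tendsto_def by (auto dest: topological_tendstoD)
  qed
  moreover have "a \<in> topspace (weak_topology :: 'a topology)"
    unfolding weak_topology_def topology_generated_by_topspace by (auto intro: exI[of _ UNIV])
  ultimately show "limitin weak_topology x a sequentially"
    unfolding limitin_def by (simp add: weak_topology_def openin_topology_generated_by_iff)
next
  assume L: "limitin weak_topology x a sequentially"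
  show "weakly_tendsto x a"
    unfolding weakly_tendsto_def
  proof (intro allI topological_tendstoI)
    fix f :: "'a \<Rightarrow>\<^sub>L real" and U :: "real set"
    assume "open U" "blinfun_apply f a \<in> U"
    moreover from \<open>open U\<close> have "openin weak_topology (blinfun_apply f -` U)"
      unfolding weak_topology_def by (intro topology_generated_by_Basis) blast
    ultimately show "eventually (\<lambda>n. blinfun_apply f (x n) \<in> U) sequentially"
      using L unfolding limitin_def by fastforce
  qed
qed

definition compact_operator :: "('a::real_normed_vector \<Rightarrow>\<^sub>L 'b::real_normed_vector) \<Rightarrow> bool" where
  "compact_operator T \<longleftrightarrow> (\<forall>S. bounded S \<longrightarrow> compact (closure (blinfun_apply T ` S)))"

definition dual_adjoint ::
    "('a::real_normed_vector \<Rightarrow>\<^sub>L 'b::real_normed_vector) \<Rightarrow> ('b \<Rightarrow>\<^sub>L real) \<Rightarrow> ('a \<Rightarrow>\<^sub>L real)" where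
  "dual_adjoint T \<xi> = \<xi> o\<^sub>L T"

definition locally_lipschitz :: "('a::metric_space \<Rightarrow> real) \<Rightarrow> bool" where
  "locally_lipschitz j \<longleftrightarrow> (\<forall>x. \<exists>U. open U \<and> x \<in> U \<and> (\<exists>L. L-lipschitz_on U j))"

(* Extended-real valued so that the upper limit always makes sense; it is finite
   whenever j is locally Lipschitz. *)
definition clarke_derivative :: "('a::real_normed_vector \<Rightarrow> real) \<Rightarrow> 'a \<Rightarrow> 'a \<Rightarrow> ereal" where
  "clarke_derivative j u v =
     Limsup (nhds u \<times>\<^sub>F at_right 0) (\<lambda>(w, t). ereal ((j (w + t *\<^sub>R v) - j w) / t))"

definition clarke_subgradient :: "('a::real_normed_vector \<Rightarrow> real) \<Rightarrow> 'a \<Rightarrow> ('a \<Rightarrow>\<^sub>L real) set" where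
  "clarke_subgradient j u = {\<xi>. \<forall>v. ereal (blinfun_apply \<xi> v) \<le> clarke_derivative j u v}"

definition ereal_convex :: "('a::real_vector \<Rightarrow> ereal) \<Rightarrow> bool" where
  "ereal_convex \<psi> \<longleftrightarrow> (\<forall>x y. \<forall>a\<ge>0. \<forall>b\<ge>0. a + b = 1 \<longrightarrow>
     \<psi> (a *\<^sub>R x + b *\<^sub>R y) \<le> ereal a * \<psi> x + ereal b * \<psi> y)"

definition lower_semicontinuous :: "('a::topological_space \<Rightarrow> ereal) \<Rightarrow> bool" where
  "lower_semicontinuous \<psi> \<longleftrightarrow> (\<forall>x. \<psi> x \<le> Liminf (at x) \<psi>)"

(* An inequality  a + \<psi> v - \<psi> u \<ge> 0  with possibly infinite values of \<psi> is read as
   a + \<psi> v \<ge> \<psi> u,  here and everywhere below. *)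
definition pseudomonotone_wrt ::
    "('a::real_normed_vector \<Rightarrow> ereal) \<Rightarrow> ('a \<Rightarrow> ('a \<Rightarrow>\<^sub>L real) set) \<Rightarrow> bool" where
  "pseudomonotone_wrt \<psi> F \<longleftrightarrow> (\<forall>u v.
     (\<exists>us \<in> F u. ereal (blinfun_apply us (v - u)) + \<psi> v \<ge> \<psi> u) \<longrightarrow>
     (\<forall>vs \<in> F v. ereal (blinfun_apply vs (v - u)) + \<psi> v \<ge> \<psi> u))"

definition stable_pseudomonotone_wrt ::
    "('a::real_normed_vector \<Rightarrow> ereal) \<Rightarrow> ('a \<Rightarrow>\<^sub>L real) set \<Rightarrow>
     ('a \<Rightarrow> ('a \<Rightarrow>\<^sub>L real) set) \<Rightarrow> bool" where
  "stable_pseudomonotone_wrt \<psi> W F \<longleftrightarrow>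
     pseudomonotone_wrt \<psi> F \<and>
     (\<forall>w \<in> W. pseudomonotone_wrt \<psi> (\<lambda>u. (\<lambda>us. us - w) ` F u))"

(* A function on [0,\<infinity>) \<times> [0,\<infinity>) is represented by a function on all pairs of reals, of
   which only the values at nonnegative arguments are used.  In the first clause the
   divergence is uniform in s \<in> S; the pointwise version would be the case c1 = 0 of the
   second clause. *)
definition property_R :: "(real \<Rightarrow> real \<Rightarrow> real) \<Rightarrow> bool" where
  "property_R r \<longleftrightarrow>
     (\<forall>S. S \<noteq> {} \<and> bounded S \<and> S \<subseteq> {0..} \<longrightarrow>
        (\<forall>M. eventually (\<lambda>t. \<forall>s\<in>S. M \<le> r t s) at_top)) \<and>
     (\<forall>c1\<ge>0. \<forall>c2\<ge>0. filterlim (\<lambda>t. r t (c1 * t + c2)) at_top at_top) \<and>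
     (\<forall>s t :: nat \<Rightarrow> real.
        (\<forall>n. 0 \<le> s n) \<and> (\<forall>n. 0 \<le> t n) \<and>
        filterlim s at_top sequentially \<and> filterlim t at_top sequentially \<and>
        (\<lambda>n. t n / s n) \<longlonglongrightarrow> 0 \<longrightarrow>
        filterlim (\<lambda>n. r (s n) (t n)) at_top sequentially)"

end

theory Submission
  imports Defs
begin

text \<open>For a fixed parameter, pseudomonotonicity and hemicontinuity make the inequality for \<open>u\<close>
  equivalent to Minty's form, in which the operator and the Clarke derivative are evaluated at the
  test point. Since \<open>\<gamma>\<^sub>i\<close> and \<open>\<delta>\<^sub>i\<close> are compact, Minty's inequality is weakly sequentially closed jointly
  in \<open>(u, w)\<close>; by the Eberlein--Smulian theorem it is weakly closed on bounded sets. On bounded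
  \<open>C\<close> and \<open>D\<close>, weak compactness reduces the existence of a solution to finitely many test points.
  There, a point violating some of the Minty inequalities is moved towards the corresponding test
  points; at a fixed point of this map the moves cancel, which contradicts the sublinearity of the
  original (Stampacchia) form together with the convexity of \<open>\<psi>\<close> and \<open>\<theta>\<close>.

  The coercivity estimate holds not only at a solution \<open>u\<close> but on the whole segment from a fixed
  point of the domain of \<open>\<psi>\<close> to \<open>u\<close>. If \<open>norm w \<le> norm u\<close>, it may thus be used at a point of norm
  \<open>norm w\<close>, where property (R) with \<open>c1 = 1\<close> and \<open>c2 = 0\<close> bounds \<open>norm w\<close>, and then \<open>norm u\<close> is bounded
  by its first clause; the other case is symmetric. This bounds all solutions, and the solutions
  on large balls solve the unrestricted problem.\<close>

section \<open>The Hahn--Banach theorem\<close>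

text \<open>The limit conditions on \<open>A\<close> and \<open>B\<close> speak of a fixed test
  point while parameter and solution vary, so weak limits are taken in Minty's form; the balance of
  moves needs a sublinear expression at the solution itself, hence Stampacchia's form. They meet by
  contraposition: pseudomonotonicity turns a violated Minty inequality into a violated Stampacchia
  inequality. For a fixed parameter solutions need not be unique, so both inequalities are treated
  simultaneously on the product instead of alternately. Hahn-Banach is needed because growth and
  pseudomonotonicity are stated for subgradients, but the inequalities for Clarke derivatives. The
  obstacle to the a priori bound is that property (R) is not uniform over all ratios of its two
  arguments, while the ratio of the two norms of a solution is unknown.\<close>

definition sublinear :: "('a::real_vector \<Rightarrow> real) \<Rightarrow> bool" where
  "sublinear p \<longleftrightarrow> (\<forall>x y. p (x + y) \<le> p x + p y) \<and> (\<forall>x. \<forall>t\<ge>0. p (t *\<^sub>R x) = t * p x)"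

lemma sublinearI:
  assumes add: "\<And>x y. p (x + y) \<le> p x + p y"
    and scale: "\<And>t x. 0 < t \<Longrightarrow> p (t *\<^sub>R x) \<le> t * p x"
    and zero: "p 0 = 0"
  shows "sublinear p"
proof -
  have "p (t *\<^sub>R x) = t * p x" if "t \<ge> 0" for t x
  proof (cases "t = 0")
    case False
    with that have t: "t > 0" by simp
    have "p (inverse t *\<^sub>R (t *\<^sub>R x)) \<le> inverse t * p (t *\<^sub>R x)"
      using scale[of "inverse t" "t *\<^sub>R x"] t by simp
    then have "t * p x \<le> p (t *\<^sub>R x)"
      using t by (simp add: field_simps)
    with scale[OF t, of x] show ?thesis by simp
  qed (simp add: zero)
  with add show ?thesis unfolding sublinear_def by blast
qed

lemma sublinear_add: "sublinear p \<Longrightarrow> p (x + y) \<le> p x + p y"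
  by (simp add: sublinear_def)

lemma sublinear_scale: "sublinear p \<Longrightarrow> 0 \<le> t \<Longrightarrow> p (t *\<^sub>R x) = t * p x"
  by (simp add: sublinear_def)

lemma sublinear_zero: "sublinear p \<Longrightarrow> p 0 = 0"
  using sublinear_scale[of p 0 0] by simp

lemma sublinear_minus: "sublinear p \<Longrightarrow> - p (- x) \<le> p x"
  using sublinear_add[of p x "- x"] by (simp add: sublinear_zero)

lemma sublinear_sum:
  assumes p: "sublinear p" and "finite I" "\<And>i. i \<in> I \<Longrightarrow> 0 \<le> a i"
  shows "p (\<Sum>i\<in>I. a i *\<^sub>R x i) \<le> (\<Sum>i\<in>I. a i * p (x i))"
  using assms(2,3)
proof (induction I rule: finite_induct)
  case (insert i I)
  then show ?case
    using sublinear_add[OF p, of "a i *\<^sub>R x i" "\<Sum>i\<in>I. a i *\<^sub>R x i"]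
    by (fastforce simp: sublinear_scale[OF p])
qed (simp add: sublinear_zero[OF p])

text \<open>The largest sublinear functional below \<open>p\<close> that is linear on the line through \<open>y\<close> and equals
  \<open>p\<close> at \<open>y\<close>. As a minimal sublinear functional cannot be lowered, it is linear.\<close>
definition lowered :: "('a::real_vector \<Rightarrow> real) \<Rightarrow> 'a \<Rightarrow> 'a \<Rightarrow> real" where
  "lowered p y x = (INF t\<in>{0..}. p (x + t *\<^sub>R y) - t * p y)"

lemma lowered_le:
  assumes p: "sublinear p" and "t \<ge> 0"
  shows "lowered p y x \<le> p (x + t *\<^sub>R y) - t * p y"
proof -
  \<comment> \<open>The infimum of a set of reals is meaningful only with a lower bound;
    subadditivity provides one that does not depend on \<open>t\<close>.\<close>
  have "- p (- x) \<le> p (x + t *\<^sub>R y) - t * p y" if "t \<ge> 0" for t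
    using sublinear_add[OF p, of "x + t *\<^sub>R y" "- x"] sublinear_scale[OF p that, of y] by simp
  then have "bdd_below ((\<lambda>t. p (x + t *\<^sub>R y) - t * p y) ` {0..})"
    by (intro bdd_belowI2) auto
  then show ?thesis
    unfolding lowered_def using assms(2) by (intro cINF_lower) auto
qed

lemma lowered_ge:
  assumes "\<And>t. t \<ge> 0 \<Longrightarrow> c \<le> p (x + t *\<^sub>R y) - t * p y"
  shows "c \<le> lowered p y x"
  unfolding lowered_def by (rule cINF_greatest) (use assms in auto)

lemma sublinear_lowered:
  assumes p: "sublinear p"
  shows "sublinear (lowered p y)"
proof (rule sublinearI)
  fix x1 x2
  have "lowered p y (x1 + x2) - (p (x2 + t2 *\<^sub>R y) - t2 * p y) \<le> lowered p y x1"
    if t2: "t2 \<ge> 0" for t2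
  proof (rule lowered_ge)
    fix t1 :: real assume t1: "t1 \<ge> 0"
    have "lowered p y (x1 + x2) \<le> p (x1 + x2 + (t1 + t2) *\<^sub>R y) - (t1 + t2) * p y"
      using lowered_le[OF p] t1 t2 by simp
    also have "x1 + x2 + (t1 + t2) *\<^sub>R y = (x1 + t1 *\<^sub>R y) + (x2 + t2 *\<^sub>R y)"
      by (simp add: algebra_simps)
    finally show "lowered p y (x1 + x2) - (p (x2 + t2 *\<^sub>R y) - t2 * p y)
        \<le> p (x1 + t1 *\<^sub>R y) - t1 * p y"
      using sublinear_add[OF p, of "x1 + t1 *\<^sub>R y" "x2 + t2 *\<^sub>R y"] by (simp add: algebra_simps)
  qed
  then have "lowered p y (x1 + x2) - lowered p y x1 \<le> lowered p y x2"
    by (intro lowered_ge) (simp add: algebra_simps)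
  then show "lowered p y (x1 + x2) \<le> lowered p y x1 + lowered p y x2" by simp
next
  fix c :: real and x assume c: "0 < c"
  have "lowered p y (c *\<^sub>R x) / c \<le> lowered p y x"
  proof (rule lowered_ge)
    fix t :: real assume t: "t \<ge> 0"
    have "lowered p y (c *\<^sub>R x) \<le> p (c *\<^sub>R x + (c * t) *\<^sub>R y) - (c * t) * p y"
      using lowered_le[OF p] t c by simp
    also have "c *\<^sub>R x + (c * t) *\<^sub>R y = c *\<^sub>R (x + t *\<^sub>R y)" by (simp add: algebra_simps)
    also have "p \<dots> - (c * t) * p y = c * (p (x + t *\<^sub>R y) - t * p y)"
      using sublinear_scale[OF p, of c "x + t *\<^sub>R y"] c by (simp add: right_diff_distrib del: scaleR_right_distrib scaleR_add_right)
    finally show "lowered p y (c *\<^sub>R x) / c \<le> p (x + t *\<^sub>R y) - t * p y"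
      using c by (simp add: field_simps)
  qed
  then show "lowered p y (c *\<^sub>R x) \<le> c * lowered p y x" using c by (simp add: field_simps)
next
  have "0 \<le> lowered p y 0"
    by (rule lowered_ge) (simp add: sublinear_scale[OF p])
  moreover have "lowered p y 0 \<le> 0"
    using lowered_le[OF p, of 0 y 0] by (simp add: sublinear_zero[OF p])
  ultimately show "lowered p y 0 = 0" by simp
qed

lemma lowered_below: "sublinear p \<Longrightarrow> lowered p y x \<le> p x"
  using lowered_le[of p 0 y x] by simp

lemma lowered_minus: "sublinear p \<Longrightarrow> lowered p y (- y) \<le> - p y"
  using lowered_le[of p 1 y "- y"] by (simp add: sublinear_zero)

text \<open>Zorn's lemma for the reversed pointwise order. The pointwise infimum bounds a chain from
  below; it is finite because every member stays above \<open>\<lambda>x. - p (- x)\<close>.\<close>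

lemma minimal_sublinear:
  assumes p: "sublinear p"
  obtains q where "sublinear q" "q \<le> p" "\<And>q'. sublinear q' \<Longrightarrow> q' \<le> q \<Longrightarrow> q' = q"
proof -
  let ?A = "{q. sublinear q \<and> q \<le> p}"
  have "\<exists>m\<in>?A. \<forall>a\<in>?A. a \<le> m \<longrightarrow> a = m"
  proof (rule predicate_Zorn)
    show "partial_order_on ?A (relation_of (\<lambda>a b. b \<le> a) ?A)"
      by (rule partial_order_on_relation_ofI) auto
  next
    fix K assume K: "K \<in> Chains (relation_of (\<lambda>a b. b \<le> a) ?A)"
    have KA: "sublinear q" "q \<le> p" if "q \<in> K" for q
      using K that by (auto simp: Chains_def relation_of_def)
    have tot: "q1 \<le> q2 \<or> q2 \<le> q1" if "q1 \<in> K" "q2 \<in> K" for q1 q2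
      using K that by (auto simp: Chains_def relation_of_def)
    show "\<exists>u\<in>?A. \<forall>a\<in>K. u \<le> a"
    proof (cases "K = {}")
      case True
      with p show ?thesis by auto
    next
      case False
      define u where "u x = (INF q\<in>K. q x)" for x
      have "- p (- x) \<le> q x" if "q \<in> K" for q x
        using sublinear_minus[OF KA(1)[OF that], of x] le_funD[OF KA(2)[OF that], of "- x"] by simp
      then have bdd: "bdd_below ((\<lambda>q. q x) ` K)" for x by (intro bdd_belowI2) auto
      have ul: "u x \<le> q x" if "q \<in> K" for q x
        unfolding u_def using bdd that by (rule cINF_lower)
      have ug: "c \<le> u x" if "\<And>q. q \<in> K \<Longrightarrow> c \<le> q x" for c x
        unfolding u_def using False that by (rule cINF_greatest)
      have "sublinear u"
      proof (rule sublinearI)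
        fix x y
        \<comment> \<open>The two infima may be approached along different members; totality of the
          chain gives one member below both.\<close>
        have "u (x + y) \<le> q1 x + q2 y" if q: "q1 \<in> K" "q2 \<in> K" for q1 q2
        proof -
          obtain q where q': "q \<in> K" "q \<le> q1" "q \<le> q2" using tot[OF q] q by blast
          have "u (x + y) \<le> q (x + y)" using ul q' by blast
          also have "\<dots> \<le> q x + q y" using sublinear_add KA q' by blast
          also have "\<dots> \<le> q1 x + q2 y" using le_funD[OF q'(2), of x] le_funD[OF q'(3), of y] by simp
          finally show ?thesis .
        qed
        then have "u (x + y) - q2 y \<le> u x" if "q2 \<in> K" for q2
          using that by (intro ug) (simp add: diff_le_eq)
        then have "u (x + y) - u x \<le> u y" by (intro ug) (simp add: diff_le_eq add.commute)
        then show "u (x + y) \<le> u x + u y" by simp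
      next
        fix t :: real and x assume t: "0 < t"
        have "u (t *\<^sub>R x) / t \<le> u x"
        proof (rule ug)
          fix q assume q: "q \<in> K"
          show "u (t *\<^sub>R x) / t \<le> q x"
            using ul[OF q, of "t *\<^sub>R x"] sublinear_scale[OF KA(1)[OF q], of t x] t
            by (simp add: field_simps)
        qed
        then show "u (t *\<^sub>R x) \<le> t * u x" using t by (simp add: field_simps)
      next
        obtain q where q: "q \<in> K" using False by blast
        then have "u 0 \<le> 0" using ul[OF q, of 0] sublinear_zero[OF KA(1)[OF q]] by simp
        moreover have "0 \<le> u 0" by (rule ug) (simp add: sublinear_zero[OF KA(1)])
        ultimately show "u 0 = 0" by simp
      qed
      moreover have "u \<le> p"
        using False KA(2) ul by (metis equals0I le_fun_def order_trans)
      ultimately show ?thesis using ul by (auto simp: le_fun_def)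
    qed
  qed
  then obtain m where m: "m \<in> ?A" and min: "\<And>a. a \<in> ?A \<Longrightarrow> a \<le> m \<Longrightarrow> a = m" by blast
  show ?thesis
  proof (rule that)
    show "sublinear m" "m \<le> p" using m by auto
    show "q' = m" if "sublinear q'" "q' \<le> m" for q'
    proof (rule min)
      show "q' \<in> ?A" using that \<open>m \<le> p\<close> order.trans by blast
    qed (rule that)
  qed
qed

text \<open>Minimality gives \<open>lowered f z = f\<close> for all \<open>z\<close>, which is the
  superadditivity of \<open>f\<close>. Starting from \<open>lowered p y\<close> instead of
  \<open>p\<close> forces \<open>f (- y) \<le> - p y\<close> and thus equality at
  \<open>y\<close>.\<close>

theorem Hahn_Banach_sublinear:
  fixes p :: "'a::real_vector \<Rightarrow> real"
  assumes p: "sublinear p"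
  obtains f where "linear f" "\<And>x. f x \<le> p x" "f y = p y"
proof -
  obtain f where f: "sublinear f" "f \<le> lowered p y"
    and min: "\<And>q. sublinear q \<Longrightarrow> q \<le> f \<Longrightarrow> q = f"
    using minimal_sublinear[OF sublinear_lowered[OF p]] by blast
  have add: "f (x + z) = f x + f z" for x z
  proof -
    have "lowered f z = f"
      by (rule min) (simp_all add: sublinear_lowered f le_fun_def lowered_below)
    then have "f x \<le> f (x + z) - f z" using lowered_le[OF f(1), of 1 z x] by simp
    with sublinear_add[OF f(1), of x z] show ?thesis by simp
  qed
  have neg: "f (- x) = - f x" for x
    using add[of x "- x"] sublinear_zero[OF f(1)] by simp
  have "f (c *\<^sub>R x) = c *\<^sub>R f x" for c x
  proof (cases "c \<ge> 0")
    case True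
    then show ?thesis using sublinear_scale[OF f(1)] by simp
  next
    case False
    then show ?thesis using sublinear_scale[OF f(1), of "- c" x] neg[of "c *\<^sub>R x"] by simp
  qed
  with add have "linear f" by (intro linearI)
  moreover have le: "f x \<le> p x" for x
    using le_funD[OF f(2), of x] lowered_below[OF p, of y x] by simp
  moreover have "p y \<le> f y"
    using le_funD[OF f(2), of "- y"] lowered_minus[OF p, of y] neg[of y] by simp
  ultimately show ?thesis using that le[of y] by force
qed

corollary Hahn_Banach_blinfun:
  fixes p :: "'a::real_normed_vector \<Rightarrow> real"
  assumes p: "sublinear p" and bound: "\<And>x. p x \<le> L * norm x" and "L \<ge> 0"
  obtains f :: "'a \<Rightarrow>\<^sub>L real" where "\<And>x. f x \<le> p x" "f y = p y" "norm f \<le> L"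
proof -
  obtain f where f: "linear f" "\<And>x. f x \<le> p x" "f y = p y"
    using Hahn_Banach_sublinear[OF p, of y] by blast
  have bd: "\<bar>f x\<bar> \<le> L * norm x" for x
    using order_trans[OF f(2)[of x] bound] order_trans[OF f(2)[of "- x"] bound]
      linear_neg[OF f(1), of x] by simp
  then have "bounded_linear f"
    by (intro bounded_linear_intro[of f L]) (simp_all add: f(1) linear_add linear_scale mult.commute)
  then have ap: "blinfun_apply (Blinfun f) = f" by (rule bounded_linear_Blinfun_apply)
  show ?thesis
    by (rule that[of "Blinfun f"]) (use bd f assms(3) in \<open>auto simp: ap intro!: norm_blinfun_bound\<close>)
qed

corollary norming_functional:
  fixes x :: "'a::real_normed_vector"
  obtains f :: "'a \<Rightarrow>\<^sub>L real" where "f x = norm x" "norm f \<le> 1"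
proof -
  have "sublinear (norm :: 'a \<Rightarrow> real)"
    by (simp add: sublinear_def norm_triangle_ineq)
  from Hahn_Banach_blinfun[OF this, of 1 x] show ?thesis using that by auto
qed

section \<open>Clarke derivatives and subgradients\<close>

abbreviation clarke_filter :: "'a::real_normed_vector \<Rightarrow> ('a \<times> real) filter" where
  "clarke_filter u \<equiv> nhds u \<times>\<^sub>F at_right 0"

text \<open>Real arithmetic in place of extended reals; for locally Lipschitz \<open>j\<close>
  nothing is lost, see \<open>ereal_clarke_real\<close>.\<close>

definition clarke_real :: "('a::real_normed_vector \<Rightarrow> real) \<Rightarrow> 'a \<Rightarrow> 'a \<Rightarrow> real" where
  "clarke_real j u v = real_of_ereal (clarke_derivative j u v)"

lemma clarke_filter_nontrivial: "clarke_filter (u :: 'a::real_normed_vector) \<noteq> bot"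
  by (simp add: prod_filter_eq_bot)

lemma tendsto_clarke_filter:
  "((\<lambda>(w, t). w + t *\<^sub>R v) \<longlongrightarrow> u) (clarke_filter (u :: 'a::real_normed_vector))"
proof -
  have 1: "(fst \<longlongrightarrow> u) (clarke_filter u)"
    by (rule filterlim_fst)
  have "(snd \<longlongrightarrow> (0 :: real)) (clarke_filter u)"
    by (rule filterlim_mono[OF filterlim_snd at_within_le_nhds order_refl])
  from tendsto_add[OF 1 tendsto_scaleR[OF this tendsto_const[of v]]]
  show ?thesis by (simp add: case_prod_unfold)
qed

lemma eventually_clarke_filter_pos: "eventually (\<lambda>(w, t). 0 < t) (clarke_filter u)"
proof -
  have "eventually (\<lambda>t::real. 0 < t) (at_right 0)" by (rule eventually_at_right_less)
  then show ?thesis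
    using eventually_compose_filterlim[OF _ filterlim_snd] by (fastforce simp: case_prod_unfold)
qed

lemma clarke_derivative_le:
  assumes "eventually (\<lambda>(w, t). (j (w + t *\<^sub>R v) - j w) / t \<le> c) (clarke_filter u)"
  shows "clarke_derivative j u v \<le> ereal c"
  unfolding clarke_derivative_def
  by (rule Limsup_bounded) (use assms in \<open>auto elim!: eventually_mono\<close>)

lemma clarke_derivative_lessD:
  assumes "clarke_derivative j u v < ereal c"
  shows "eventually (\<lambda>(w, t). (j (w + t *\<^sub>R v) - j w) / t < c) (clarke_filter u)"
  using Limsup_lessD[OF assms[unfolded clarke_derivative_def]] by (auto elim!: eventually_mono)

lemma locally_lipschitz_quotient_bound:
  fixes u :: "'a::real_normed_vector"
  assumes "locally_lipschitz j"
  obtains L where "L \<ge> 0"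
    "\<And>v. eventually (\<lambda>(w, t). \<bar>(j (w + t *\<^sub>R v) - j w) / t\<bar> \<le> L * norm v) (clarke_filter u)"
proof -
  from assms obtain U L where U: "open U" "u \<in> U" and L: "L-lipschitz_on U j"
    unfolding locally_lipschitz_def by blast
  show ?thesis
  proof (rule that)
    show "L \<ge> 0" using lipschitz_on_nonneg[OF L] .
    fix v
    have 1: "eventually (\<lambda>(w, t). w + t *\<^sub>R v \<in> U) (clarke_filter u)"
      using topological_tendstoD[OF tendsto_clarke_filter U] by (simp add: case_prod_unfold)
    have 2: "eventually (\<lambda>(w, t). w \<in> U) (clarke_filter u)"
      using topological_tendstoD[OF tendsto_clarke_filter U, of 0] by (simp add: case_prod_unfold)
    show "eventually (\<lambda>(w, t). \<bar>(j (w + t *\<^sub>R v) - j w) / t\<bar> \<le> L * norm v) (clarke_filter u)"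
      using 1 2 eventually_clarke_filter_pos
    proof eventually_elim
      case (elim p)
      obtain w t where p: "p = (w, t)" by fastforce
      have "\<bar>j (w + t *\<^sub>R v) - j w\<bar> \<le> L * (t * norm v)"
        using lipschitz_onD[OF L, of "w + t *\<^sub>R v" w] elim p by (simp add: dist_norm)
      then show ?case using elim p by (simp add: field_simps)
    qed
  qed
qed

lemma
  assumes j: "locally_lipschitz j"
  shows ereal_clarke_real: "ereal (clarke_real j u v) = clarke_derivative j u v"
    and clarke_real_bound_ex: "\<exists>L\<ge>0. \<forall>v. \<bar>clarke_real j u v\<bar> \<le> L * norm v"
proof -
  obtain L where L: "L \<ge> 0"
    "\<And>v. eventually (\<lambda>(w, t). \<bar>(j (w + t *\<^sub>R v) - j w) / t\<bar> \<le> L * norm v) (clarke_filter u)"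
    using locally_lipschitz_quotient_bound[OF j] by blast
  have le: "clarke_derivative j u v \<le> ereal (L * norm v)" for v
    by (rule clarke_derivative_le)
      (use L(2)[of v] in \<open>auto elim!: eventually_mono intro: abs_le_D1 simp del: abs_divide\<close>)
  have ge: "ereal (- (L * norm v)) \<le> clarke_derivative j u v" for v
    unfolding clarke_derivative_def
    by (rule le_Limsup[OF clarke_filter_nontrivial])
      (use L(2)[of v] in \<open>auto elim!: eventually_mono simp: abs_le_iff minus_le_iff simp del: abs_divide\<close>)
  have eq: "ereal (clarke_real j u v) = clarke_derivative j u v" for v
    unfolding clarke_real_def using le[of v] ge[of v]
    by (cases "clarke_derivative j u v") auto
  then show "ereal (clarke_real j u v) = clarke_derivative j u v" .
  have "\<bar>clarke_real j u v\<bar> \<le> L * norm v" for v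
    using le[of v] ge[of v] by (simp flip: eq add: abs_le_iff)
  then show "\<exists>L\<ge>0. \<forall>v. \<bar>clarke_real j u v\<bar> \<le> L * norm v" using L(1) by blast
qed

lemma clarke_real_le:
  assumes "locally_lipschitz j"
    and "eventually (\<lambda>(w, t). (j (w + t *\<^sub>R v) - j w) / t \<le> c) (clarke_filter u)"
  shows "clarke_real j u v \<le> c"
  using clarke_derivative_le[OF assms(2)] by (simp flip: ereal_clarke_real[OF assms(1)])

lemma clarke_real_lessD:
  assumes "locally_lipschitz j" and "clarke_real j u v < c"
  shows "eventually (\<lambda>(w, t). (j (w + t *\<^sub>R v) - j w) / t < c) (clarke_filter u)"
  by (rule clarke_derivative_lessD) (simp add: assms(2) flip: ereal_clarke_real[OF assms(1)])

text \<open>The quotient for \<open>x + y\<close> is the one for \<open>x\<close> at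
  \<open>w\<close> plus the one for \<open>y\<close> at \<open>w + t *\<^sub>R x\<close>. The
  shifted base point still tends to \<open>u\<close>; this is where the varying base point of the
  definition matters. Homogeneity is the substitution of \<open>c * t\<close> for
  \<open>t\<close>.\<close>

lemma sublinear_clarke_real:
  assumes j: "locally_lipschitz j"
  shows "sublinear (clarke_real j u)"
proof (rule sublinearI)
  fix x y
  show "clarke_real j u (x + y) \<le> clarke_real j u x + clarke_real j u y"
  proof (rule field_le_epsilon)
    fix e :: real assume "e > 0"
    define a b where "a = clarke_real j u x + e / 2" and "b = clarke_real j u y + e / 2"
    have 1: "eventually (\<lambda>(w, t). (j (w + t *\<^sub>R x) - j w) / t < a) (clarke_filter u)"
      by (rule clarke_real_lessD[OF j]) (use \<open>e > 0\<close> in \<open>simp add: a_def\<close>)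
    have 2: "eventually (\<lambda>(w, t). (j (w + t *\<^sub>R y) - j w) / t < b) (clarke_filter u)"
      by (rule clarke_real_lessD[OF j]) (use \<open>e > 0\<close> in \<open>simp add: b_def\<close>)
    have lim: "filterlim (\<lambda>(w, t). (w + t *\<^sub>R x, t)) (clarke_filter u) (clarke_filter u)"
      using filterlim_Pair[OF tendsto_clarke_filter[of x u] filterlim_snd]
      by (simp add: case_prod_unfold)
    have 3: "eventually (\<lambda>(w, t). (j (w + t *\<^sub>R x + t *\<^sub>R y) - j (w + t *\<^sub>R x)) / t < b)
        (clarke_filter u)"
      using eventually_compose_filterlim[OF 2 lim] by (simp add: case_prod_unfold)
    have "clarke_real j u (x + y) \<le> a + b"
    proof (rule clarke_real_le[OF j])
      show "eventually (\<lambda>(w, t). (j (w + t *\<^sub>R (x + y)) - j w) / t \<le> a + b) (clarke_filter u)"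
        using 1 3
      proof eventually_elim
        case (elim p)
        obtain w t where p: "p = (w, t)" by fastforce
        have "(j (w + t *\<^sub>R (x + y)) - j w) / t
            = (j (w + t *\<^sub>R x) - j w) / t + (j (w + t *\<^sub>R x + t *\<^sub>R y) - j (w + t *\<^sub>R x)) / t"
          by (simp add: diff_divide_distrib scaleR_add_right add.assoc)
        then show ?case using elim p by simp
      qed
    qed
    then show "clarke_real j u (x + y) \<le> clarke_real j u x + clarke_real j u y + e"
      by (simp add: a_def b_def)
  qed
next
  fix c :: real and x assume c: "0 < c"
  show "clarke_real j u (c *\<^sub>R x) \<le> c * clarke_real j u x"
  proof (rule field_le_epsilon)
    fix e :: real assume "e > 0"
    have 1: "eventually (\<lambda>(w, t). (j (w + t *\<^sub>R x) - j w) / t < clarke_real j u x + e / c)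
        (clarke_filter u)"
      by (rule clarke_real_lessD[OF j]) (use \<open>e > 0\<close> c in simp)
    have "filterlim (\<lambda>t. c * t) (at_right 0) (at_right (0::real))"
      by (rule filterlim_times_pos[OF filterlim_ident c]) simp
    from filterlim_compose[OF this filterlim_snd]
    have "filterlim (\<lambda>p. c * snd p) (at_right 0) (clarke_filter u)" .
    then have lim: "filterlim (\<lambda>(w, t). (w, c * t)) (clarke_filter u) (clarke_filter u)"
      using filterlim_Pair[OF filterlim_fst] by (simp add: case_prod_unfold)
    have 2: "eventually (\<lambda>(w, t). (j (w + (c * t) *\<^sub>R x) - j w) / (c * t)
        < clarke_real j u x + e / c) (clarke_filter u)"
      using eventually_compose_filterlim[OF 1 lim] by (simp add: case_prod_unfold)
    show "clarke_real j u (c *\<^sub>R x) \<le> c * clarke_real j u x + e"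
    proof (rule clarke_real_le[OF j])
      show "eventually (\<lambda>(w, t). (j (w + t *\<^sub>R (c *\<^sub>R x)) - j w) / t
          \<le> c * clarke_real j u x + e) (clarke_filter u)"
        using 2 eventually_clarke_filter_pos[of u]
      proof eventually_elim
        case (elim p)
        obtain w t where p: "p = (w, t)" by fastforce
        have "(j (w + t *\<^sub>R (c *\<^sub>R x)) - j w) / t
            = c * ((j (w + (c * t) *\<^sub>R x) - j w) / (c * t))"
          using c by (simp add: mult.commute)
        also have "\<dots> \<le> c * (clarke_real j u x + e / c)"
          using elim p c by (intro mult_left_mono) auto
        also have "\<dots> = c * clarke_real j u x + e" using c by (simp add: distrib_left)
        finally show ?case using p by simp
      qed
    qed
  qed
next
  show "clarke_real j u 0 = 0" using clarke_real_bound_ex[OF j, of u] by (metis abs_le_zero_iff mult_zero_right norm_zero)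
qed

text \<open>A bound on the quotients over a neighbourhood of \<open>u\<close> is also one over a
  neighbourhood of each nearby \<open>w\<close>. The intermediate \<open>c'\<close> keeps the
  inequality strict after passing to the upper limit.\<close>

lemma clarke_real_usc:
  assumes j: "locally_lipschitz j" and "clarke_real j u v < c"
  shows "eventually (\<lambda>w. clarke_real j w v < c) (nhds u)"
proof -
  obtain c' where c': "clarke_real j u v < c'" "c' < c" using assms(2) dense by blast
  from clarke_real_lessD[OF j c'(1)] obtain P Q where PQ: "eventually P (nhds u)"
    "eventually Q (at_right 0)" "\<And>w t. P w \<Longrightarrow> Q t \<Longrightarrow> (j (w + t *\<^sub>R v) - j w) / t < c'"
    unfolding eventually_prod_filter by auto
  from PQ(1) have "eventually (\<lambda>w. eventually P (nhds w)) (nhds u)"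
    by (simp add: eventually_eventually)
  then show ?thesis
  proof eventually_elim
    case (elim w)
    have "eventually (\<lambda>(w, t). (j (w + t *\<^sub>R v) - j w) / t \<le> c') (clarke_filter w)"
      unfolding eventually_prod_filter using elim PQ(2,3) less_imp_le by blast
    from clarke_real_le[OF j this] c'(2) show ?case by simp
  qed
qed

lemma in_clarke_subgradient_iff:
  "locally_lipschitz j \<Longrightarrow> \<xi> \<in> clarke_subgradient j u \<longleftrightarrow> (\<forall>v. \<xi> v \<le> clarke_real j u v)"
  unfolding clarke_subgradient_def by (simp flip: ereal_clarke_real)

text \<open>Hahn-Banach below the sublinear Clarke derivative, touching it at \<open>v\<close>.
  Hypotheses on subgradients thereby become statements on the derivative.\<close>

lemma clarke_subgradient_max:
  assumes j: "locally_lipschitz j"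
  obtains \<xi> where "\<xi> \<in> clarke_subgradient j u" "\<xi> v = clarke_real j u v"
proof -
  obtain L where L: "L \<ge> 0" "\<And>v. \<bar>clarke_real j u v\<bar> \<le> L * norm v"
    using clarke_real_bound_ex[OF j, of u] by blast
  obtain f :: "'a \<Rightarrow>\<^sub>L real" where "\<And>x. f x \<le> clarke_real j u x" "f v = clarke_real j u v"
    using Hahn_Banach_blinfun[OF sublinear_clarke_real[OF j, of u], of L v] L abs_le_D1 by metis
  then show ?thesis using that[of f] by (simp add: in_clarke_subgradient_iff[OF j])
qed

lemma clarke_real_bound:
  assumes j: "locally_lipschitz j"
    and bound: "\<And>\<xi>. \<xi> \<in> clarke_subgradient j u \<Longrightarrow> norm \<xi> \<le> L"
  shows "clarke_real j u v \<le> L * norm v"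
proof -
  obtain \<xi> where \<xi>: "\<xi> \<in> clarke_subgradient j u" "\<xi> v = clarke_real j u v"
    using clarke_subgradient_max[OF j] by blast
  have "\<xi> v \<le> norm \<xi> * norm v" using norm_blinfun[of \<xi> v] by simp
  also have "\<dots> \<le> L * norm v" using bound[OF \<xi>(1)] by (simp add: mult_right_mono)
  finally show ?thesis using \<xi>(2) by simp
qed

lemma convex_on_infdist:
  fixes S :: "'a::real_normed_vector set"
  assumes S: "convex S"
  shows "convex_on UNIV (\<lambda>x. infdist x S)"
proof (cases "S = {}")
  case False
  show ?thesis
  proof (rule convex_onI)
    fix t :: real and x y :: 'a assume t: "0 < t" "t < 1"
    show "infdist ((1 - t) *\<^sub>R x + t *\<^sub>R y) S \<le> (1 - t) * infdist x S + t * infdist y S"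
    proof (rule field_le_epsilon)
      fix e :: real assume e: "e > 0"
      obtain a where a: "a \<in> S" "dist x a < infdist x S + e"
        using cInf_lessD[of "dist x ` S" "infdist x S + e"] False e
        by (auto simp: infdist_notempty)
      obtain b where b: "b \<in> S" "dist y b < infdist y S + e"
        using cInf_lessD[of "dist y ` S" "infdist y S + e"] False e
        by (auto simp: infdist_notempty)
      have "(1 - t) *\<^sub>R a + t *\<^sub>R b \<in> S"
        using S a(1) b(1) t by (intro convexD) auto
      then have "infdist ((1 - t) *\<^sub>R x + t *\<^sub>R y) S
          \<le> dist ((1 - t) *\<^sub>R x + t *\<^sub>R y) ((1 - t) *\<^sub>R a + t *\<^sub>R b)"
        by (rule infdist_le)
      also have "\<dots> = norm ((1 - t) *\<^sub>R (x - a) + t *\<^sub>R (y - b))"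
        by (simp add: dist_norm algebra_simps)
      also have "\<dots> \<le> (1 - t) * dist x a + t * dist y b"
        using norm_triangle_ineq[of "(1 - t) *\<^sub>R (x - a)" "t *\<^sub>R (y - b)"] t
        by (simp add: dist_norm)
      also have "\<dots> \<le> (1 - t) * (infdist x S + e) + t * (infdist y S + e)"
        using a b t by (intro add_mono mult_left_mono) auto
      finally show "infdist ((1 - t) *\<^sub>R x + t *\<^sub>R y) S
          \<le> (1 - t) * infdist x S + t * infdist y S + e"
        by (simp add: algebra_simps)
    qed
  qed simp
qed (simp add: infdist_def convex_on_def)

text \<open>Any Clarke subgradient of the distance function to \<open>S\<close> separates a point from \<open>S\<close>.\<close>
lemma separate_point_closed_convex:
  fixes S :: "'a::real_normed_vector set"
  assumes S: "closed S" "convex S" and x: "x \<notin> S"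
  obtains f :: "'a \<Rightarrow>\<^sub>L real" and b where "\<And>y. y \<in> S \<Longrightarrow> f y \<le> b" "b < f x"
proof (cases "S = {}")
  case True
  then show ?thesis using that[of "0" "-1"] by simp
next
  case False
  define d where "d y = infdist y S" for y
  have "1-lipschitz_on UNIV d"
    by (rule lipschitz_onI) (simp_all add: d_def dist_real_def infdist_triangle_abs)
  then have d: "locally_lipschitz d"
    unfolding locally_lipschitz_def by (metis UNIV_I open_UNIV)
  have dx: "d x > 0"
    using False S(1) x unfolding d_def by (simp add: infdist_pos_not_in_closed)
  obtain \<xi> where \<xi>: "\<xi> \<in> clarke_subgradient d x"
    using clarke_subgradient_max[OF d] by blast
  show ?thesis
  proof (rule that)
    show "\<xi> x - d x < \<xi> x" using dx by simp
    fix y assume y: "y \<in> S"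
    \<comment> \<open>For convex \<open>d\<close>, a quotient with \<open>t < 1\<close> is at most
      the increment over the full step \<open>y - x\<close>, which tends to
      \<open>d y - d x = - d x\<close> as the base point tends to \<open>x\<close>.\<close>
    have "clarke_real d x (y - x) \<le> - d x"
    proof (rule field_le_epsilon)
      fix e :: real assume e: "e > 0"
      have "((\<lambda>w. d (w + (y - x)) - d w) \<longlongrightarrow> d (x + (y - x)) - d x) (nhds x)"
        unfolding d_def by (intro tendsto_intros filterlim_ident)
      moreover have "d (x + (y - x)) - d x = - d x" using y by (simp add: d_def)
      ultimately have "eventually (\<lambda>w. d (w + (y - x)) - d w < - d x + e) (nhds x)"
        using e by (intro order_tendstoD(2)) auto
      then have 1: "eventually (\<lambda>(w, t). d (w + (y - x)) - d w < - d x + e) (clarke_filter x)"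
        using eventually_compose_filterlim[OF _ filterlim_fst] by (fastforce simp: case_prod_unfold)
      have "eventually (\<lambda>t::real. t < 1) (at_right 0)"
        by (rule eventually_at_right_real[THEN eventually_mono, of 0 1]) auto
      then have 2: "eventually (\<lambda>(w, t). t < 1) (clarke_filter x)"
        using eventually_compose_filterlim[OF _ filterlim_snd] by (fastforce simp: case_prod_unfold)
      show "clarke_real d x (y - x) \<le> - d x + e"
      proof (rule clarke_real_le[OF d])
        show "eventually (\<lambda>(w, t). (d (w + t *\<^sub>R (y - x)) - d w) / t \<le> - d x + e)
            (clarke_filter x)"
          using 1 2 eventually_clarke_filter_pos
        proof eventually_elim
          case (elim p)
          obtain w t where p: "p = (w, t)" by fastforce
          have "w + t *\<^sub>R (y - x) = (1 - t) *\<^sub>R w + t *\<^sub>R (w + (y - x))"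
            by (simp add: algebra_simps)
          moreover have "d ((1 - t) *\<^sub>R w + t *\<^sub>R (w + (y - x)))
              \<le> (1 - t) * d w + t * d (w + (y - x))"
            using convex_onD[OF convex_on_infdist[OF S(2)], of t w "w + (y - x)"] elim p
            by (simp add: d_def)
          ultimately have "d (w + t *\<^sub>R (y - x)) - d w \<le> t * (d (w + (y - x)) - d w)"
            by (simp add: algebra_simps)
          then have "(d (w + t *\<^sub>R (y - x)) - d w) / t \<le> d (w + (y - x)) - d w"
            using elim p by (simp add: divide_le_eq mult.commute)
          then show ?case using elim p by simp
        qed
      qed
    qed
    then show "\<xi> y \<le> \<xi> x - d x"
      using \<xi> by (force simp: in_clarke_subgradient_iff[OF d] blinfun.diff_right dest!: spec[of _ "y - x"])
  qed
qed

section \<open>The weak topology of a reflexive space\<close>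

lemma topspace_weak_topology [simp]: "topspace weak_topology = UNIV"
  unfolding weak_topology_def topology_generated_by_topspace by (auto intro: exI[of _ UNIV])

lemma openin_weak_vimage:
  fixes f :: "'a::real_normed_vector \<Rightarrow>\<^sub>L real"
  shows "open U \<Longrightarrow> openin weak_topology (blinfun_apply f -` U)"
  unfolding weak_topology_def by (intro topology_generated_by_Basis) blast

lemma closedin_weak_vimage:
  fixes f :: "'a::real_normed_vector \<Rightarrow>\<^sub>L real"
  assumes "closed T"
  shows "closedin weak_topology (blinfun_apply f -` T)"
proof -
  have "UNIV - blinfun_apply f -` T = blinfun_apply f -` (- T)" by auto
  then show ?thesis
    unfolding closedin_def using openin_weak_vimage[of "- T" f] assms by (simp add: open_Compl)
qed

text \<open>Mazur's theorem: a separating functional puts each outside point into a weakly open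
  half-space disjoint from \<open>S\<close>.\<close>

lemma closedin_weak_closed_convex:
  fixes S :: "'a::real_normed_vector set"
  assumes "closed S" "convex S"
  shows "closedin weak_topology S"
proof -
  have "openin weak_topology (- S)"
  proof (subst openin_subopen, intro ballI)
    fix x assume "x \<in> - S"
    then obtain f :: "'a \<Rightarrow>\<^sub>L real" and b where "\<And>y. y \<in> S \<Longrightarrow> f y \<le> b" "b < f x"
      using separate_point_closed_convex[OF assms, of x] by auto
    then show "\<exists>T. openin weak_topology T \<and> x \<in> T \<and> T \<subseteq> - S"
      by (intro exI[of _ "blinfun_apply f -` {b<..}"]) (force intro: openin_weak_vimage)
  qed
  then show ?thesis by (simp add: closedin_def Compl_eq_Diff_UNIV)
qed

lemma weakly_tendsto_closedin:
  assumes "weakly_tendsto x a" "closedin weak_topology S" "\<And>n. x n \<in> S"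
  shows "a \<in> S"
  using limitin_closedin[of weak_topology x a sequentially S] assms
  by (simp add: weakly_tendsto_iff_limitin)

lemma weakly_tendsto_subseq:
  assumes "weakly_tendsto x a" "strict_mono r"
  shows "weakly_tendsto (x \<circ> r) a"
  using assms LIMSEQ_subseq_LIMSEQ unfolding weakly_tendsto_def by (fastforce simp: o_def)

lemma tendsto_imp_weakly_tendsto: "x \<longlonglongrightarrow> a \<Longrightarrow> weakly_tendsto x a"
  unfolding weakly_tendsto_def by (auto intro: blinfun.tendsto)

lemma weakly_tendsto_blinfun:
  fixes T :: "'a::real_normed_vector \<Rightarrow>\<^sub>L 'b::real_normed_vector"
  assumes "weakly_tendsto x a"
  shows "weakly_tendsto (\<lambda>n. T (x n)) (T a)"
  unfolding weakly_tendsto_def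
proof
  fix f :: "'b \<Rightarrow>\<^sub>L real"
  from assms have "(\<lambda>n. (f o\<^sub>L T) (x n)) \<longlonglongrightarrow> (f o\<^sub>L T) a" unfolding weakly_tendsto_def by blast
  then show "(\<lambda>n. f (T (x n))) \<longlonglongrightarrow> f (T a)" by simp
qed

lemma weakly_tendsto_unique_strong:
  fixes x :: "nat \<Rightarrow> 'a::real_normed_vector"
  assumes "weakly_tendsto x a" "x \<longlonglongrightarrow> b"
  shows "a = b"
proof -
  obtain f :: "'a \<Rightarrow>\<^sub>L real" where f: "f (a - b) = norm (a - b)"
    using norming_functional[of "a - b"] by blast
  have "(\<lambda>n. f (x n)) \<longlonglongrightarrow> f a" using assms(1) unfolding weakly_tendsto_def by blast
  moreover have "(\<lambda>n. f (x n)) \<longlonglongrightarrow> f b" by (intro blinfun.tendsto tendsto_const assms(2))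
  ultimately have "f a = f b" by (rule LIMSEQ_unique)
  then show ?thesis using f by (simp add: blinfun.diff_right)
qed

text \<open>A subsequence staying away from \<open>T a\<close> would have images with a strongly
  convergent further subsequence, whose limit must agree with the weak limit
  \<open>T a\<close>.\<close>

lemma compact_operator_weakly_tendsto:
  fixes T :: "'a::real_normed_vector \<Rightarrow>\<^sub>L 'b::real_normed_vector"
  assumes T: "compact_operator T" and x: "weakly_tendsto x a" and bd: "bounded (range x)"
  shows "(\<lambda>n. T (x n)) \<longlonglongrightarrow> T a"
proof (rule ccontr)
  assume "\<not> ?thesis"
  then obtain e where e: "e > 0" "\<exists>\<^sub>F n in sequentially. e \<le> dist (T (x n)) (T a)"
    unfolding tendsto_iff by (auto simp: frequently_def not_le)
  from e(2) have "infinite {n. e \<le> dist (T (x n)) (T a)}"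
    using frequently_cofinite[of "\<lambda>n. e \<le> dist (T (x n)) (T a)"]
    by (metis cofinite_eq_sequentially)
  then obtain r :: "nat \<Rightarrow> nat" where r: "strict_mono r" "\<And>n. e \<le> dist (T (x (r n))) (T a)"
    using infinite_enumerate[of "{n. e \<le> dist (T (x n)) (T a)}"] by blast
  let ?K = "closure (blinfun_apply T ` range x)"
  have "compact ?K" using T bd unfolding compact_operator_def by blast
  moreover have "T (x (r n)) \<in> ?K" for n
    by (rule subsetD[OF closure_subset]) blast
  ultimately obtain b s where b: "strict_mono s" "((\<lambda>n. T (x (r n))) \<circ> s) \<longlonglongrightarrow> b"
    using seq_compactE[of ?K "\<lambda>n. T (x (r n))"] unfolding compact_eq_seq_compact_metric by blast
  have "weakly_tendsto ((\<lambda>n. T (x (r n))) \<circ> s) (T a)"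
    using weakly_tendsto_subseq[OF weakly_tendsto_blinfun[OF weakly_tendsto_subseq[OF x r(1)], of T] b(1)]
    by (simp add: o_def)
  then have "T a = b" using b(2) by (rule weakly_tendsto_unique_strong)
  with b(2) e(1) obtain n where "dist (T (x (r (s n)))) (T a) < e"
    unfolding lim_sequentially o_def by blast
  with r(2)[of "s n"] show False by simp
qed

text \<open>Banach-Alaoglu in the bidual, carried to the space by reflexivity. Elements of the
  bidual are kept as plain functions, so Tychonoff's theorem applies to a product of intervals, in
  which the linear ones form a closed set.\<close>

theorem compactin_weak_cball:
  assumes refl: "reflexive_space TYPE('a::real_normed_vector)"
  shows "compactin weak_topology (cball (0 :: 'a) R)"
proof (cases "R \<ge> 0")
  case R: True
  define P where "P = (PiE UNIV (\<lambda>f :: 'a \<Rightarrow>\<^sub>L real. {- (R * norm f) .. R * norm f}))"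
  have "compactin (product_topology (\<lambda>i. euclidean) UNIV) P"
    unfolding P_def compactin_PiE by simp
  then have P: "compact P" by (simp add: euclidean_product_topology)
  define T where "T = P \<inter> (\<Inter>f. \<Inter>g. \<Inter>c. {\<phi>. \<phi> (f + c *\<^sub>R g) = \<phi> f + c * \<phi> g})"
  have cl: "closed {\<phi> :: ('a \<Rightarrow>\<^sub>L real) \<Rightarrow> real. \<phi> (f + c *\<^sub>R g) = \<phi> f + c * \<phi> g}" for f g c
    by (intro closed_Collect_eq continuous_intros continuous_on_product_coordinates)
  have T: "compact T"
    unfolding T_def by (intro compact_Int_closed P closed_INT ballI cl)
  have bd: "\<bar>\<phi> f\<bar> \<le> R * norm f" if "\<phi> \<in> T" for \<phi> f
    using that by (auto simp: T_def P_def PiE_def Pi_def abs_le_iff minus_le_iff)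
  have "\<exists>x :: 'a. \<forall>f. \<phi> f = blinfun_apply f x" if "\<phi> \<in> T" for \<phi>
  proof -
    have lin: "\<phi> (f + c *\<^sub>R g) = \<phi> f + c * \<phi> g" for f c g using that unfolding T_def by blast
    have "\<phi> 0 = 0" using lin[of 0 1 0] by simp
    then have "bounded_linear \<phi>"
      using lin[of _ 1] lin[of 0] bd[OF that]
      by (intro bounded_linear_intro[of \<phi> R]) (simp_all add: mult.commute)
    then have "blinfun_apply (Blinfun \<phi>) = \<phi>" by (rule bounded_linear_Blinfun_apply)
    then show ?thesis using refl unfolding reflexive_space_def by metis
  qed
  \<comment> \<open>\<open>i\<close> inverts the evaluation embedding. It is continuous because the
    coordinate of \<open>\<phi>\<close> at \<open>f\<close> is \<open>f (i \<phi>)\<close>, so that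
    subbasic sets pull back to open sets.\<close>
  then obtain i :: "(('a \<Rightarrow>\<^sub>L real) \<Rightarrow> real) \<Rightarrow> 'a"
    where i: "\<And>\<phi> f. \<phi> \<in> T \<Longrightarrow> \<phi> f = blinfun_apply f (i \<phi>)" by metis
  have "continuous_map (subtopology euclidean T) weak_topology i"
    unfolding weak_topology_def
  proof (rule continuous_on_generated_topo)
    fix W assume "W \<in> {blinfun_apply f -` U | (f :: 'a \<Rightarrow>\<^sub>L real) U. open U}"
    then obtain f :: "'a \<Rightarrow>\<^sub>L real" and U where W: "W = blinfun_apply f -` U" "open U" by blast
    have "open ((\<lambda>\<phi> :: ('a \<Rightarrow>\<^sub>L real) \<Rightarrow> real. \<phi> f) -` U)"
      by (intro open_vimage W(2) continuous_on_product_coordinates)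
    moreover have "i -` W \<inter> T = T \<inter> ((\<lambda>\<phi>. \<phi> f) -` U)"
      using i by (auto simp: W(1))
    ultimately show "openin (subtopology euclidean T) (i -` W \<inter> topspace (subtopology euclidean T))"
      by (auto simp: openin_open)
  qed (auto intro: exI[of _ UNIV])
  then have "compactin weak_topology (i ` T)"
    using image_compactin[of "subtopology euclidean T" T weak_topology i] T
    by (simp add: compactin_subtopology)
  moreover have "cball 0 R \<subseteq> i ` T"
  proof
    fix x :: 'a assume x: "x \<in> cball 0 R"
    define \<phi> where "\<phi> = (\<lambda>f :: 'a \<Rightarrow>\<^sub>L real. blinfun_apply f x)"
    have "\<bar>\<phi> f\<bar> \<le> R * norm f" for f
    proof -
      have "norm (blinfun_apply f x) \<le> norm f * norm x" by (rule norm_blinfun)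
      also have "\<dots> \<le> norm f * R" using x by (intro mult_left_mono) auto
      finally show ?thesis by (simp add: \<phi>_def mult.commute)
    qed
    then have \<phi>: "\<phi> \<in> T"
      unfolding T_def P_def
      by (auto simp: abs_le_iff minus_le_iff) (auto simp: \<phi>_def blinfun.bilinear_simps)
    have "i \<phi> = x"
    proof -
      obtain f :: "'a \<Rightarrow>\<^sub>L real" where f: "f (i \<phi> - x) = norm (i \<phi> - x)"
        using norming_functional[of "i \<phi> - x"] by blast
      moreover have "f (i \<phi>) = f x" using i[OF \<phi>, of f] by (simp add: \<phi>_def)
      ultimately show ?thesis by (simp add: blinfun.diff_right)
    qed
    with \<phi> show "x \<in> i ` T" by blast
  qed
  ultimately show ?thesis
    using closedin_weak_closed_convex[of "cball (0 :: 'a) R"] by (metis closed_compactin closed_cball convex_cball)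
qed simp

corollary compactin_weak_closedin:
  fixes S :: "'a::real_normed_vector set"
  assumes refl: "reflexive_space TYPE('a)" and "bounded S" "closedin weak_topology S"
  shows "compactin weak_topology S"
proof -
  obtain R where "S \<subseteq> cball 0 R"
    using bounded_normE[OF assms(2)] by (metis mem_cball_0 subsetI)
  then show ?thesis using closed_compactin[OF compactin_weak_cball[OF refl]] assms(3) by blast
qed

text \<open>The hull of a finite set is totally bounded, so finitely many functionals norm the
  differences of a \<open>d\<close>-net from \<open>a\<close>; every \<open>z - a\<close> is then
  normed up to an error of order \<open>d\<close>.\<close>

lemma finite_norming_net:
  fixes Y :: "'a::real_normed_vector set"
  assumes "finite Y" "d > 0"
  obtains \<Phi> :: "('a \<Rightarrow>\<^sub>L real) set" where "finite \<Phi>"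
    "\<And>z. z \<in> convex hull Y \<Longrightarrow>
      \<exists>z'. \<exists>f\<in>\<Phi>. dist z z' < d \<and> blinfun_apply f (z' - a) = norm (z' - a) \<and> norm f \<le> 1"
proof -
  have "compact (convex hull Y)" using assms(1) by (rule finite_imp_compact_convex_hull)
  then obtain K where K: "finite K" "convex hull Y \<subseteq> (\<Union>x\<in>K. ball x d)"
    using assms(2) unfolding compact_eq_totally_bounded by blast
  obtain g :: "'a \<Rightarrow> 'a \<Rightarrow>\<^sub>L real" where g: "\<And>x. g x x = norm x" "\<And>x. norm (g x) \<le> 1"
    using norming_functional by metis
  show ?thesis
  proof (rule that[of "(\<lambda>z'. g (z' - a)) ` K"])
    show "finite ((\<lambda>z'. g (z' - a)) ` K)" using K(1) by simp
    fix z assume "z \<in> convex hull Y"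
    then obtain z' where "z' \<in> K" "dist z z' < d" using K(2) by (auto simp: dist_commute)
    then show "\<exists>z'. \<exists>f\<in>(\<lambda>z'. g (z' - a)) ` K.
        dist z z' < d \<and> blinfun_apply f (z' - a) = norm (z' - a) \<and> norm f \<le> 1"
      using g by blast
  qed
qed

text \<open>The sequence is built together with a countable set of functionals that norms the closed
  convex hull of the sequence relative to \<open>a\<close>, so that \<open>a\<close> is its only weak cluster point
  (Whitley's proof of the Eberlein--Smulian theorem).\<close>
lemma weak_closure_sequence:
  fixes M :: "'a::real_normed_vector set"
  assumes refl: "reflexive_space TYPE('a)" and bd: "bounded M"
    and near: "\<And>\<Phi> e. finite (\<Phi> :: ('a \<Rightarrow>\<^sub>L real) set) \<Longrightarrow> e > 0 \<Longrightarrow> \<exists>y\<in>M. \<forall>f\<in>\<Phi>. \<bar>f y - f a\<bar> < e"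
  obtains y where "\<And>n. y n \<in> M" "weakly_tendsto y a"
proof -
  define net where "net n Y (\<Phi> :: ('a \<Rightarrow>\<^sub>L real) set) \<longleftrightarrow> (\<forall>z\<in>convex hull Y.
      \<exists>z'. \<exists>f\<in>\<Phi>. dist z z' < inverse (real (Suc n)) \<and> blinfun_apply f (z' - a) = norm (z' - a) \<and> norm f \<le> 1)"
    for n Y \<Phi>
  have net_ex: "\<exists>\<Phi>. finite \<Phi> \<and> net n Y \<Phi>" if "finite Y" for n Y
    using finite_norming_net[OF that, of "inverse (real (Suc n))"] unfolding net_def
    by (metis inverse_positive_iff_positive of_nat_0_less_iff zero_less_Suc)
  \<comment> \<open>\<open>Q\<close> makes each new point agree with \<open>a\<close>, ever more
    closely, on all functionals chosen so far; \<open>P\<close> keeps these rich enough to norm the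
    hull of the points chosen so far.\<close>
  define P where "P = (\<lambda>n (Y, \<Phi>, y). finite Y \<and> finite \<Phi> \<and> y \<in> M \<and> y \<in> Y \<and> net n Y \<Phi>)"
  define Q where "Q = (\<lambda>n (Y :: 'a set, \<Phi>, y :: 'a) (Y', \<Phi>', y'). Y \<subseteq> Y' \<and> \<Phi> \<subseteq> \<Phi>' \<and>
      (\<forall>f\<in>\<Phi>. \<bar>blinfun_apply f y' - f a\<bar> < inverse (real (Suc n))))"
  have "\<exists>s. \<forall>n. P n (s n) \<and> Q n (s n) (s (Suc n))"
  proof (rule dependent_nat_choice)
    obtain y where "y \<in> M" using near[of "{}" 1] by auto
    moreover obtain \<Phi> where "finite \<Phi>" "net 0 {y} \<Phi>" using net_ex[of "{y}" 0] by auto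
    ultimately have "P 0 ({y}, \<Phi>, y)" by (simp add: P_def)
    then show "\<exists>s. P 0 s" by blast
  next
    fix s n assume s: "P n s"
    obtain Y \<Phi> y0 where s_eq: "s = (Y, \<Phi>, y0)" by (cases s)
    with s have fin: "finite Y" "finite \<Phi>" by (auto simp: P_def)
    obtain y where y: "y \<in> M" "\<forall>f\<in>\<Phi>. \<bar>f y - f a\<bar> < inverse (real (Suc n))"
      using near[OF fin(2), of "inverse (real (Suc n))"] by auto
    obtain \<Phi>' where \<Phi>': "finite \<Phi>'" "net (Suc n) (insert y Y) \<Phi>'"
      using net_ex[of "insert y Y" "Suc n"] fin by auto
    then have "net (Suc n) (insert y Y) (\<Phi> \<union> \<Phi>')" unfolding net_def by blast
    then have "P (Suc n) (insert y Y, \<Phi> \<union> \<Phi>', y)" using fin y(1) \<Phi>'(1) by (simp add: P_def)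
    moreover have "Q n s (insert y Y, \<Phi> \<union> \<Phi>', y)" using y(2) by (auto simp: Q_def s_eq)
    ultimately show "\<exists>s'. P (Suc n) s' \<and> Q n s s'" by blast
  qed
  then obtain s where s: "\<And>n. P n (s n)" "\<And>n. Q n (s n) (s (Suc n))" by blast
  define Y \<Phi> y where "Y n = fst (s n)" and "\<Phi> n = fst (snd (s n))" and "y n = snd (snd (s n))" for n
  have s_eq: "s n = (Y n, \<Phi> n, y n)" for n by (simp add: Y_def \<Phi>_def y_def)
  have Pn: "finite (Y n)" "finite (\<Phi> n)" "y n \<in> M" "y n \<in> Y n" "net n (Y n) (\<Phi> n)" for n
    using s(1)[of n] by (simp_all add: P_def s_eq)
  have Qn: "Y n \<subseteq> Y (Suc n)" "\<Phi> n \<subseteq> \<Phi> (Suc n)"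
    "\<And>f. f \<in> \<Phi> n \<Longrightarrow> \<bar>f (y (Suc n)) - f a\<bar> < inverse (real (Suc n))" for n
    using s(2)[of n] by (simp_all add: Q_def s_eq)
  have Y_mono: "Y m \<subseteq> Y n" if "m \<le> n" for m n using Qn(1) that by (rule lift_Suc_mono_le)
  have \<Phi>_mono: "\<Phi> m \<subseteq> \<Phi> n" if "m \<le> n" for m n using Qn(2) that by (rule lift_Suc_mono_le)
  have conv: "(\<lambda>n. f (y n)) \<longlonglongrightarrow> f a" if f: "f \<in> \<Phi> m" for f m
  proof -
    have "(\<lambda>n. f (y (Suc n)) - f a) \<longlonglongrightarrow> 0"
    proof (rule tendsto_rabs_zero_cancel, rule tendsto_sandwich[OF _ _ tendsto_const])
      show "eventually (\<lambda>n. \<bar>f (y (Suc n)) - f a\<bar> \<le> inverse (real (Suc n))) sequentially"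
        using eventually_ge_at_top[of m]
        by eventually_elim (use Qn(3) \<Phi>_mono f in \<open>meson less_imp_le subsetD\<close>)
    qed (use LIMSEQ_inverse_real_of_nat in auto)
    then have "(\<lambda>n. f (y (Suc n))) \<longlonglongrightarrow> f a" by (simp add: LIM_zero_iff)
    then show ?thesis by (rule LIMSEQ_imp_Suc)
  qed
  define L where "L = closure (\<Union>n. convex hull Y n)"
  have "convex (\<Union>n. convex hull Y n)"
  proof (rule convexI)
    fix p q and u v :: real
    assume pq: "p \<in> (\<Union>n. convex hull Y n)" "q \<in> (\<Union>n. convex hull Y n)"
      and uv: "0 \<le> u" "0 \<le> v" "u + v = 1"
    from pq obtain m n where "p \<in> convex hull Y m" "q \<in> convex hull Y n" by blast
    then have "p \<in> convex hull Y (max m n)" "q \<in> convex hull Y (max m n)"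
      using hull_mono[OF Y_mono] by (meson max.cobounded1 max.cobounded2 subsetD)+
    then have "u *\<^sub>R p + v *\<^sub>R q \<in> convex hull Y (max m n)"
      using convexD[OF convex_convex_hull] uv by blast
    then show "u *\<^sub>R p + v *\<^sub>R q \<in> (\<Union>n. convex hull Y n)" by blast
  qed
  then have L: "closedin weak_topology L"
    unfolding L_def by (intro closedin_weak_closed_convex closed_closure convex_closure)
  have yL: "y n \<in> L" for n
    unfolding L_def by (rule subsetD[OF closure_subset]) (use Pn(4)[of n] in \<open>auto intro: hull_inc\<close>)
  \<comment> \<open>A point \<open>p\<close> of \<open>L\<close> is close to a hull point
    \<open>z\<close>, hence to a net point \<open>z'\<close> normed by some chosen \<open>f\<close>.
    As \<open>f\<close> does not distinguish \<open>p\<close> from \<open>a\<close>, the distance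
    from \<open>z'\<close> to \<open>a\<close> is at most that from \<open>z'\<close> to
    \<open>p\<close>.\<close>
  have only: "p = a" if p: "p \<in> L" and pf: "\<And>m f. f \<in> \<Phi> m \<Longrightarrow> f p = f a" for p
  proof -
    have "norm (p - a) \<le> 0 + e" if e: "e > 0" for e
    proof -
      obtain z m where z: "z \<in> convex hull Y m" "dist z p < e / 4"
        using p[unfolded L_def closure_approachable, rule_format, of "e / 4"] e by auto
      obtain k where k: "inverse (real (Suc k)) < e / 4"
        using reals_Archimedean[of "e / 4"] e by auto
      define n where "n = max m k"
      have "inverse (real (Suc n)) \<le> inverse (real (Suc k))"
        by (simp add: n_def le_imp_inverse_le)
      from this k have n: "inverse (real (Suc n)) < e / 4" by (rule le_less_trans)
      have "z \<in> convex hull Y n"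
        using z(1) hull_mono[OF Y_mono[of m n]] by (auto simp: n_def)
      then obtain z' f where z': "f \<in> \<Phi> n" "dist z z' < inverse (real (Suc n))"
        "f (z' - a) = norm (z' - a)" "norm f \<le> 1"
        using Pn(5)[of n] unfolding net_def by blast
      have zp: "norm (z' - p) < e / 2"
        using z(2) z'(2) n dist_triangle[of z' p z] by (simp add: dist_norm norm_minus_commute)
      have "norm (z' - a) = f (z' - p)"
        using z'(3) pf[OF z'(1)] by (simp add: blinfun.diff_right)
      also have "\<dots> \<le> norm f * norm (z' - p)" using norm_blinfun[of f "z' - p"] by simp
      also have "\<dots> \<le> norm (z' - p)" using z'(4) by (simp add: mult_left_le_one_le)
      finally show ?thesis
        using zp norm_triangle_ineq4[of "z' - a" "z' - p"] by simp
    qed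
    then have "norm (p - a) \<le> 0" by (rule field_le_epsilon)
    then show ?thesis by simp
  qed
  obtain R where R: "M \<subseteq> cball 0 R" using bounded_normE[OF bd] by (metis mem_cball_0 subsetI)
  have "weakly_tendsto y a"
    unfolding weakly_tendsto_def
  proof (rule allI, rule ccontr)
    fix f0 :: "'a \<Rightarrow>\<^sub>L real"
    assume "\<not> (\<lambda>n. f0 (y n)) \<longlonglongrightarrow> f0 a"
    then obtain e where e: "e > 0" "\<exists>\<^sub>F n in sequentially. e \<le> \<bar>f0 (y n) - f0 a\<bar>"
      unfolding tendsto_iff by (auto simp: frequently_def not_le dist_real_def)
    \<comment> \<open>Infinitely many \<open>y n\<close> lie in \<open>A\<close>, so compactness of
      the ball yields a point \<open>p\<close> of \<open>L\<close> in \<open>A\<close> at which all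
      chosen functionals take the same value as at \<open>a\<close>. Such a \<open>p\<close> equals
      \<open>a\<close>, which is not in \<open>A\<close>.\<close>
    define A where "A = blinfun_apply f0 -` {r. e \<le> \<bar>r - f0 a\<bar>}"
    define \<U>' where "\<U>' = insert L
      {blinfun_apply g -` cball (g a) (inverse (real (Suc k))) | g k m. g \<in> \<Phi> m}"
    have "closedin weak_topology A"
      unfolding A_def by (intro closedin_weak_vimage closed_Collect_le continuous_intros)
    moreover have "closedin weak_topology U" if "U \<in> \<U>'" for U
      using that L closedin_weak_vimage[OF closed_cball] unfolding \<U>'_def by fastforce
    moreover have "cball 0 R \<inter> \<Inter>\<F> \<noteq> {}" if \<F>: "finite \<F>" "\<F> \<subseteq> insert A \<U>'" for \<F>
    proof -
      have "eventually (\<lambda>n. y n \<in> U) sequentially" if "U \<in> \<U>'" for U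
        using that unfolding \<U>'_def
      proof (elim insertE CollectE exE conjE)
        fix g k m assume U: "U = blinfun_apply g -` cball (g a) (inverse (real (Suc k)))"
          and g: "g \<in> \<Phi> m"
        from tendstoD[OF conv[OF g], of "inverse (real (Suc k))"]
        show ?thesis by (auto simp: U dist_commute elim!: eventually_mono)
      qed (simp add: yL)
      then have "eventually (\<lambda>n. \<forall>U\<in>\<F> - {A}. y n \<in> U) sequentially"
        using \<F> by (intro eventually_ball_finite) auto
      then have "\<exists>\<^sub>F n in sequentially. e \<le> \<bar>f0 (y n) - f0 a\<bar> \<and> (\<forall>U\<in>\<F> - {A}. y n \<in> U)"
        by (intro frequently_rev_mp[OF e(2)]) (auto elim!: eventually_mono)
      then obtain n where "e \<le> \<bar>f0 (y n) - f0 a\<bar>" "\<forall>U\<in>\<F> - {A}. y n \<in> U"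
        using frequently_ex by blast
      then have "y n \<in> cball 0 R \<inter> \<Inter>\<F>" using Pn(3)[of n] R by (auto simp: A_def)
      then show ?thesis by blast
    qed
    ultimately have "cball 0 R \<inter> \<Inter>(insert A \<U>') \<noteq> {}"
      using compactin_weak_cball[OF refl, of R, unfolded compactin_fip] by blast
    then obtain p where p: "p \<in> A" "\<And>U. U \<in> \<U>' \<Longrightarrow> p \<in> U" by blast
    have "g p = g a" if g: "g \<in> \<Phi> m" for g m
    proof -
      have "\<bar>g p - g a\<bar> < d" if d: "d > 0" for d
      proof -
        obtain k where k: "inverse (real (Suc k)) < d" using reals_Archimedean[OF d] by blast
        have "p \<in> blinfun_apply g -` cball (g a) (inverse (real (Suc k)))"
          using g by (intro p(2)) (auto simp: \<U>'_def)
        with k show ?thesis by (simp add: dist_real_def abs_minus_commute)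
      qed
      from this[of "\<bar>g p - g a\<bar>"] show ?thesis by fastforce
    qed
    moreover have "p \<in> L" by (rule p(2)) (simp add: \<U>'_def)
    ultimately have "p = a" using only by blast
    with p(1) e(1) show False by (simp add: A_def)
  qed
  with Pn(3) show ?thesis using that by blast
qed

text \<open>The hypotheses on the operators are sequential, whereas the finite intersection property
  needs weakly closed sets. If every basic weak neighbourhood of \<open>a\<close> met
  \<open>M\<close>, some sequence in \<open>M\<close> would tend weakly to \<open>a\<close>.\<close>

theorem weakly_sequentially_closed_imp_closedin:
  fixes M :: "'a::real_normed_vector set"
  assumes refl: "reflexive_space TYPE('a)" and bd: "bounded M"
    and seq: "\<And>y a. (\<And>n. y n \<in> M) \<Longrightarrow> weakly_tendsto y a \<Longrightarrow> a \<in> M"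
  shows "closedin weak_topology M"
proof -
  have "openin weak_topology (- M)"
  proof (subst openin_subopen, intro ballI)
    fix a assume a: "a \<in> - M"
    have "\<exists>\<Phi> e. finite (\<Phi> :: ('a \<Rightarrow>\<^sub>L real) set) \<and> e > 0 \<and> (\<forall>y\<in>M. \<exists>f\<in>\<Phi>. e \<le> \<bar>f y - f a\<bar>)"
    proof (rule ccontr)
      assume "\<not> ?thesis"
      then have "\<exists>y\<in>M. \<forall>f\<in>\<Phi>. \<bar>f y - f a\<bar> < e"
        if "finite (\<Phi> :: ('a \<Rightarrow>\<^sub>L real) set)" "e > 0" for \<Phi> e
        using that by (metis not_less)
      from weak_closure_sequence[OF refl bd this] seq a show False by (metis ComplD)
    qed
    then obtain \<Phi> e where \<Phi>: "finite (\<Phi> :: ('a \<Rightarrow>\<^sub>L real) set)" "e > 0"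
      "\<And>y. y \<in> M \<Longrightarrow> \<exists>f\<in>\<Phi>. e \<le> \<bar>f y - f a\<bar>" by blast
    let ?T = "UNIV \<inter> (\<Inter>f\<in>\<Phi>. blinfun_apply f -` ball (f a) e)"
    have "openin weak_topology ?T"
    proof (cases "\<Phi> = {}")
      case True
      then show ?thesis using openin_topspace[of "weak_topology :: 'a topology"] by simp
    next
      case False
      then show ?thesis using \<Phi>(1) by (simp add: openin_INT2 openin_weak_vimage)
    qed
    moreover have "?T \<subseteq> - M" using \<Phi>(3) by (force simp: dist_real_def abs_minus_commute)
    ultimately show "\<exists>T. openin weak_topology T \<and> a \<in> T \<and> T \<subseteq> - M" using \<Phi>(2) by fastforce
  qed
  then show ?thesis by (simp add: closedin_def Compl_eq_Diff_UNIV)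
qed

section \<open>Fixed points of Brouwer and Schauder\<close>

text \<open>The cube sits in the space of sequences with the coordinates from \<open>n\<close> on
  frozen at 0; compactness and convergence are those of the product topology.\<close>

definition nat_cube :: "nat \<Rightarrow> (nat \<Rightarrow> real) set" where
  "nat_cube n = (\<Pi>\<^sub>E i\<in>UNIV. if i < n then {0..1} else {0})"

lemma in_nat_cube_iff: "x \<in> nat_cube n \<longleftrightarrow> (\<forall>i. if i < n then 0 \<le> x i \<and> x i \<le> 1 else x i = 0)"
  by (auto simp: nat_cube_def PiE_iff split: if_splits)

lemma compact_nat_cube: "compact (nat_cube n)"
proof -
  have "compactin (product_topology (\<lambda>i. euclidean) UNIV) (nat_cube n)"
    unfolding nat_cube_def compactin_PiE by simp
  then show ?thesis by (simp add: euclidean_product_topology)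
qed

lemma tendsto_fun_iff:
  fixes f :: "'c \<Rightarrow> 'i \<Rightarrow> 'a::topological_space"
  shows "(f \<longlongrightarrow> l) F \<longleftrightarrow> (\<forall>i. ((\<lambda>x. f x i) \<longlongrightarrow> l i) F)"
  using limitin_componentwise[of "\<lambda>i. euclidean" "UNIV :: 'i set" f l F]
  by (simp add: euclidean_product_topology)

lemma continuous_on_coordinate [continuous_intros]: "continuous_on S (\<lambda>x. x i)"
  by (rule continuous_on_product_then_coordinatewise[OF continuous_on_id])

text \<open>Kuhn's combinatorial lemma on the grid of mesh \<open>1 / p\<close>. Each coordinate
  \<open>i\<close> has its own two points near the common \<open>y\<close>: at one \<open>F\<close>
  does not decrease that coordinate, at the other it does not increase it.\<close>

lemma kuhn_approximation:
  assumes F: "\<And>x. x \<in> nat_cube n \<Longrightarrow> F x \<in> nat_cube n" and p: "p > 0"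
  shows "\<exists>y\<in>nat_cube n. \<exists>a b. \<forall>i<n. a i \<in> nat_cube n \<and> b i \<in> nat_cube n \<and>
    (\<forall>j. \<bar>a i j - y j\<bar> \<le> 1 / real p \<and> \<bar>b i j - y j\<bar> \<le> 1 / real p) \<and>
    a i i \<le> F (a i) i \<and> F (b i) i \<le> b i i"
proof -
  define Y where "Y x i = (if i < n then real (x i) / real p else 0)" for x :: "nat \<Rightarrow> nat" and i
  have Y: "Y x \<in> nat_cube n" if "\<forall>i<n. x i \<le> p" for x
    using that p by (auto simp: in_nat_cube_iff Y_def)
  \<comment> \<open>Kuhn's lemma prescribes the labels on the faces; they agree with the direction
    in which \<open>F\<close> moves because \<open>F\<close> maps the cube into itself.\<close>
  define label where "label x i =
    (if x i = 0 then 0 else if x i = p then 1 else if Y x i \<le> F (Y x) i then 0 else (1 :: nat))" for x i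
  have lab: "if label x i = 0 then Y x i \<le> F (Y x) i else F (Y x) i \<le> Y x i"
    if "\<forall>i<n. x i \<le> p" "i < n" for x i
    using F[OF Y[OF that(1)]] that p by (auto simp: label_def in_nat_cube_iff Y_def)
  obtain q where q: "\<forall>i<n. q i < p" and ex: "\<forall>i<n. \<exists>r s.
      (\<forall>j<n. q j \<le> r j \<and> r j \<le> q j + 1) \<and> (\<forall>j<n. q j \<le> s j \<and> s j \<le> q j + 1) \<and> label r i \<noteq> label s i"
    by (rule kuhn_lemma[of p n label]) (use p in \<open>auto simp: label_def\<close>)
  have close: "\<bar>Y r j - Y q j\<bar> \<le> 1 / real p" if "\<forall>j<n. q j \<le> r j \<and> r j \<le> q j + 1" for r j
    using that p by (auto simp: Y_def divide_right_mono simp flip: diff_divide_distrib dest!: spec[of _ j])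
  have le: "\<forall>j<n. r j \<le> p" if "\<forall>j<n. q j \<le> r j \<and> r j \<le> q j + 1" for r
    using that q by (metis Suc_eq_plus1 Suc_leI le_trans)
  have "\<exists>a b. a \<in> nat_cube n \<and> b \<in> nat_cube n \<and>
      (\<forall>j. \<bar>a j - Y q j\<bar> \<le> 1 / real p \<and> \<bar>b j - Y q j\<bar> \<le> 1 / real p) \<and> a i \<le> F a i \<and> F b i \<le> b i"
    if i: "i < n" for i
  proof -
    obtain r s where r: "\<forall>j<n. q j \<le> r j \<and> r j \<le> q j + 1"
      and s: "\<forall>j<n. q j \<le> s j \<and> s j \<le> q j + 1" and rs: "label r i \<noteq> label s i"
      using ex i by blast
    note lr = lab[OF le[OF r] i] and ls = lab[OF le[OF s] i]
    show ?thesis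
    proof (cases "label r i = 0")
      case True
      then show ?thesis
        using lr ls rs Y[OF le[OF r]] Y[OF le[OF s]] close[OF r] close[OF s]
        by (intro exI[of _ "Y r"] exI[of _ "Y s"]) auto
    next
      case False
      then have "label s i = 0" using rs by (auto simp: label_def split: if_splits)
      then show ?thesis
        using False lr ls Y[OF le[OF r]] Y[OF le[OF s]] close[OF r] close[OF s]
        by (intro exI[of _ "Y s"] exI[of _ "Y r"]) auto
    qed
  qed
  then obtain a b where "\<forall>i<n. a i \<in> nat_cube n \<and> b i \<in> nat_cube n \<and>
      (\<forall>j. \<bar>a i j - Y q j\<bar> \<le> 1 / real p \<and> \<bar>b i j - Y q j\<bar> \<le> 1 / real p) \<and>
      a i i \<le> F (a i) i \<and> F (b i) i \<le> b i i"
    by metis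
  moreover have "Y q \<in> nat_cube n" using q by (intro Y) (simp add: less_imp_le)
  ultimately show ?thesis by blast
qed

text \<open>The library's Brouwer theorem is tied to a type of fixed dimension; here the dimension is a
  natural number.\<close>
theorem brouwer_nat_cube:
  assumes cont: "continuous_on (nat_cube n) F" and F: "\<And>x. x \<in> nat_cube n \<Longrightarrow> F x \<in> nat_cube n"
  obtains x where "x \<in> nat_cube n" "F x = x"
proof -
  define R where "R m y a b \<longleftrightarrow> y \<in> nat_cube n \<and> (\<forall>i<n. a i \<in> nat_cube n \<and> b i \<in> nat_cube n \<and>
      (\<forall>j. \<bar>a i j - y j\<bar> \<le> 1 / real (Suc m) \<and> \<bar>b i j - y j\<bar> \<le> 1 / real (Suc m)) \<and>
      a i i \<le> F (a i) i \<and> F (b i) i \<le> b i i)" for m y and a b :: "nat \<Rightarrow> nat \<Rightarrow> real"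
  have "\<exists>y a b. R m y a b" for m
    unfolding R_def using kuhn_approximation[of n F "Suc m", OF F] by blast
  then obtain y a b where "\<And>m. R m (y m) (a m) (b m)" by metis
  then have y: "\<And>m. y m \<in> nat_cube n"
    and ab: "\<And>m i. i < n \<Longrightarrow> a m i \<in> nat_cube n" "\<And>m i. i < n \<Longrightarrow> b m i \<in> nat_cube n"
      "\<And>m i j. i < n \<Longrightarrow> \<bar>a m i j - y m j\<bar> \<le> 1 / real (Suc m)"
      "\<And>m i j. i < n \<Longrightarrow> \<bar>b m i j - y m j\<bar> \<le> 1 / real (Suc m)"
      "\<And>m i. i < n \<Longrightarrow> a m i i \<le> F (a m i) i"
      "\<And>m i. i < n \<Longrightarrow> F (b m i) i \<le> b m i i"
    unfolding R_def by blast+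
  obtain l r where l: "l \<in> nat_cube n" "strict_mono r" "(y \<circ> r) \<longlonglongrightarrow> l"
    using seq_compactE[OF compact_imp_seq_compact[OF compact_nat_cube], of y n] y by blast
  have inv: "(\<lambda>m. 1 / real (Suc (r m))) \<longlonglongrightarrow> 0"
    using LIMSEQ_subseq_LIMSEQ[OF LIMSEQ_inverse_real_of_nat l(2)]
    by (simp add: o_def inverse_eq_divide)
  \<comment> \<open>Every choice of nearby points shares the limit \<open>l\<close>, so in the limit
    the two inequalities for each coordinate meet at \<open>l\<close>.\<close>
  have lim: "(\<lambda>m. c (r m)) \<longlonglongrightarrow> l"
    if "\<And>m j. \<bar>c m j - y m j\<bar> \<le> 1 / real (Suc m)" for c :: "nat \<Rightarrow> nat \<Rightarrow> real"
    unfolding tendsto_fun_iff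
  proof
    fix j
    have "(\<lambda>m. c (r m) j - y (r m) j) \<longlonglongrightarrow> 0"
      by (rule tendsto_rabs_zero_cancel, rule tendsto_sandwich[OF _ _ tendsto_const inv])
        (use that in auto)
    moreover have "(\<lambda>m. y (r m) j) \<longlonglongrightarrow> l j" using l(3) by (simp add: tendsto_fun_iff o_def)
    ultimately show "(\<lambda>m. c (r m) j) \<longlonglongrightarrow> l j" using tendsto_add by fastforce
  qed
  have limF: "(\<lambda>m. F (c (r m))) \<longlonglongrightarrow> F l"
    if "(\<lambda>m. c (r m)) \<longlonglongrightarrow> l" "\<And>m. c m \<in> nat_cube n" for c
    using cont[unfolded continuous_on_sequentially, rule_format, of l "\<lambda>m. c (r m)"] that l(1)
    by (simp add: o_def)
  have "F l i = l i" for i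
  proof (cases "i < n")
    case i: True
    note la = lim[of "\<lambda>m. a m i", OF ab(3)[OF i]] and lb = lim[of "\<lambda>m. b m i", OF ab(4)[OF i]]
    have "(\<lambda>m. F (a (r m) i) i) \<longlonglongrightarrow> F l i" "(\<lambda>m. F (b (r m) i) i) \<longlonglongrightarrow> F l i"
      using limF[OF la ab(1)[OF i]] limF[OF lb ab(2)[OF i]] by (simp_all add: tendsto_fun_iff)
    moreover have "(\<lambda>m. a (r m) i i) \<longlonglongrightarrow> l i" "(\<lambda>m. b (r m) i i) \<longlonglongrightarrow> l i"
      using la lb by (simp_all add: tendsto_fun_iff)
    ultimately have "l i \<le> F l i" "F l i \<le> l i"
      using ab(5,6)[OF i] by (meson LIMSEQ_le)+
    then show ?thesis by simp
  next
    case False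
    with F[OF l(1)] l(1) show ?thesis by (simp add: in_nat_cube_iff)
  qed
  then have "F l = l" by blast
  with l(1) show ?thesis by (rule that)
qed

text \<open>Brouwer's theorem is applied to coefficients, not to points of the space:
  \<open>t\<close> is sent to the weights, at \<open>f (X t)\<close>, of a partition of unity for an
  \<open>e\<close>-net. A fixed \<open>t\<close> exhibits \<open>X t\<close> as an average of net
  points within \<open>e\<close> of \<open>f (X t)\<close>.\<close>

lemma schauder_approximate:
  fixes f :: "'a::real_normed_vector \<Rightarrow> 'a"
  assumes K: "compact K" "convex K" "K \<noteq> {}"
    and f: "continuous_on K f" "\<And>x. x \<in> K \<Longrightarrow> f x \<in> K" and e: "e > 0"
  shows "\<exists>x\<in>K. dist x (f x) \<le> e"
proof -
  obtain C where C: "C \<subseteq> K" "finite C" "K \<subseteq> (\<Union>x\<in>C. ball x e)"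
    by (rule compactE_image[OF K(1), of K "\<lambda>x. ball x e"]) (use e in auto)
  obtain n :: nat and c where bij: "bij_betw c {..<n} C"
    using ex_bij_betw_nat_finite[OF C(2)] by (auto simp: atLeast0LessThan)
  have cK: "c i \<in> K" if "i < n" for i using bij C(1) that by (auto simp: bij_betw_def)
  have n: "n > 0" using bij C(3) K(3) by (auto simp: bij_betw_def intro!: Nat.gr0I)
  define w where "w i y = max 0 (e - dist y (c i))" for i y
  define W where "W y = (\<Sum>i<n. w i y)" for y
  have w0: "w i y \<ge> 0" for i y by (simp add: w_def)
  have W: "W y > 0" if y: "y \<in> K" for y
  proof -
    obtain i where "i < n" "dist y (c i) < e"
      using y C(3) bij by (force simp: bij_betw_def dist_commute)
    then show ?thesis
      unfolding W_def by (intro sum_pos2[of _ i]) (auto simp: w_def)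
  qed
  define s where "s t = (\<Sum>i<n. t i)" for t :: "nat \<Rightarrow> real"
  \<comment> \<open>Turns any point of the cube into convex weights: missing mass goes to index 0,
    excess mass is divided out. Where \<open>s t = 1\<close>, in particular at the fixed point,
    nothing changes.\<close>
  define \<mu> where "\<mu> t i = (t i + (if i = 0 then max 0 (1 - s t) else 0)) / max 1 (s t)" for t i
  define X where "X t = (\<Sum>i<n. \<mu> t i *\<^sub>R c i)" for t
  have \<mu>1: "(\<Sum>i<n. \<mu> t i) = 1" for t
  proof -
    have "(\<Sum>i<n. \<mu> t i) = (s t + max 0 (1 - s t)) / max 1 (s t)"
      using n by (simp add: \<mu>_def s_def sum.distrib flip: sum_divide_distrib)
    then show ?thesis by (auto simp: max_def)
  qed
  have XK: "X t \<in> K" if "t \<in> nat_cube n" for t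
    unfolding X_def
    by (rule convex_sum[OF _ K(2) \<mu>1]) (use that cK in \<open>auto simp: in_nat_cube_iff \<mu>_def split: if_splits\<close>)
  define F where "F t i = (if i < n then w i (f (X t)) / W (f (X t)) else 0)" for t i
  have s_cont: "continuous_on S s" for S
    unfolding s_def by (intro continuous_intros)
  have "max 1 (s t) \<noteq> 0" for t by (simp add: max_def)
  then have "continuous_on S (\<lambda>t. \<mu> t i)" for S i
    by (cases "i = 0") (auto simp: \<mu>_def intro!: continuous_intros s_cont)
  then have "continuous_on (nat_cube n) X"
    unfolding X_def by (intro continuous_intros)
  then have fX: "continuous_on (nat_cube n) (\<lambda>t. f (X t))"
    by (rule continuous_on_compose2[OF f(1)]) (use XK in auto)
  have "continuous_on (nat_cube n) (\<lambda>t. F t i)" for i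
  proof (cases "i < n")
    case True
    have "W (f (X t)) \<noteq> 0" if "t \<in> nat_cube n" for t using W[OF f(2)[OF XK[OF that]]] by simp
    moreover have "continuous_on (nat_cube n) (\<lambda>t. w i (f (X t)))" for i
      unfolding w_def by (intro continuous_intros fX)
    ultimately show ?thesis using True by (auto simp: F_def W_def intro!: continuous_intros)
  qed (simp add: F_def)
  then have "continuous_on (nat_cube n) F" by (rule continuous_on_coordinatewise_then_product)
  moreover have "F t \<in> nat_cube n" if "t \<in> nat_cube n" for t
  proof -
    have "w i (f (X t)) \<le> W (f (X t))" if "i < n" for i
      unfolding W_def using that w0 by (intro member_le_sum) auto
    then show ?thesis
      using W[OF f(2)[OF XK[OF that]]] w0 by (auto simp: in_nat_cube_iff F_def divide_le_eq)
  qed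
  ultimately obtain t where t: "t \<in> nat_cube n" "F t = t" by (rule brouwer_nat_cube)
  define y where "y = f (X t)"
  have Wy: "W y > 0" unfolding y_def by (intro W f(2) XK t(1))
  have ti: "t i = w i y / W y" if "i < n" for i
    using fun_cong[OF t(2), of i] that by (simp add: F_def y_def)
  have s1: "s t = 1"
    using Wy by (simp add: s_def ti W_def flip: sum_divide_distrib)
  then have "X t = (\<Sum>i<n. t i *\<^sub>R c i)" by (auto simp: X_def \<mu>_def intro!: sum.cong)
  then have "X t - y = (\<Sum>i<n. t i *\<^sub>R (c i - y))"
    using s1 by (simp add: scaleR_diff_right sum_subtractf s_def flip: scaleR_left.sum)
  then have "norm (X t - y) \<le> (\<Sum>i<n. norm (t i *\<^sub>R (c i - y)))" by (simp only: norm_sum)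
  also have "\<dots> \<le> (\<Sum>i<n. t i * e)"
  proof (rule sum_mono)
    fix i assume i: "i \<in> {..<n}"
    show "norm (t i *\<^sub>R (c i - y)) \<le> t i * e"
    proof (cases "w i y = 0")
      case False
      then have "norm (c i - y) \<le> e" by (auto simp: w_def dist_norm norm_minus_commute max_def split: if_splits)
      then show ?thesis using ti[of i] i w0[of i y] Wy by (simp add: mult_left_mono divide_right_mono)
    qed (use ti i in simp)
  qed
  also have "\<dots> = e" using s1 by (simp add: s_def flip: sum_distrib_right)
  finally show ?thesis using XK[OF t(1)] by (auto simp: y_def dist_norm)
qed

theorem schauder_fixed_point:
  fixes f :: "'a::real_normed_vector \<Rightarrow> 'a"
  assumes K: "compact K" "convex K" "K \<noteq> {}"
    and f: "continuous_on K f" "\<And>x. x \<in> K \<Longrightarrow> f x \<in> K"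
  obtains x where "x \<in> K" "f x = x"
proof -
  have "continuous_on K (\<lambda>x. dist x (f x))" by (intro continuous_intros f(1))
  then obtain x where x: "x \<in> K" "\<And>y. y \<in> K \<Longrightarrow> dist x (f x) \<le> dist y (f y)"
    using continuous_attains_inf[OF K(1,3)] by blast
  have "dist x (f x) \<le> 0 + e" if "e > 0" for e
    using schauder_approximate[OF K f that] x(2) by force
  then have "dist x (f x) \<le> 0" by (rule field_le_epsilon)
  then show ?thesis using that x(1) by simp
qed

section \<open>Convex lower semicontinuous functions\<close>

lemma lower_semicontinuous_eventually:
  assumes "lower_semicontinuous \<psi>" "c < \<psi> x"
  shows "eventually (\<lambda>y. c < \<psi> y) (nhds x)"
proof -
  have "c < Liminf (at x) \<psi>"
    using assms unfolding lower_semicontinuous_def by (meson less_le_trans)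
  then have "eventually (\<lambda>y. c < \<psi> y) (at x)" by (rule less_LiminfD)
  with assms(2) show ?thesis by (simp add: eventually_nhds_conv_at)
qed

lemma closed_sublevel:
  assumes "lower_semicontinuous \<psi>"
  shows "closed {x. \<psi> x \<le> c}"
proof -
  have "open (- {x. \<psi> x \<le> c})"
  proof (subst open_subopen, intro ballI)
    fix x assume "x \<in> - {x. \<psi> x \<le> c}"
    then have "eventually (\<lambda>y. c < \<psi> y) (nhds x)"
      using lower_semicontinuous_eventually[OF assms] by auto
    then show "\<exists>T. open T \<and> x \<in> T \<and> T \<subseteq> - {x. \<psi> x \<le> c}"
      unfolding eventually_nhds by (auto simp: not_le subset_iff)
  qed
  then show ?thesis by (simp add: closed_def)
qed

lemma convex_sublevel:
  assumes "ereal_convex \<psi>"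
  shows "convex {x. \<psi> x \<le> ereal c}"
proof (rule convexI)
  fix x y and a b :: real
  assume x: "x \<in> {x. \<psi> x \<le> ereal c}" and y: "y \<in> {x. \<psi> x \<le> ereal c}"
    and ab: "0 \<le> a" "0 \<le> b" "a + b = 1"
  have "\<psi> (a *\<^sub>R x + b *\<^sub>R y) \<le> ereal a * \<psi> x + ereal b * \<psi> y"
    using assms ab unfolding ereal_convex_def by blast
  also have "\<dots> \<le> ereal a * ereal c + ereal b * ereal c"
    using x y ab by (intro add_mono ereal_mult_left_mono) auto
  also have "\<dots> = ereal c" using ab(3) by (simp flip: distrib_right)
  finally show "a *\<^sub>R x + b *\<^sub>R y \<in> {x. \<psi> x \<le> ereal c}" by simp
qed

lemma weakly_lower_semicontinuous:
  assumes "ereal_convex \<psi>" "lower_semicontinuous \<psi>" "weakly_tendsto x a" "ereal c < \<psi> a"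
  shows "eventually (\<lambda>n. ereal c < \<psi> (x n)) sequentially"
proof -
  have "closedin weak_topology {x. \<psi> x \<le> ereal c}"
    using closedin_weak_closed_convex closed_sublevel[OF assms(2)] convex_sublevel[OF assms(1)]
    by blast
  then have "openin weak_topology (UNIV - {x. \<psi> x \<le> ereal c})" by (simp add: closedin_def)
  with assms(3,4) have "eventually (\<lambda>n. x n \<in> UNIV - {x. \<psi> x \<le> ereal c}) sequentially"
    unfolding weakly_tendsto_iff_limitin limitin_def by auto
  then show ?thesis by (auto elim!: eventually_mono)
qed

lemma ereal_convexD:
  assumes "ereal_convex \<psi>" "\<psi> x \<le> ereal p" "\<psi> y \<le> ereal q" "0 \<le> t" "t \<le> 1"
  shows "\<psi> ((1 - t) *\<^sub>R x + t *\<^sub>R y) \<le> ereal ((1 - t) * p + t * q)"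
proof -
  have "\<psi> ((1 - t) *\<^sub>R x + t *\<^sub>R y) \<le> ereal (1 - t) * \<psi> x + ereal t * \<psi> y"
    using assms unfolding ereal_convex_def by simp
  also have "\<dots> \<le> ereal (1 - t) * ereal p + ereal t * ereal q"
    using assms by (intro add_mono ereal_mult_left_mono) auto
  finally show ?thesis by simp
qed

lemma ereal_convex_sum:
  assumes "ereal_convex \<psi>" and fin: "finite I" and "\<And>i. i \<in> I \<Longrightarrow> 0 \<le> a i" and "(\<Sum>i\<in>I. a i) = 1"
    and "\<And>i. i \<in> I \<Longrightarrow> \<psi> (x i) \<le> ereal (p i)"
  shows "\<psi> (\<Sum>i\<in>I. a i *\<^sub>R x i) \<le> ereal (\<Sum>i\<in>I. a i * p i)"
proof -
  \<comment> \<open>The epigraph with real heights is a convex set, so convex sums can be formed in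
    it without arithmetic on infinite values.\<close>
  let ?E = "{(x, q). \<psi> x \<le> ereal q}"
  have "convex ?E"
  proof (rule convexI)
    fix z1 z2 and u v :: real
    assume z: "z1 \<in> ?E" "z2 \<in> ?E" and uv: "0 \<le> u" "0 \<le> v" "u + v = 1"
    have "\<psi> ((1 - v) *\<^sub>R fst z1 + v *\<^sub>R fst z2) \<le> ereal ((1 - v) * snd z1 + v * snd z2)"
      using z uv by (intro ereal_convexD[OF assms(1)]) auto
    moreover have "1 - v = u" using uv by simp
    ultimately show "u *\<^sub>R z1 + v *\<^sub>R z2 \<in> ?E" by (simp add: case_prod_unfold)
  qed
  then have "(\<Sum>i\<in>I. a i *\<^sub>R (x i, p i)) \<in> ?E"
    using assms(3-5) by (intro convex_sum[OF fin]) auto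
  then show ?thesis by (simp add: case_prod_unfold fst_sum snd_sum)
qed

text \<open>Lower semicontinuity bounds \<open>\<psi>\<close> below by \<open>p - 1\<close> on a
  ball of radius \<open>D\<close> about \<open>u0\<close>; outside it, convexity along segments from
  \<open>u0\<close> allows a decrease of slope at most \<open>1 / D\<close>.\<close>

lemma convex_lsc_lower_bound:
  fixes \<psi> :: "'a::real_normed_vector \<Rightarrow> ereal"
  assumes conv: "ereal_convex \<psi>" and lsc: "lower_semicontinuous \<psi>"
    and ninf: "\<And>u. \<psi> u \<noteq> -\<infinity>" and u0: "\<psi> u0 < \<infinity>"
  obtains a where "a \<ge> 0" "\<And>u. ereal (- (a * (1 + norm u))) \<le> \<psi> u"
proof -
  obtain p where p: "\<psi> u0 = ereal p" using ninf[of u0] u0 by (cases "\<psi> u0") auto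
  have "eventually (\<lambda>y. ereal (p - 1) < \<psi> y) (nhds u0)"
    by (rule lower_semicontinuous_eventually[OF lsc]) (simp add: p)
  then obtain d where d: "d > 0" "\<And>y. dist y u0 < d \<Longrightarrow> ereal (p - 1) < \<psi> y"
    unfolding eventually_nhds_metric by blast
  define D where "D = d / 2"
  have D: "D > 0" "\<And>y. norm (y - u0) \<le> D \<Longrightarrow> ereal (p - 1) \<le> \<psi> y"
    using d by (auto simp: D_def dist_norm intro!: less_imp_le)
  have main: "ereal (p - 1 - norm (u - u0) / D) \<le> \<psi> u" for u
  proof (cases "norm (u - u0) \<le> D")
    case True
    have "ereal (p - 1 - norm (u - u0) / D) \<le> ereal (p - 1)" using D(1) by simp
    also have "\<dots> \<le> \<psi> u" using D(2) True by blast
    finally show ?thesis .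
  next
    case False
    show ?thesis
    proof (cases "\<psi> u")
      case (real q)
      define t where "t = D / norm (u - u0)"
      have N: "0 < norm (u - u0)" using False D(1) by linarith
      then have t: "0 < t" "t \<le> 1" using False D(1) by (simp_all add: t_def divide_le_eq)
      have "(1 - t) *\<^sub>R u0 + t *\<^sub>R u = u0 + t *\<^sub>R (u - u0)" by (simp add: algebra_simps)
      moreover have "norm (t *\<^sub>R (u - u0)) = D" using N D(1) by (simp add: t_def)
      ultimately have "ereal (p - 1) \<le> \<psi> ((1 - t) *\<^sub>R u0 + t *\<^sub>R u)" by (intro D(2)) simp
      also have "\<dots> \<le> ereal ((1 - t) * p + t * q)"
        using t p real by (intro ereal_convexD[OF conv]) auto
      finally have "t * (p - q) \<le> 1" by (simp add: algebra_simps)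
      then have "p - q \<le> norm (u - u0) / D"
        using N D(1) by (simp add: t_def field_simps)
      then show ?thesis using real by simp
    qed (use ninf in auto)
  qed
  define a where "a = \<bar>p - 1\<bar> + norm u0 / D + 1 / D"
  show ?thesis
  proof (rule that)
    show "a \<ge> 0" using D(1) by (simp add: a_def)
    fix u
    have "norm (u - u0) / D \<le> (norm u + norm u0) / D"
      using D(1) by (intro divide_right_mono norm_triangle_ineq4) auto
    then have "norm (u - u0) / D \<le> norm u / D + norm u0 / D" by (simp add: add_divide_distrib)
    moreover have "0 \<le> \<bar>p - 1\<bar> * norm u" "0 \<le> norm u0 / D * norm u" "0 \<le> 1 / D" using D(1) by auto
    moreover have "a * (1 + norm u) = \<bar>p - 1\<bar> + norm u0 / D + 1 / D + \<bar>p - 1\<bar> * norm u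
        + norm u0 / D * norm u + norm u / D"
      by (simp add: a_def algebra_simps add_divide_distrib)
    ultimately have "- (a * (1 + norm u)) \<le> p - 1 - norm (u - u0) / D"
      by linarith
    then show "ereal (- (a * (1 + norm u))) \<le> \<psi> u" using main[of u] by (meson ereal_less_eq(3) order_trans)
  qed
qed

section \<open>A single parametric variational-hemivariational inequality\<close>

text \<open>The data for \<open>u\<close> and for \<open>w\<close> satisfy the same hypotheses with
  the two spaces exchanged, so one inequality is analysed once and instantiated twice. The parameter
  is the first argument of \<open>A\<close> and of \<open>J\<close>.\<close>

locale parametric_vhi =
  fixes h :: "'v::real_normed_vector \<Rightarrow>\<^sub>L real"
    and \<gamma> :: "'v \<Rightarrow>\<^sub>L 'x::real_normed_vector" and \<delta> :: "'e::real_normed_vector \<Rightarrow>\<^sub>L 'z::real_normed_vector"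
    and \<psi> :: "'v \<Rightarrow> ereal" and J :: "'z \<Rightarrow> 'x \<Rightarrow> real" and A :: "'e \<Rightarrow> 'v \<Rightarrow> ('v \<Rightarrow>\<^sub>L real)"
  assumes compact_gamma: "compact_operator \<gamma>" and compact_delta: "compact_operator \<delta>"
    and psi_ninf: "\<And>u. \<psi> u \<noteq> -\<infinity>" and psi_convex: "ereal_convex \<psi>"
    and psi_lsc: "lower_semicontinuous \<psi>"
    and J_lipschitz: "\<And>w. locally_lipschitz (J w)"
    and J_growth: "\<exists>cJ\<ge>0. \<forall>w u. \<forall>\<xi> \<in> clarke_subgradient (J w) u. norm \<xi> \<le> cJ * (1 + norm u + norm w)"
    and J_usc: "\<And>u v ws w. ws \<longlonglongrightarrow> w \<Longrightarrow>
      limsup (\<lambda>n. clarke_derivative (J (ws n)) u v) \<le> clarke_derivative (J w) u v"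
    and A_hemi: "\<And>w u v.
      Limsup (at 0) (\<lambda>t. ereal (A w (t *\<^sub>R v + (1 - t) *\<^sub>R u) (v - u))) \<le> ereal (A w u (v - u))"
    and A_pseudo: "\<And>w. stable_pseudomonotone_wrt \<psi> {h}
      (\<lambda>u. {A w u + dual_adjoint \<gamma> \<xi> | \<xi>. \<xi> \<in> clarke_subgradient (J (\<delta> w)) (\<gamma> u)})"
    and A_usc: "\<And>ws w us u v. weakly_tendsto ws w \<Longrightarrow> weakly_tendsto us u \<Longrightarrow>
      limsup (\<lambda>n. ereal (A (ws n) v (v - us n))) \<le> ereal (A w v (v - u))"
    and A_growth: "\<exists>bA>0. \<forall>w u. norm (A w u) \<le> bA * (1 + norm u + norm w)"
    and A_coercive: "\<exists>rA. property_R rA \<and> (\<forall>u w.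
      ereal (A w u u) - clarke_derivative (J (\<delta> w)) (\<gamma> u) (- \<gamma> u) \<ge> ereal (rA (norm u) (norm w) * norm u))"
begin

text \<open>Including \<open>h\<close> keeps the expression sublinear in \<open>d\<close>; scaling
  and splitting a direction then treat all three terms at once.\<close>

definition form :: "'e \<Rightarrow> 'v \<Rightarrow> 'v \<Rightarrow> real" where
  "form w u d = A w u d + clarke_real (J (\<delta> w)) (\<gamma> u) (\<gamma> d) - h d"

definition stampacchia :: "'e \<Rightarrow> 'v \<Rightarrow> 'v \<Rightarrow> bool" where
  "stampacchia w u v \<longleftrightarrow> \<psi> u \<le> ereal (form w u (v - u)) + \<psi> v"

definition minty :: "'e \<Rightarrow> 'v \<Rightarrow> 'v \<Rightarrow> bool" where
  "minty w u v \<longleftrightarrow> \<psi> u \<le> ereal (form w v (v - u)) + \<psi> v"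

lemma stampacchia_iff:
  "stampacchia w u v \<longleftrightarrow> ereal (A w u (v - u))
     + clarke_derivative (J (\<delta> w)) (\<gamma> u) (\<gamma> (v - u)) + \<psi> v \<ge> ereal (h (v - u)) + \<psi> u"
  unfolding stampacchia_def form_def ereal_clarke_real[OF J_lipschitz, symmetric]
  by (cases "\<psi> u"; cases "\<psi> v") (auto simp: psi_ninf)

lemma sublinear_form: "sublinear (form w u)"
proof -
  note J = sublinear_clarke_real[OF J_lipschitz, of "\<delta> w" "\<gamma> u"]
  show ?thesis
    unfolding sublinear_def form_def
    using sublinear_add[OF J] sublinear_scale[OF J]
    by (auto simp: blinfun.add_right blinfun.scaleR_right algebra_simps)
qed

lemma form_scale: "0 \<le> t \<Longrightarrow> form w u (t *\<^sub>R d) = t * form w u d"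
  by (rule sublinear_scale[OF sublinear_form])

lemma stampacchia_refl: "stampacchia w u u"
  by (simp add: stampacchia_def sublinear_zero[OF sublinear_form])

lemma stampacchia_finite: "stampacchia w u v \<Longrightarrow> \<psi> v < \<infinity> \<Longrightarrow> \<psi> u < \<infinity>"
  unfolding stampacchia_def using psi_ninf[of v] by (cases "\<psi> v") (auto simp: le_less_trans)

lemma minty_finite: "minty w u v \<Longrightarrow> \<psi> v < \<infinity> \<Longrightarrow> \<psi> u < \<infinity>"
  unfolding minty_def using psi_ninf[of v] by (cases "\<psi> v") (auto simp: le_less_trans)

lemma stampacchia_infinite: "\<psi> v = \<infinity> \<Longrightarrow> stampacchia w u v"
  by (simp add: stampacchia_def)

lemma minty_infinite: "\<psi> v = \<infinity> \<Longrightarrow> minty w u v"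
  by (simp add: minty_def)

text \<open>A subgradient at \<open>u\<close> that attains the Clarke derivative in the direction
  \<open>\<gamma> (v - u)\<close> makes the premise of pseudomonotonicity the given inequality; at
  \<open>v\<close> any subgradient is dominated by the Clarke derivative.\<close>

lemma stampacchia_imp_minty:
  assumes "stampacchia w u v"
  shows "minty w u v"
proof -
  let ?F = "\<lambda>u. {A w u + dual_adjoint \<gamma> \<xi> | \<xi>. \<xi> \<in> clarke_subgradient (J (\<delta> w)) (\<gamma> u)}"
  have pm: "pseudomonotone_wrt \<psi> (\<lambda>u. (\<lambda>us. us - h) ` ?F u)"
    using A_pseudo[of w] by (simp add: stable_pseudomonotone_wrt_def)
  have ap: "blinfun_apply (A w u + dual_adjoint \<gamma> \<xi> - h) d = A w u d + \<xi> (\<gamma> d) - h d" for u \<xi> d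
    by (simp add: dual_adjoint_def blinfun.add_left blinfun.diff_left)
  obtain \<xi> where \<xi>: "\<xi> \<in> clarke_subgradient (J (\<delta> w)) (\<gamma> u)"
    "\<xi> (\<gamma> (v - u)) = clarke_real (J (\<delta> w)) (\<gamma> u) (\<gamma> (v - u))"
    using clarke_subgradient_max[OF J_lipschitz] by blast
  obtain \<eta> where \<eta>: "\<eta> \<in> clarke_subgradient (J (\<delta> w)) (\<gamma> v)"
    using clarke_subgradient_max[OF J_lipschitz] by blast
  have "A w u + dual_adjoint \<gamma> \<xi> - h \<in> (\<lambda>us. us - h) ` ?F u" using \<xi>(1) by blast
  moreover have "ereal (blinfun_apply (A w u + dual_adjoint \<gamma> \<xi> - h) (v - u)) + \<psi> v \<ge> \<psi> u"
    using assms by (simp only: ap \<xi>(2) stampacchia_def form_def)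
  ultimately have *: "\<And>vs. vs \<in> (\<lambda>us. us - h) ` ?F v \<Longrightarrow> ereal (blinfun_apply vs (v - u)) + \<psi> v \<ge> \<psi> u"
    using pm unfolding pseudomonotone_wrt_def by blast
  have "ereal (blinfun_apply (A w v + dual_adjoint \<gamma> \<eta> - h) (v - u)) + \<psi> v \<ge> \<psi> u"
    by (rule *) (use \<eta> in blast)
  moreover have "\<eta> (\<gamma> (v - u)) \<le> clarke_real (J (\<delta> w)) (\<gamma> v) (\<gamma> (v - u))"
    using \<eta> by (simp add: in_clarke_subgradient_iff[OF J_lipschitz])
  then have "ereal (blinfun_apply (A w v + dual_adjoint \<gamma> \<eta> - h) (v - u)) + \<psi> v
      \<le> ereal (form w v (v - u)) + \<psi> v"
    by (intro add_mono order_refl) (simp add: ap form_def)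
  ultimately show ?thesis unfolding minty_def by (rule order_trans)
qed

text \<open>Minty's inequality is tested at \<open>y t\<close> close to \<open>u\<close>;
  homogeneity of \<open>form\<close> and convexity of \<open>\<psi>\<close> allow division by
  \<open>t\<close>. Then \<open>t\<close> tends to 0, by hemicontinuity of \<open>A\<close> and
  upper semicontinuity of the Clarke derivative. Finiteness of \<open>\<psi> u\<close> permits
  cancelling it.\<close>

lemma minty_imp_stampacchia:
  assumes K: "convex K" "u \<in> K" "v \<in> K" and fin: "\<psi> u < \<infinity>"
    and M: "\<And>y. y \<in> K \<Longrightarrow> minty w u y"
  shows "stampacchia w u v"
proof (cases "\<psi> v")
  case (real q)
  obtain p where p: "\<psi> u = ereal p" using psi_ninf[of u] fin by (cases "\<psi> u") auto
  show ?thesis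
  proof (rule ccontr)
    assume "\<not> ?thesis"
    then have lt: "form w u (v - u) < p - q" by (simp add: stampacchia_def p real)
    \<comment> \<open>Half of the gap: one share for \<open>A\<close> and one for the Clarke
      derivative.\<close>
    define e where "e = (p - q - form w u (v - u)) / 2"
    have e: "e > 0" using lt by (simp add: e_def)
    define y where "y t = t *\<^sub>R v + (1 - t) *\<^sub>R u" for t :: real
    have "Limsup (at 0) (\<lambda>t. ereal (A w (y t) (v - u))) < ereal (A w u (v - u) + e)"
      unfolding y_def by (rule le_less_trans[OF A_hemi]) (use e in simp)
    then have 1: "eventually (\<lambda>t. A w (y t) (v - u) < A w u (v - u) + e) (at 0)"
      using Limsup_lessD by fastforce
    let ?j = "\<lambda>x. clarke_real (J (\<delta> w)) x (\<gamma> (v - u))"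
    have "eventually (\<lambda>x. ?j x < ?j (\<gamma> u) + e) (nhds (\<gamma> u))"
      by (rule clarke_real_usc[OF J_lipschitz]) (use e in simp)
    moreover have "((\<lambda>t. \<gamma> (y t)) \<longlongrightarrow> \<gamma> (0 *\<^sub>R v + (1 - 0) *\<^sub>R u)) (at 0)"
      unfolding y_def by (intro tendsto_intros)
    ultimately have 2: "eventually (\<lambda>t. ?j (\<gamma> (y t)) < ?j (\<gamma> u) + e) (at 0)"
      using eventually_compose_filterlim by fastforce
    have "eventually (\<lambda>t. form w (y t) (v - u) < p - q) (at 0)"
      using 1 2
    proof eventually_elim
      case (elim t)
      then show ?case by (simp add: form_def e_def field_simps)
    qed
    then have "eventually (\<lambda>t. form w (y t) (v - u) < p - q) (at_right 0)"
      by (simp add: eventually_at_split)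
    moreover have "eventually (\<lambda>t::real. t \<in> {0<..<1}) (at_right 0)"
      by (rule eventually_at_right_real) simp
    ultimately have "eventually (\<lambda>t. form w (y t) (v - u) < p - q \<and> t \<in> {0<..<1}) (at_right 0)"
      by (rule eventually_conj)
    then obtain t where t: "form w (y t) (v - u) < p - q" "0 < t" "t < 1"
      using eventually_happens'[OF trivial_limit_at_right_real] by fastforce
    have "y t \<in> K" unfolding y_def using K t by (intro convexD) auto
    then have "\<psi> u \<le> ereal (form w (y t) (y t - u)) + \<psi> (y t)" using M unfolding minty_def by blast
    also have "y t - u = t *\<^sub>R (v - u)" by (simp add: y_def algebra_simps)
    also have "\<psi> (y t) \<le> ereal ((1 - t) * p + t * q)"
      using ereal_convexD[OF psi_convex, of u p v q t] p real t by (simp add: y_def add.commute)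
    finally have "p \<le> form w (y t) (t *\<^sub>R (v - u)) + ((1 - t) * p + t * q)"
      by (simp add: p add_left_mono)
    moreover have "form w (y t) (t *\<^sub>R (v - u)) = t * form w (y t) (v - u)"
      using t by (simp add: form_scale)
    ultimately have "p \<le> t * form w (y t) (v - u) + ((1 - t) * p + t * q)" by (simp only:)
    then have "t * (p - q) \<le> t * form w (y t) (v - u)" by (simp add: algebra_simps)
    with t show False by simp
  qed
qed (use psi_ninf stampacchia_infinite in auto)

text \<open>Homogeneity of \<open>form\<close> and convexity of \<open>\<psi>\<close> cancel the
  factor \<open>t\<close>, so a test close to \<open>u\<close> is as good as a distant one. This
  removes the restriction to a ball.\<close>

lemma stampacchia_extend:
  assumes fin: "\<psi> u < \<infinity>" and t: "0 < t" "t \<le> 1" and S: "stampacchia w u (u + t *\<^sub>R (v - u))"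
  shows "stampacchia w u v"
proof (cases "\<psi> v")
  case (real q)
  obtain p where p: "\<psi> u = ereal p" using psi_ninf[of u] fin by (cases "\<psi> u") auto
  have eq: "u + t *\<^sub>R (v - u) = (1 - t) *\<^sub>R u + t *\<^sub>R v" by (simp add: algebra_simps)
  have "\<psi> u \<le> ereal (form w u (t *\<^sub>R (v - u))) + \<psi> (u + t *\<^sub>R (v - u))"
    using S by (simp add: stampacchia_def)
  also have "\<psi> (u + t *\<^sub>R (v - u)) \<le> ereal ((1 - t) * p + t * q)"
    unfolding eq using ereal_convexD[OF psi_convex, of u p v q t] p real t by simp
  finally have "p \<le> form w u (t *\<^sub>R (v - u)) + ((1 - t) * p + t * q)"
    by (simp add: p add_left_mono)
  moreover have "form w u (t *\<^sub>R (v - u)) = t * form w u (v - u)" using t by (simp add: form_scale)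
  ultimately have "p \<le> t * form w u (v - u) + ((1 - t) * p + t * q)" by (simp only:)
  then have "t * p \<le> t * (form w u (v - u) + q)" by (simp add: algebra_simps)
  with t show ?thesis by (simp add: stampacchia_def p real)
qed (use psi_ninf stampacchia_infinite in auto)

text \<open>Minty's inequality at a point \<open>v\<close> of the segment from \<open>u0\<close> to a solution \<open>u\<close> reverses into
  Stampacchia's inequality at \<open>v\<close> tested with \<open>u0\<close>. This transports the a priori estimate
  from \<open>u\<close> to the whole segment.\<close>
lemma stampacchia_segment:
  assumes S: "\<And>y. y \<in> closed_segment u0 u \<Longrightarrow> stampacchia w u y"
    and fin: "\<psi> u0 < \<infinity>" and v: "v \<in> closed_segment u0 u"
  shows "stampacchia w v u0"
proof -
  obtain t where t: "0 \<le> t" "t \<le> 1" "v = (1 - t) *\<^sub>R u0 + t *\<^sub>R u"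
    using v by (auto simp: in_segment)
  consider "t = 0" | "t = 1" | "0 < t" "t < 1" using t by linarith
  then show ?thesis
  proof cases
    case 1
    then show ?thesis using t stampacchia_refl by simp
  next
    case 2
    then show ?thesis using t S[of u0] by simp
  next
    case 3
    have finu: "\<psi> u < \<infinity>" using stampacchia_finite[OF S fin] by simp
    obtain p0 where p0: "\<psi> u0 = ereal p0" using psi_ninf[of u0] fin by (cases "\<psi> u0") auto
    obtain p where p: "\<psi> u = ereal p" using psi_ninf[of u] finu by (cases "\<psi> u") auto
    have le: "\<psi> v \<le> ereal ((1 - t) * p0 + t * p)"
      unfolding t(3) using t by (intro ereal_convexD[OF psi_convex]) (auto simp: p0 p)
    then obtain q where q: "\<psi> v = ereal q" using psi_ninf[of v] by (cases "\<psi> v") auto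
    have "minty w u v" using S[OF v] by (rule stampacchia_imp_minty)
    \<comment> \<open>As \<open>v\<close> lies strictly between \<open>u0\<close> and
      \<open>u\<close>, Minty's direction \<open>v - u\<close> is a positive multiple of the wanted
      \<open>u0 - v\<close>; convexity of \<open>\<psi>\<close> then eliminates
      \<open>\<psi> u\<close>.\<close>
    moreover have "v - u = ((1 - t) / t) *\<^sub>R (u0 - v)"
    proof -
      have "t *\<^sub>R (v - u) = (1 - t) *\<^sub>R (u0 - v)" by (simp add: t(3) algebra_simps)
      then have "(1 / t) *\<^sub>R (t *\<^sub>R (v - u)) = (1 / t) *\<^sub>R ((1 - t) *\<^sub>R (u0 - v))" by simp
      then show ?thesis using 3 by simp
    qed
    ultimately have "p \<le> (1 - t) / t * form w v (u0 - v) + q"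
      using 3 by (simp add: minty_def p q form_scale)
    then have "t * p \<le> (1 - t) * form w v (u0 - v) + t * q"
      using 3 by (simp add: field_simps)
    moreover have "q \<le> (1 - t) * p0 + t * p" using le q by simp
    ultimately have "(1 - t) * q \<le> (1 - t) * (form w v (u0 - v) + p0)"
      by (simp add: algebra_simps)
    then show ?thesis using 3 by (simp add: stampacchia_def p0 q)
  qed
qed

end

section \<open>Weak closedness and coercivity for one inequality\<close>

context parametric_vhi
begin

lemma clarke_growth:
  obtains cJ where "cJ \<ge> 0" "\<And>w u d. clarke_real (J w) u d \<le> cJ * (1 + norm u + norm w) * norm d"
proof -
  obtain cJ where cJ: "cJ \<ge> 0"
    "\<And>w u \<xi>. \<xi> \<in> clarke_subgradient (J w) u \<Longrightarrow> norm \<xi> \<le> cJ * (1 + norm u + norm w)"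
    using J_growth by blast
  show ?thesis by (rule that[OF cJ(1)]) (rule clarke_real_bound[OF J_lipschitz cJ(2)])
qed

text \<open>With \<open>v\<close> fixed, \<open>A_usc\<close> covers the operator. The Clarke
  direction is split into the image of \<open>v - u\<close>, covered by \<open>J_usc\<close>, and
  that of \<open>u - us n\<close>, which tends to 0 strongly and is controlled by the growth of the
  subgradients.\<close>

lemma minty_weakly_closed:
  assumes ws: "weakly_tendsto ws w" "bounded (range ws)"
    and us: "weakly_tendsto us u" "bounded (range us)"
    and M: "\<And>n. minty (ws n) (us n) v"
  shows "minty w u v"
proof (cases "\<psi> v")
  case (real b)
  show ?thesis
  proof (rule ccontr)
    assume "\<not> ?thesis"
    then have "ereal (form w v (v - u) + b) < \<psi> u" by (simp add: minty_def real)
    then obtain c where c: "form w v (v - u) + b < c" "ereal c < \<psi> u"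
      using ereal_dense2 by fastforce
    \<comment> \<open>A quarter of the gap for each of four upper limits: \<open>A\<close>, the two
      parts of the Clarke term, and \<open>h\<close>.\<close>
    define e where "e = (c - b - form w v (v - u)) / 4"
    have e: "e > 0" using c(1) by (simp add: e_def)
    obtain cJ where cJ: "cJ \<ge> 0" "\<And>w u d. clarke_real (J w) u d \<le> cJ * (1 + norm u + norm w) * norm d"
      using clarke_growth by blast
    have gam: "(\<lambda>n. \<gamma> (us n)) \<longlonglongrightarrow> \<gamma> u"
      by (rule compact_operator_weakly_tendsto[OF compact_gamma us])
    have del: "(\<lambda>n. \<delta> (ws n)) \<longlonglongrightarrow> \<delta> w"
      by (rule compact_operator_weakly_tendsto[OF compact_delta ws])
    have "limsup (\<lambda>n. ereal (A (ws n) v (v - us n))) < ereal (A w v (v - u) + e)"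
      by (rule le_less_trans[OF A_usc[OF ws(1) us(1)]]) (use e in simp)
    then have 1: "eventually (\<lambda>n. A (ws n) v (v - us n) < A w v (v - u) + e) sequentially"
      using Limsup_lessD by fastforce
    have "limsup (\<lambda>n. clarke_derivative (J (\<delta> (ws n))) (\<gamma> v) (\<gamma> (v - u)))
        < ereal (clarke_real (J (\<delta> w)) (\<gamma> v) (\<gamma> (v - u)) + e)"
      by (rule le_less_trans[OF J_usc[OF del]])
        (use e in \<open>simp flip: ereal_clarke_real[OF J_lipschitz]\<close>)
    then have 2: "eventually (\<lambda>n. clarke_real (J (\<delta> (ws n))) (\<gamma> v) (\<gamma> (v - u))
        < clarke_real (J (\<delta> w)) (\<gamma> v) (\<gamma> (v - u)) + e) sequentially"
      using Limsup_lessD by (fastforce simp flip: ereal_clarke_real[OF J_lipschitz])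
    have "(\<lambda>n. cJ * (1 + norm (\<gamma> v) + norm (\<delta> (ws n))) * norm (\<gamma> u - \<gamma> (us n)))
        \<longlonglongrightarrow> cJ * (1 + norm (\<gamma> v) + norm (\<delta> w)) * norm (\<gamma> u - \<gamma> u)"
      by (intro tendsto_intros gam del)
    then have "eventually (\<lambda>n. cJ * (1 + norm (\<gamma> v) + norm (\<delta> (ws n))) * norm (\<gamma> u - \<gamma> (us n)) < e)
        sequentially"
      using e by (intro order_tendstoD(2)) auto
    then have 3: "eventually (\<lambda>n. clarke_real (J (\<delta> (ws n))) (\<gamma> v) (\<gamma> (u - us n)) < e) sequentially"
    proof eventually_elim
      case (elim n)
      then show ?case using cJ(2)[of "\<delta> (ws n)" "\<gamma> v" "\<gamma> (u - us n)"]
        by (simp add: blinfun.diff_right)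
    qed
    have "(\<lambda>n. h (us n)) \<longlonglongrightarrow> h u" using us(1) unfolding weakly_tendsto_def by blast
    then have 4: "eventually (\<lambda>n. h (us n) < h u + e) sequentially"
      using e by (intro order_tendstoD(2)) auto
    have 5: "eventually (\<lambda>n. ereal c < \<psi> (us n)) sequentially"
      by (rule weakly_lower_semicontinuous[OF psi_convex psi_lsc us(1) c(2)])
    have "eventually (\<lambda>n. False) sequentially"
      using 1 2 3 4 5
    proof eventually_elim
      case (elim n)
      have "\<gamma> (v - us n) = \<gamma> (v - u) + \<gamma> (u - us n)" by (simp add: blinfun.diff_right)
      then have "clarke_real (J (\<delta> (ws n))) (\<gamma> v) (\<gamma> (v - us n))
          \<le> clarke_real (J (\<delta> (ws n))) (\<gamma> v) (\<gamma> (v - u)) + clarke_real (J (\<delta> (ws n))) (\<gamma> v) (\<gamma> (u - us n))"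
        using sublinear_add[OF sublinear_clarke_real[OF J_lipschitz]] by metis
      with elim have "form (ws n) v (v - us n) < form w v (v - u) + 4 * e"
        by (simp add: form_def blinfun.diff_right)
      also have "\<dots> = c - b" by (simp add: e_def field_simps)
      finally have "ereal (form (ws n) v (v - us n)) + \<psi> v < ereal c" by (simp add: real)
      with elim M[of n] show ?case by (simp add: minty_def)
    qed
    then show False by simp
  qed
qed (use psi_ninf minty_infinite in auto)

text \<open>The test point is fixed, so after the coercive part is split off every remaining term is
  at most linear in the norms of \<open>u\<close> and \<open>w\<close>; for \<open>\<psi> u\<close>
  this is \<open>convex_lsc_lower_bound\<close>.\<close>

lemma coercive_estimate:
  assumes u0: "\<psi> u0 < \<infinity>"
  obtains r k where "property_R r" "k \<ge> 0"
    "\<And>w u. stampacchia w u u0 \<Longrightarrow> r (norm u) (norm w) * norm u \<le> k * (1 + norm u + norm w)"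
proof -
  obtain b where b: "\<psi> u0 = ereal b" using psi_ninf[of u0] u0 by (cases "\<psi> u0") auto
  obtain a where a: "a \<ge> 0" "\<And>u. ereal (- (a * (1 + norm u))) \<le> \<psi> u"
    using convex_lsc_lower_bound[OF psi_convex psi_lsc psi_ninf u0] by blast
  obtain r where r: "property_R r" "\<And>u w. ereal (r (norm u) (norm w) * norm u)
      \<le> ereal (A w u u) - clarke_derivative (J (\<delta> w)) (\<gamma> u) (- \<gamma> u)"
    using A_coercive by blast
  obtain bA where bA: "bA > 0" "\<And>w u. norm (A w u) \<le> bA * (1 + norm u + norm w)"
    using A_growth by blast
  obtain cJ where cJ: "cJ \<ge> 0" "\<And>w u d. clarke_real (J w) u d \<le> cJ * (1 + norm u + norm w) * norm d"
    using clarke_growth by blast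
  \<comment> \<open>The summands bound, relative to \<open>1 + norm u + norm w\<close>, the terms
    \<open>A w u u0\<close>, the Clarke derivative in the direction \<open>\<gamma> u0\<close>,
    \<open>h u - h u0\<close>, and \<open>b - p\<close>.\<close>
  define k where "k = bA * norm u0 + cJ * (1 + norm \<gamma> + norm \<delta>) * norm (\<gamma> u0)
    + (norm h * (1 + norm u0) + (\<bar>b\<bar> + a))"
  show ?thesis
  proof (rule that[OF r(1)])
    show "k \<ge> 0" using a(1) bA(1) cJ(1) by (simp add: k_def)
    fix w u assume S: "stampacchia w u u0"
    define N where "N = 1 + norm u + norm w"
    have N: "1 \<le> N" "norm u \<le> N" "norm w \<le> N" "1 + norm u \<le> N" by (simp_all add: N_def)
    obtain p where p: "\<psi> u = ereal p"
      using psi_ninf[of u] stampacchia_finite[OF S u0] by (cases "\<psi> u") auto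
    have "p \<le> form w u (u0 - u) + b" using S by (simp add: stampacchia_def p b)
    moreover have "clarke_real (J (\<delta> w)) (\<gamma> u) (\<gamma> (u0 - u))
        \<le> clarke_real (J (\<delta> w)) (\<gamma> u) (\<gamma> u0) + clarke_real (J (\<delta> w)) (\<gamma> u) (- \<gamma> u)"
      using sublinear_add[OF sublinear_clarke_real[OF J_lipschitz], of "\<delta> w" "\<gamma> u" "\<gamma> u0" "- \<gamma> u"]
      by (simp add: blinfun.diff_right)
    moreover have "r (norm u) (norm w) * norm u \<le> A w u u - clarke_real (J (\<delta> w)) (\<gamma> u) (- \<gamma> u)"
      using r(2)[of u w] by (simp flip: ereal_clarke_real[OF J_lipschitz])
    ultimately have 0: "r (norm u) (norm w) * norm u
        \<le> A w u u0 + clarke_real (J (\<delta> w)) (\<gamma> u) (\<gamma> u0) + (h u - h u0 + (b - p))"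
      by (simp add: form_def blinfun.diff_right)
    have 1: "A w u u0 \<le> bA * norm u0 * N"
    proof -
      have "A w u u0 \<le> norm (A w u) * norm u0" using norm_blinfun[of "A w u" u0] by simp
      also have "\<dots> \<le> (bA * N) * norm u0"
        using bA(2)[of w u] by (intro mult_right_mono) (simp_all add: N_def)
      finally show ?thesis by (simp add: mult_ac)
    qed
    have 2: "clarke_real (J (\<delta> w)) (\<gamma> u) (\<gamma> u0) \<le> cJ * (1 + norm \<gamma> + norm \<delta>) * norm (\<gamma> u0) * N"
    proof -
      have "norm (\<gamma> u) \<le> norm \<gamma> * N"
        using norm_blinfun[of \<gamma> u] N(2) by (meson mult_left_mono norm_ge_zero order_trans)
      moreover have "norm (\<delta> w) \<le> norm \<delta> * N"
        using norm_blinfun[of \<delta> w] N(3) by (meson mult_left_mono norm_ge_zero order_trans)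
      ultimately have "1 + norm (\<gamma> u) + norm (\<delta> w) \<le> (1 + norm \<gamma> + norm \<delta>) * N"
        using N(1) by (simp add: algebra_simps)
      then have "cJ * (1 + norm (\<gamma> u) + norm (\<delta> w)) * norm (\<gamma> u0)
          \<le> cJ * ((1 + norm \<gamma> + norm \<delta>) * N) * norm (\<gamma> u0)"
        using cJ(1) by (intro mult_right_mono mult_left_mono) auto
      with cJ(2)[of "\<delta> w" "\<gamma> u" "\<gamma> u0"] show ?thesis by (simp add: mult_ac)
    qed
    have 3: "h u - h u0 \<le> norm h * (1 + norm u0) * N"
    proof -
      have "h u - h u0 \<le> norm h * norm (u - u0)"
        using norm_blinfun[of h "u - u0"] by (simp add: blinfun.diff_right)
      also have "\<dots> \<le> norm h * (norm u + norm u0)"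
        by (intro mult_left_mono norm_triangle_ineq4) simp
      also have "\<dots> \<le> norm h * ((1 + norm u0) * N)"
      proof (intro mult_left_mono)
        have "norm u0 * 1 \<le> norm u0 * N" using N(1) by (intro mult_left_mono) auto
        then show "norm u + norm u0 \<le> (1 + norm u0) * N" using N(2) by (simp add: distrib_right)
      qed simp
      finally show ?thesis by (simp add: mult_ac)
    qed
    have 4: "b - p \<le> (\<bar>b\<bar> + a) * N"
    proof -
      have "- (a * (1 + norm u)) \<le> p" using a(2)[of u] by (simp add: p)
      moreover have "a * (1 + norm u) \<le> a * N" by (rule mult_left_mono[OF N(4) a(1)])
      moreover have "\<bar>b\<bar> * 1 \<le> \<bar>b\<bar> * N" using N(1) by (intro mult_left_mono) auto
      ultimately show ?thesis by (simp add: distrib_right)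
    qed
    have "k * N = bA * norm u0 * N + cJ * (1 + norm \<gamma> + norm \<delta>) * norm (\<gamma> u0) * N
        + (norm h * (1 + norm u0) * N + (\<bar>b\<bar> + a) * N)"
      unfolding k_def by (simp only: distrib_right)
    with 0 1 2 3 4 have "r (norm u) (norm w) * norm u \<le> k * N" by linarith
    then show "r (norm u) (norm w) * norm u \<le> k * (1 + norm u + norm w)" by (simp add: N_def)
  qed
qed

end

text \<open>Here \<open>s\<close> and \<open>t\<close> are the norms of the two components of a solution and \<open>\<sigma>\<close> runs through the norms
  on the segment; the case \<open>\<sigma> = t\<close> bounds \<open>t\<close>, and then \<open>\<sigma> = s\<close> bounds \<open>s\<close>.\<close>
lemma property_R_bound:
  assumes r: "property_R r" and k: "k \<ge> 0" and R: "R \<ge> 0"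
  obtains M where "M \<ge> R"
    "\<And>s t. 0 \<le> t \<Longrightarrow> t \<le> s \<Longrightarrow> (\<And>\<sigma>. R \<le> \<sigma> \<Longrightarrow> \<sigma> \<le> s \<Longrightarrow> r \<sigma> t * \<sigma> \<le> k * (1 + \<sigma> + t)) \<Longrightarrow> s \<le> M"
proof -
  have "filterlim (\<lambda>t. r t (1 * t + 0)) at_top at_top"
    using r unfolding property_R_def by (meson order_refl zero_le_one)
  \<comment> \<open>For \<open>1 \<le> t\<close> the term \<open>3 * k * t\<close> absorbs
    \<open>k * (1 + t + t)\<close>; the extra 1 yields the contradiction.\<close>
  then have "eventually (\<lambda>t. 3 * k + 1 \<le> r t t) at_top" by (simp add: filterlim_at_top)
  then obtain T where T: "\<And>t. T \<le> t \<Longrightarrow> 3 * k + 1 \<le> r t t"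
    by (auto simp: eventually_at_top_linorder)
  define T1 where "T1 = max 1 (max R T)"
  \<comment> \<open>For \<open>1 \<le> s\<close> and \<open>t \<le> T1\<close> the factor
    \<open>1 + s + t\<close> is at most \<open>(2 + T1) * s\<close>, hence this threshold. It has to
    hold uniformly in \<open>t\<close>, which is known only to lie in the interval.\<close>
  have "eventually (\<lambda>s. \<forall>t\<in>{0..T1}. k * (2 + T1) + 1 \<le> r s t) at_top"
    using r unfolding property_R_def by (auto simp: T1_def)
  then obtain T2 where T2: "\<And>s t. T2 \<le> s \<Longrightarrow> t \<in> {0..T1} \<Longrightarrow> k * (2 + T1) + 1 \<le> r s t"
    unfolding eventually_at_top_linorder by blast
  show ?thesis
  proof (rule that[of "max T1 T2"])
    show "R \<le> max T1 T2" by (simp add: T1_def)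
    fix s t assume t: "0 \<le> t" "t \<le> s"
      and est: "\<And>\<sigma>. R \<le> \<sigma> \<Longrightarrow> \<sigma> \<le> s \<Longrightarrow> r \<sigma> t * \<sigma> \<le> k * (1 + \<sigma> + t)"
    have tT: "t < T1"
    proof (rule ccontr)
      assume "\<not> t < T1"
      then have t1: "1 \<le> t" "R \<le> t" "T \<le> t" by (auto simp: T1_def)
      have "(3 * k + 1) * t \<le> r t t * t" using T[OF t1(3)] t(1) by (rule mult_right_mono)
      also have "\<dots> \<le> k * (1 + t + t)" using est t1(2) t(2) by blast
      also have "\<dots> \<le> k * (3 * t)" using t1(1) k by (intro mult_left_mono) auto
      finally show False using t1(1) by (simp add: algebra_simps)
    qed
    show "s \<le> max T1 T2"
    proof (rule ccontr)
      assume "\<not> ?thesis"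
      then have s: "1 \<le> s" "R \<le> s" "T2 \<le> s" by (auto simp: T1_def)
      have "(k * (2 + T1) + 1) * s \<le> r s t * s"
        using T2[OF s(3), of t] tT t(1) s(1) by (intro mult_right_mono) auto
      also have "\<dots> \<le> k * (1 + s + t)" using est s(2) by blast
      also have "\<dots> \<le> k * ((2 + T1) * s)"
      proof (rule mult_left_mono[OF _ k])
        have "t * 1 \<le> T1 * s" using tT t(1) s(1) by (intro mult_mono) auto
        then show "1 + s + t \<le> (2 + T1) * s" using s(1) by (simp add: distrib_right)
      qed
      finally show False using s(1) by (simp add: algebra_simps)
    qed
  qed
qed

section \<open>The coupled system\<close>

text \<open>Normalised weights exhibit \<open>u\<close> as a convex combination of the test points,
  so \<open>\<psi> u\<close> is finite and at most the average of their values. Summing the strict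
  violations makes the weighted sum of \<open>form\<close> negative, although sublinearity bounds it
  below by \<open>form w u 0 = 0\<close>.\<close>

lemma (in parametric_vhi) moves_not_balanced:
  assumes fin: "finite I" and dom: "\<And>v. v \<in> I \<Longrightarrow> \<psi> v < \<infinity>" and a: "\<And>v. v \<in> I \<Longrightarrow> 0 \<le> a v"
    and pos: "z \<in> I" "0 < a z"
    and viol: "\<And>v. v \<in> I \<Longrightarrow> 0 < a v \<Longrightarrow> \<not> stampacchia w u v"
  shows "(\<Sum>v\<in>I. a v *\<^sub>R (v - u)) \<noteq> 0"
proof
  assume zero: "(\<Sum>v\<in>I. a v *\<^sub>R (v - u)) = 0"
  define p where "p v = real_of_ereal (\<psi> v)" for v
  have p: "\<psi> v = ereal (p v)" if "v \<in> I" for v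
    using dom[OF that] psi_ninf[of v] by (cases "\<psi> v") (auto simp: p_def)
  define W where "W = (\<Sum>v\<in>I. a v)"
  have W: "W > 0" unfolding W_def by (rule sum_pos2[OF fin, of z]) (use pos a in auto)
  have "(\<Sum>v\<in>I. a v *\<^sub>R v) = W *\<^sub>R u"
    using zero by (simp add: scaleR_diff_right sum_subtractf W_def scaleR_left.sum)
  moreover have "(\<Sum>v\<in>I. (a v / W) *\<^sub>R v) = inverse W *\<^sub>R (\<Sum>v\<in>I. a v *\<^sub>R v)"
    by (simp add: scaleR_right.sum divide_inverse mult.commute)
  ultimately have "(\<Sum>v\<in>I. (a v / W) *\<^sub>R v) = u" using W by simp
  moreover have "\<psi> (\<Sum>v\<in>I. (a v / W) *\<^sub>R v) \<le> ereal (\<Sum>v\<in>I. a v / W * p v)"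
    using W a p by (intro ereal_convex_sum[OF psi_convex fin]) (auto simp: W_def simp flip: sum_divide_distrib)
  ultimately have le: "\<psi> u \<le> ereal (\<Sum>v\<in>I. a v / W * p v)" by simp
  then obtain q where q: "\<psi> u = ereal q" using psi_ninf[of u] by (cases "\<psi> u") auto
  have "W * (\<Sum>v\<in>I. a v / W * p v) = (\<Sum>v\<in>I. a v * p v)"
    using W by (simp add: sum_distrib_left)
  moreover have "W * q \<le> W * (\<Sum>v\<in>I. a v / W * p v)"
    using le q W by (intro mult_left_mono) auto
  ultimately have Wq: "W * q \<le> (\<Sum>v\<in>I. a v * p v)" by simp
  have lt: "form w u (v - u) + p v < q" if "v \<in> I" "0 < a v" for v
    using viol[OF that] by (simp add: stampacchia_def q p[OF that(1)] not_le)
  have "(\<Sum>v\<in>I. a v * (form w u (v - u) + p v)) < (\<Sum>v\<in>I. a v * q)"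
  proof (rule sum_strict_mono_ex1[OF fin])
    show "\<forall>v\<in>I. a v * (form w u (v - u) + p v) \<le> a v * q"
    proof
      fix v assume v: "v \<in> I"
      show "a v * (form w u (v - u) + p v) \<le> a v * q"
        using lt[OF v] a[OF v] by (cases "a v = 0") (auto intro!: mult_left_mono less_imp_le)
    qed
    show "\<exists>v\<in>I. a v * (form w u (v - u) + p v) < a v * q"
      using lt[OF pos] pos by (intro bexI[of _ z]) auto
  qed
  then have "(\<Sum>v\<in>I. a v * form w u (v - u)) + (\<Sum>v\<in>I. a v * p v) < W * q"
    by (simp add: distrib_left sum.distrib W_def sum_distrib_right)
  moreover have "0 \<le> (\<Sum>v\<in>I. a v * form w u (v - u))"
    using sublinear_sum[OF sublinear_form[of w u] fin, of a "\<lambda>v. v - u"] a zero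
    by (simp add: sublinear_zero[OF sublinear_form])
  ultimately show False using Wq by simp
qed

lemma convex_moves:
  assumes S: "convex S" "x \<in> S" and fin: "finite I" and a: "\<And>i. i \<in> I \<Longrightarrow> 0 \<le> a i"
    and le: "(\<Sum>i\<in>I. a i) \<le> 1" and y: "\<And>i. i \<in> I \<Longrightarrow> y i \<in> S"
  shows "x + (\<Sum>i\<in>I. a i *\<^sub>R (y i - x)) \<in> S"
proof -
  have "(1 - (\<Sum>i\<in>I. a i)) *\<^sub>R x + (\<Sum>i\<in>I. a i *\<^sub>R y i) \<in> S"
  proof (cases "(\<Sum>i\<in>I. a i) = 0")
    case True
    then have "a i = 0" if "i \<in> I" for i using a fin that by (simp add: sum_nonneg_eq_0_iff)
    then show ?thesis using S(2) by simp
  next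
    case False
    define W where "W = (\<Sum>i\<in>I. a i)"
    have W: "0 < W" "W \<le> 1" using False a le sum_nonneg[of I a] by (auto simp: W_def less_le)
    have "(\<Sum>i\<in>I. (a i / W) *\<^sub>R y i) \<in> S"
      using W a y by (intro convex_sum[OF fin S(1)]) (auto simp: W_def simp flip: sum_divide_distrib)
    then have "(1 - W) *\<^sub>R x + W *\<^sub>R (\<Sum>i\<in>I. (a i / W) *\<^sub>R y i) \<in> S"
      using W S by (intro convexD) auto
    then show ?thesis using W by (simp add: W_def scaleR_right.sum)
  qed
  then show ?thesis
    by (simp add: scaleR_diff_right sum_subtractf scaleR_diff_left algebra_simps flip: scaleR_left.sum)
qed

lemma norm_on_segment:
  assumes "norm a \<le> \<sigma>" "\<sigma> \<le> norm b"
  obtains y where "y \<in> closed_segment a b" "norm y = \<sigma>"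
proof -
  have "\<exists>t\<ge>0. t \<le> 1 \<and> norm ((1 - t) *\<^sub>R a + t *\<^sub>R b) = \<sigma>"
    by (rule IVT') (use assms in \<open>auto intro!: continuous_intros\<close>)
  then show ?thesis using that by (auto simp: in_segment)
qed

lemma weakly_tendsto_fst: "weakly_tendsto x a \<Longrightarrow> weakly_tendsto (\<lambda>n. fst (x n)) (fst a)"
  using weakly_tendsto_blinfun[of x a fst_blinfun] by simp

lemma weakly_tendsto_snd: "weakly_tendsto x a \<Longrightarrow> weakly_tendsto (\<lambda>n. snd (x n)) (snd a)"
  using weakly_tendsto_blinfun[of x a snd_blinfun] by simp

lemma reflexive_space_prod:
  assumes "reflexive_space TYPE('a::real_normed_vector)" "reflexive_space TYPE('b::real_normed_vector)"
  shows "reflexive_space TYPE('a \<times> 'b)"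
  unfolding reflexive_space_def
proof
  fix \<Phi> :: "(('a \<times> 'b) \<Rightarrow>\<^sub>L real) \<Rightarrow>\<^sub>L real"
  have "bounded_linear (\<lambda>f :: 'a \<Rightarrow>\<^sub>L real. \<Phi> (f o\<^sub>L fst_blinfun :: ('a \<times> 'b) \<Rightarrow>\<^sub>L real))"
    by (intro blinfun.bounded_linear_right[THEN bounded_linear_compose]
        bounded_bilinear.bounded_linear_left[OF bounded_bilinear_blinfun_compose])
  from bounded_linear_Blinfun_apply[OF this]
  obtain u where u: "\<And>f :: 'a \<Rightarrow>\<^sub>L real. \<Phi> (f o\<^sub>L (fst_blinfun :: ('a \<times> 'b) \<Rightarrow>\<^sub>L 'a)) = blinfun_apply f (u :: 'a)"
    using assms(1) unfolding reflexive_space_def by metis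
  have "bounded_linear (\<lambda>f :: 'b \<Rightarrow>\<^sub>L real. \<Phi> (f o\<^sub>L snd_blinfun :: ('a \<times> 'b) \<Rightarrow>\<^sub>L real))"
    by (intro blinfun.bounded_linear_right[THEN bounded_linear_compose]
        bounded_bilinear.bounded_linear_left[OF bounded_bilinear_blinfun_compose])
  from bounded_linear_Blinfun_apply[OF this]
  obtain w where w: "\<And>f :: 'b \<Rightarrow>\<^sub>L real. \<Phi> (f o\<^sub>L (snd_blinfun :: ('a \<times> 'b) \<Rightarrow>\<^sub>L 'b)) = blinfun_apply f (w :: 'b)"
    using assms(2) unfolding reflexive_space_def by metis
  have "\<Phi> f = f (u, w)" for f
  proof -
    define i1 :: "'a \<Rightarrow>\<^sub>L ('a \<times> 'b)" where "i1 = Blinfun (\<lambda>x. (x, 0))"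
    define i2 :: "'b \<Rightarrow>\<^sub>L ('a \<times> 'b)" where "i2 = Blinfun (\<lambda>y. (0, y))"
    have i1: "i1 x = (x, 0)" for x
      unfolding i1_def by (simp add: bounded_linear_Blinfun_apply bounded_linear_Pair bounded_linear_ident bounded_linear_zero)
    have i2: "i2 y = (0, y)" for y
      unfolding i2_def by (simp add: bounded_linear_Blinfun_apply bounded_linear_Pair bounded_linear_ident bounded_linear_zero)
    have split: "f (x, y) = f (x, 0) + f (0, y)" for x y
      by (simp flip: blinfun.add_right)
    have "f = ((f o\<^sub>L i1) o\<^sub>L fst_blinfun) + ((f o\<^sub>L i2) o\<^sub>L snd_blinfun)"
      by (rule blinfun_eqI) (auto simp: blinfun.add_left i1 i2 intro: split)
    then have "\<Phi> f = \<Phi> ((f o\<^sub>L i1) o\<^sub>L fst_blinfun) + \<Phi> ((f o\<^sub>L i2) o\<^sub>L snd_blinfun)"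
      by (metis blinfun.add_right)
    also have "\<dots> = f (u, 0) + f (0, w)" by (simp only: u w) (simp add: i1 i2)
    also have "\<dots> = f (u, w)" by (rule split[symmetric])
    finally show ?thesis .
  qed
  then show "\<exists>x. \<forall>f. \<Phi> f = blinfun_apply f x" by blast
qed

section \<open>Finitely many test points and the a priori bound\<close>

locale coupled_vhi =
  P: parametric_vhi h \<gamma>1 \<delta>1 \<psi> J A + Q: parametric_vhi l \<gamma>2 \<delta>2 \<theta> H B
  for h :: "'v::real_normed_vector \<Rightarrow>\<^sub>L real" and l :: "'e::real_normed_vector \<Rightarrow>\<^sub>L real"
    and \<gamma>1 :: "'v \<Rightarrow>\<^sub>L 'x::real_normed_vector" and \<gamma>2 :: "'e \<Rightarrow>\<^sub>L 'y::real_normed_vector"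
    and \<delta>1 :: "'e \<Rightarrow>\<^sub>L 'z1::real_normed_vector" and \<delta>2 :: "'v \<Rightarrow>\<^sub>L 'z2::real_normed_vector"
    and \<psi> :: "'v \<Rightarrow> ereal" and \<theta> :: "'e \<Rightarrow> ereal"
    and J :: "'z1 \<Rightarrow> 'x \<Rightarrow> real" and H :: "'z2 \<Rightarrow> 'y \<Rightarrow> real"
    and A :: "'e \<Rightarrow> 'v \<Rightarrow> ('v \<Rightarrow>\<^sub>L real)" and B :: "'v \<Rightarrow> 'e \<Rightarrow> ('e \<Rightarrow>\<^sub>L real)"
begin

text \<open>An argument of Knaster-Kuratowski-Mazurkiewicz type on both hulls at once: each test
  point attracts with a weight that measures how far the pair is from the solutions of its Minty
  inequality.\<close>

lemma finite_minty:
  assumes I: "finite I" "I \<noteq> {}" "\<And>v. v \<in> I \<Longrightarrow> \<psi> v < \<infinity>"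
    and K: "finite K" "K \<noteq> {}" "\<And>z. z \<in> K \<Longrightarrow> \<theta> z < \<infinity>"
  shows "\<exists>u\<in>convex hull I. \<exists>w\<in>convex hull K. (\<forall>v\<in>I. P.minty w u v) \<and> (\<forall>z\<in>K. Q.minty u w z)"
proof (rule ccontr)
  assume none: "\<not> ?thesis"
  define X where "X = (convex hull I) \<times> (convex hull K)"
  have X: "compact X" "convex X" "X \<noteq> {}"
    unfolding X_def using I K by (auto intro: compact_Times finite_imp_compact_convex_hull convex_Times)
  define ZP where "ZP v = {x \<in> X. P.minty (snd x) (fst x) v}" for v
  define ZQ where "ZQ z = {x \<in> X. Q.minty (fst x) (snd x) z}" for z
  have fs: "weakly_tendsto (\<lambda>n. fst (x n)) (fst a)" "bounded (range (\<lambda>n. fst (x n)))"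
    "weakly_tendsto (\<lambda>n. snd (x n)) (snd a)" "bounded (range (\<lambda>n. snd (x n)))"
    if "x \<longlonglongrightarrow> a" for x :: "nat \<Rightarrow> 'v \<times> 'e" and a
    using tendsto_fst[OF that] tendsto_snd[OF that]
    by (auto intro: tendsto_imp_weakly_tendsto convergent_imp_bounded)
  have XL: "a \<in> X" if "x \<longlonglongrightarrow> a" "\<And>n. x n \<in> X" for x a
    using closed_sequentially[OF compact_imp_closed[OF X(1)]] that by blast
  have ZP: "closed (ZP v)" for v
    unfolding closed_sequential_limits ZP_def
    using XL fs P.minty_weakly_closed by blast
  have ZQ: "closed (ZQ z)" for z
    unfolding closed_sequential_limits ZQ_def
    using XL fs Q.minty_weakly_closed by blast
  \<comment> \<open>\<open>infdist\<close> to the empty set is 0 and would signal membership; the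
    value 1 keeps \<open>\<phi> v x = 0\<close> equivalent to \<open>x \<in> ZP v\<close>.\<close>
  define \<phi> where "\<phi> v x = (if ZP v = {} then 1 else infdist x (ZP v))" for v x
  define \<rho> where "\<rho> z x = (if ZQ z = {} then 1 else infdist x (ZQ z))" for z x
  have nonneg: "0 \<le> \<phi> v x" "0 \<le> \<rho> z x" for v z x
    by (simp_all add: \<phi>_def \<rho>_def infdist_nonneg)
  have zero: "\<phi> v x = 0 \<longleftrightarrow> x \<in> ZP v" "\<rho> z x = 0 \<longleftrightarrow> x \<in> ZQ z" for v z x
    using in_closed_iff_infdist_zero[OF ZP, of v x] in_closed_iff_infdist_zero[OF ZQ, of z x]
    by (auto simp: \<phi>_def \<rho>_def)
  have cont: "continuous_on S (\<phi> v)" "continuous_on S (\<rho> z)" for S v z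
  proof -
    show "continuous_on S (\<phi> v)"
    proof (cases "ZP v = {}")
      case True
      then have "\<phi> v = (\<lambda>x. 1)" by (simp add: \<phi>_def fun_eq_iff)
      then show ?thesis by simp
    next
      case False
      then have "\<phi> v = (\<lambda>x. infdist x (ZP v))" by (simp add: \<phi>_def fun_eq_iff)
      then show ?thesis by (simp add: continuous_on_infdist)
    qed
    show "continuous_on S (\<rho> z)"
    proof (cases "ZQ z = {}")
      case True
      then have "\<rho> z = (\<lambda>x. 1)" by (simp add: \<rho>_def fun_eq_iff)
      then show ?thesis by simp
    next
      case False
      then have "\<rho> z = (\<lambda>x. infdist x (ZQ z))" by (simp add: \<rho>_def fun_eq_iff)
      then show ?thesis by (simp add: continuous_on_infdist)
    qed
  qed
  \<comment> \<open>One normaliser for both components: it is positive even if only one of the two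
    families is violated, and it keeps the total weight in each component at most 1.\<close>
  define s where "s x = (\<Sum>v\<in>I. \<phi> v x) + (\<Sum>z\<in>K. \<rho> z x)" for x
  have some: "(\<exists>v\<in>I. 0 < \<phi> v x) \<or> (\<exists>z\<in>K. 0 < \<rho> z x)" if "x \<in> X" for x
  proof (rule ccontr)
    assume "\<not> ?thesis"
    then have "\<forall>v\<in>I. x \<in> ZP v" "\<forall>z\<in>K. x \<in> ZQ z"
      using nonneg zero by (metis less_eq_real_def)+
    then have "\<forall>v\<in>I. P.minty (snd x) (fst x) v" "\<forall>z\<in>K. Q.minty (fst x) (snd x) z"
      by (simp_all add: ZP_def ZQ_def)
    moreover have "fst x \<in> convex hull I" "snd x \<in> convex hull K"
      using that by (auto simp: X_def)
    ultimately show False using none by blast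
  qed
  have s: "s x > 0" if "x \<in> X" for x
    using some[OF that]
  proof
    assume "\<exists>v\<in>I. 0 < \<phi> v x"
    then obtain v where v: "v \<in> I" "0 < \<phi> v x" by blast
    then have "0 < (\<Sum>v\<in>I. \<phi> v x)" using nonneg by (intro sum_pos2[OF I(1)]) auto
    then show ?thesis unfolding s_def by (intro add_pos_nonneg sum_nonneg nonneg)
  next
    assume "\<exists>z\<in>K. 0 < \<rho> z x"
    then obtain z where z: "z \<in> K" "0 < \<rho> z x" by blast
    then have "0 < (\<Sum>z\<in>K. \<rho> z x)" using nonneg by (intro sum_pos2[OF K(1)]) auto
    then show ?thesis unfolding s_def by (intro add_nonneg_pos sum_nonneg nonneg)
  qed
  define f where "f x = (fst x + (\<Sum>v\<in>I. (\<phi> v x / s x) *\<^sub>R (v - fst x)),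
    snd x + (\<Sum>z\<in>K. (\<rho> z x / s x) *\<^sub>R (z - snd x)))" for x
  have "continuous_on X s" unfolding s_def by (intro continuous_intros cont)
  then have "continuous_on X f"
    unfolding f_def using s by (intro continuous_intros cont) (metis less_irrefl)+
  moreover have "f x \<in> X" if x: "x \<in> X" for x
  proof -
    have "(\<Sum>v\<in>I. \<phi> v x / s x) \<le> 1" "(\<Sum>z\<in>K. \<rho> z x / s x) \<le> 1"
      using s[OF x] nonneg by (simp_all add: s_def sum_nonneg flip: sum_divide_distrib)
    then have "fst (f x) \<in> convex hull I" "snd (f x) \<in> convex hull K"
      unfolding f_def fst_conv snd_conv using x I(1) K(1) nonneg s[OF x]
      by (auto simp: X_def hull_inc intro!: convex_moves)
    then show ?thesis by (simp add: X_def mem_Times_iff)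
  qed
  ultimately obtain x where x: "x \<in> X" "f x = x" using schauder_fixed_point[OF X] by blast
  obtain u w where uw: "x = (u, w)" by fastforce
  have bal: "(\<Sum>v\<in>I. (\<phi> v x / s x) *\<^sub>R (v - u)) = 0" "(\<Sum>z\<in>K. (\<rho> z x / s x) *\<^sub>R (z - w)) = 0"
    using x(2) by (simp_all add: f_def uw)
  \<comment> \<open>A positive weight means that Minty's inequality fails; by contraposition
    Stampacchia's fails too, as \<open>moves_not_balanced\<close> requires.\<close>
  have viol: "\<not> P.stampacchia w u v" if "0 < \<phi> v x / s x" for v
  proof
    assume "P.stampacchia w u v"
    then have "x \<in> ZP v" using P.stampacchia_imp_minty x(1) by (simp add: ZP_def uw)
    with that show False using zero(1)[of v x] by simp
  qed
  have viol': "\<not> Q.stampacchia u w z" if "0 < \<rho> z x / s x" for z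
  proof
    assume "Q.stampacchia u w z"
    then have "x \<in> ZQ z" using Q.stampacchia_imp_minty x(1) by (simp add: ZQ_def uw)
    with that show False using zero(2)[of z x] by simp
  qed
  show False
    using some[OF x(1)]
  proof
    assume "\<exists>v\<in>I. 0 < \<phi> v x"
    then obtain v where "v \<in> I" "0 < \<phi> v x / s x" using s[OF x(1)] by auto
    from P.moves_not_balanced[where I = I and a = "\<lambda>v. \<phi> v x / s x", OF I(1,3) _ this, of w u] show False
      using bal(1) viol nonneg s[OF x(1)] by (simp add: less_imp_le)
  next
    assume "\<exists>z\<in>K. 0 < \<rho> z x"
    then obtain z where "z \<in> K" "0 < \<rho> z x / s x" using s[OF x(1)] by auto
    from Q.moves_not_balanced[where I = K and a = "\<lambda>z. \<rho> z x / s x", OF K(1,3) _ this, of u w] show False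
      using bal(2) viol' nonneg s[OF x(1)] by (simp add: less_imp_le)
  qed
qed

definition solutions :: "'v set \<Rightarrow> 'e set \<Rightarrow> ('v \<times> 'e) set" where
  "solutions C D = {(u, w). u \<in> C \<and> w \<in> D \<and>
     (\<forall>v\<in>C. P.stampacchia w u v) \<and> (\<forall>z\<in>D. Q.stampacchia u w z)}"

text \<open>Testing Minty's inequalities with \<open>u0\<close> and \<open>w0\<close> gives the
  finite values of \<open>\<psi>\<close> and \<open>\<theta>\<close> on which the way back to
  Stampacchia's form relies.\<close>

lemma in_solutions_iff_minty:
  assumes C: "convex C" "u0 \<in> C" "\<psi> u0 < \<infinity>" and D: "convex D" "w0 \<in> D" "\<theta> w0 < \<infinity>"
  shows "x \<in> solutions C D \<longleftrightarrow> x \<in> C \<times> D \<and>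
    (\<forall>v\<in>C. P.minty (snd x) (fst x) v) \<and> (\<forall>z\<in>D. Q.minty (fst x) (snd x) z)"
proof
  assume "x \<in> solutions C D"
  then show "x \<in> C \<times> D \<and>
      (\<forall>v\<in>C. P.minty (snd x) (fst x) v) \<and> (\<forall>z\<in>D. Q.minty (fst x) (snd x) z)"
    unfolding solutions_def using P.stampacchia_imp_minty Q.stampacchia_imp_minty by auto
next
  assume x: "x \<in> C \<times> D \<and>
    (\<forall>v\<in>C. P.minty (snd x) (fst x) v) \<and> (\<forall>z\<in>D. Q.minty (fst x) (snd x) z)"
  then have "\<psi> (fst x) < \<infinity>" "\<theta> (snd x) < \<infinity>"
    using P.minty_finite[of "snd x" "fst x" u0] Q.minty_finite[of "fst x" "snd x" w0] C(2,3) D(2,3)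
    by simp_all
  then have "\<forall>v\<in>C. P.stampacchia (snd x) (fst x) v" "\<forall>z\<in>D. Q.stampacchia (fst x) (snd x) z"
    using x P.minty_imp_stampacchia[OF C(1)] Q.minty_imp_stampacchia[OF D(1)]
    by (simp_all add: mem_Times_iff)
  with x show "x \<in> solutions C D" by (simp add: solutions_def mem_Times_iff case_prod_unfold)
qed

text \<open>\<open>M\<close> is chosen before \<open>C\<close> and \<open>D\<close>, so it also
  bounds the solutions on sets cut by a ball whose radius depends on \<open>M\<close>.\<close>

lemma a_priori_bound:
  assumes u0: "\<psi> u0 < \<infinity>" and w0: "\<theta> w0 < \<infinity>"
  obtains M where "norm u0 \<le> M" "norm w0 \<le> M"
    "\<And>C D u w. convex C \<Longrightarrow> convex D \<Longrightarrow> u0 \<in> C \<Longrightarrow> w0 \<in> D \<Longrightarrow> (u, w) \<in> solutions C D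
      \<Longrightarrow> norm u \<le> M \<and> norm w \<le> M"
proof -
  obtain r k where r: "property_R r" "k \<ge> 0"
    "\<And>w u. P.stampacchia w u u0 \<Longrightarrow> r (norm u) (norm w) * norm u \<le> k * (1 + norm u + norm w)"
    by (fact P.coercive_estimate[OF u0])
  obtain r' k' where r': "property_R r'" "k' \<ge> 0"
    "\<And>u w. Q.stampacchia u w w0 \<Longrightarrow> r' (norm w) (norm u) * norm w \<le> k' * (1 + norm w + norm u)"
    by (fact Q.coercive_estimate[OF w0])
  obtain M1 where M1: "norm u0 \<le> M1" "\<And>s t. 0 \<le> t \<Longrightarrow> t \<le> s \<Longrightarrow>
      (\<And>\<sigma>. norm u0 \<le> \<sigma> \<Longrightarrow> \<sigma> \<le> s \<Longrightarrow> r \<sigma> t * \<sigma> \<le> k * (1 + \<sigma> + t)) \<Longrightarrow> s \<le> M1"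
    by (fact property_R_bound[OF r(1,2) norm_ge_zero])
  obtain M2 where M2: "norm w0 \<le> M2" "\<And>s t. 0 \<le> t \<Longrightarrow> t \<le> s \<Longrightarrow>
      (\<And>\<sigma>. norm w0 \<le> \<sigma> \<Longrightarrow> \<sigma> \<le> s \<Longrightarrow> r' \<sigma> t * \<sigma> \<le> k' * (1 + \<sigma> + t)) \<Longrightarrow> s \<le> M2"
    by (fact property_R_bound[OF r'(1,2) norm_ge_zero])
  show ?thesis
  proof (rule that[of "max M1 M2"])
    fix C D u w
    assume CD: "convex C" "convex D" "u0 \<in> C" "w0 \<in> D" and uw: "(u, w) \<in> solutions C D"
    have seg: "closed_segment u0 u \<subseteq> C" "closed_segment w0 w \<subseteq> D"
      using CD uw by (auto simp: solutions_def closed_segment_subset)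
    show "norm u \<le> max M1 M2 \<and> norm w \<le> max M1 M2"
    proof (cases "norm w \<le> norm u")
      case True
      have "norm u \<le> M1"
      proof (rule M1(2)[OF norm_ge_zero True])
        fix \<sigma> assume "norm u0 \<le> \<sigma>" "\<sigma> \<le> norm u"
        then obtain y where y: "y \<in> closed_segment u0 u" "norm y = \<sigma>" by (rule norm_on_segment)
        have "P.stampacchia w y u0"
          using seg(1) uw y(1) by (intro P.stampacchia_segment[OF _ u0, of u]) (auto simp: solutions_def)
        from r(3)[OF this] y(2) show "r \<sigma> (norm w) * \<sigma> \<le> k * (1 + \<sigma> + norm w)" by simp
      qed
      with True show ?thesis by (meson max.coboundedI1 order_trans)
    next
      case False
      have "norm w \<le> M2"
      proof (rule M2(2)[OF norm_ge_zero])
        show "norm u \<le> norm w" using False by simp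
        fix \<sigma> assume "norm w0 \<le> \<sigma>" "\<sigma> \<le> norm w"
        then obtain y where y: "y \<in> closed_segment w0 w" "norm y = \<sigma>" by (rule norm_on_segment)
        have "Q.stampacchia u y w0"
          using seg(2) uw y(1) by (intro Q.stampacchia_segment[OF _ w0, of w]) (auto simp: solutions_def)
        from r'(3)[OF this] y(2) show "r' \<sigma> (norm u) * \<sigma> \<le> k' * (1 + \<sigma> + norm u)" by simp
      qed
      with False show ?thesis by (meson max.coboundedI2 order_trans linear)
    qed
  qed (use M1(1) M2(1) in auto)
qed

end

section \<open>Weakly closed Minty sets and existence\<close>

context coupled_vhi
begin

text \<open>Test sets are separate from constraint sets: single test points give the closed sets for
  the finite intersection property, and \<open>I = C\<close>, \<open>K = D\<close> gives the
  solutions.\<close>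

definition minty_set :: "'v set \<Rightarrow> 'e set \<Rightarrow> 'v set \<Rightarrow> 'e set \<Rightarrow> ('v \<times> 'e) set" where
  "minty_set C D I K = {x \<in> C \<times> D.
     (\<forall>v\<in>I. P.minty (snd x) (fst x) v) \<and> (\<forall>z\<in>K. Q.minty (fst x) (snd x) z)}"

lemma closedin_minty_set:
  assumes refl: "reflexive_space TYPE('v)" "reflexive_space TYPE('e)"
    and C: "closed C" "convex C" and D: "closed D" "convex D"
    and bd: "bounded (minty_set C D I K)"
  shows "closedin weak_topology (minty_set C D I K)"
proof (rule weakly_sequentially_closed_imp_closedin[OF reflexive_space_prod[OF refl] bd])
  fix x a assume x: "\<And>n. x n \<in> minty_set C D I K" and lim: "weakly_tendsto x a"
  have "closedin weak_topology (C \<times> D)"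
    using C D by (intro closedin_weak_closed_convex closed_Times convex_Times)
  with lim have "a \<in> C \<times> D"
    by (rule weakly_tendsto_closedin) (use x in \<open>simp add: minty_set_def\<close>)
  moreover have "bounded (range x)" using bd by (rule bounded_subset) (use x in blast)
  then have b: "bounded (range (\<lambda>n. fst (x n)))" "bounded (range (\<lambda>n. snd (x n)))"
    using bounded_fst[of "range x"] bounded_snd[of "range x"] by (simp_all add: image_image)
  have "P.minty (snd a) (fst a) v" if "v \<in> I" for v
    by (rule P.minty_weakly_closed[OF weakly_tendsto_snd[OF lim] b(2) weakly_tendsto_fst[OF lim] b(1)])
      (use x that in \<open>simp add: minty_set_def\<close>)
  moreover have "Q.minty (fst a) (snd a) z" if "z \<in> K" for z
    by (rule Q.minty_weakly_closed[OF weakly_tendsto_fst[OF lim] b(1) weakly_tendsto_snd[OF lim] b(2)])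
      (use x that in \<open>simp add: minty_set_def\<close>)
  ultimately show "a \<in> minty_set C D I K" by (simp add: minty_set_def)
qed

lemma solutions_eq_minty_set:
  assumes "convex C" "u0 \<in> C" "\<psi> u0 < \<infinity>" and "convex D" "w0 \<in> D" "\<theta> w0 < \<infinity>"
  shows "solutions C D = minty_set C D C D"
  using in_solutions_iff_minty[OF assms] by (auto simp: minty_set_def)

lemma solutions_bounded_nonempty:
  assumes refl: "reflexive_space TYPE('v)" "reflexive_space TYPE('e)"
    and C: "closed C" "convex C" "bounded C" "u0 \<in> C" "\<psi> u0 < \<infinity>"
    and D: "closed D" "convex D" "bounded D" "w0 \<in> D" "\<theta> w0 < \<infinity>"
  shows "solutions C D \<noteq> {}"
proof -
  have bd: "bounded (minty_set C D I K)" for I K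
    by (rule bounded_subset[OF bounded_Times[OF C(3) D(3)]]) (auto simp: minty_set_def)
  note cl = closedin_minty_set[OF refl C(1,2) D(1,2) bd]
  let ?I = "{v \<in> C. \<psi> v < \<infinity>}" and ?K = "{z \<in> D. \<theta> z < \<infinity>}"
  let ?U = "(\<lambda>v. minty_set C D {v} {}) ` ?I" and ?V = "(\<lambda>z. minty_set C D {} {z}) ` ?K"
  have cpt: "compactin weak_topology (minty_set C D {} {})"
    by (rule compactin_weak_closedin[OF reflexive_space_prod[OF refl] bd cl])
  have U: "\<forall>U\<in>?U \<union> ?V. closedin weak_topology U" using cl by blast
  have fip: "minty_set C D {} {} \<inter> \<Inter>\<F> \<noteq> {}" if \<F>: "finite \<F>" "\<F> \<subseteq> ?U \<union> ?V" for \<F>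
  proof -
    obtain I where I: "I \<subseteq> ?I" "finite I" "\<F> \<inter> ?U = (\<lambda>v. minty_set C D {v} {}) ` I"
      using finite_subset_image[OF finite_Int[OF disjI1[OF \<F>(1)]] Int_lower2[of \<F> ?U]]
      by (elim exE conjE)
    obtain K where K: "K \<subseteq> ?K" "finite K" "\<F> \<inter> ?V = (\<lambda>z. minty_set C D {} {z}) ` K"
      using finite_subset_image[OF finite_Int[OF disjI1[OF \<F>(1)]] Int_lower2[of \<F> ?V]]
      by (elim exE conjE)
    \<comment> \<open>Adding \<open>u0\<close> and \<open>w0\<close> keeps both sets of test points
      nonempty even if the subfamily involves only one of the two inequalities, or none.\<close>
    have "\<exists>u\<in>convex hull (insert u0 I). \<exists>w\<in>convex hull (insert w0 K).
        (\<forall>v\<in>insert u0 I. P.minty w u v) \<and> (\<forall>z\<in>insert w0 K. Q.minty u w z)"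
      by (rule finite_minty) (use I(1,2) K(1,2) C(5) D(5) in auto)
    then obtain u w where uw: "u \<in> convex hull (insert u0 I)" "w \<in> convex hull (insert w0 K)"
      "\<forall>v\<in>I. P.minty w u v" "\<forall>z\<in>K. Q.minty u w z"
      by auto
    have "convex hull (insert u0 I) \<subseteq> C" "convex hull (insert w0 K) \<subseteq> D"
      using I(1) K(1) C(2,4) D(2,4) by (intro hull_minimal; auto)+
    with uw(1,2) have "(u, w) \<in> C \<times> D" by blast
    then have "(u, w) \<in> minty_set C D {} {}" "\<And>v. v \<in> I \<Longrightarrow> (u, w) \<in> minty_set C D {v} {}"
      "\<And>z. z \<in> K \<Longrightarrow> (u, w) \<in> minty_set C D {} {z}"
      using uw(3,4) by (simp_all add: minty_set_def)
    moreover from this have "(u, w) \<in> X" if "X \<in> \<F>" for X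
    proof -
      from that \<F>(2) have "X \<in> \<F> \<inter> ?U \<or> X \<in> \<F> \<inter> ?V" by auto
      then have "X \<in> (\<lambda>v. minty_set C D {v} {}) ` I \<or> X \<in> (\<lambda>z. minty_set C D {} {z}) ` K"
        by (simp only: I(3) K(3))
      then show ?thesis using calculation by auto
    qed
    ultimately show ?thesis by blast
  qed
  have "minty_set C D {} {} \<inter> \<Inter>(?U \<union> ?V) \<noteq> {}"
    by (rule cpt[unfolded compactin_fip, THEN conjunct2, THEN spec, THEN mp], intro conjI allI impI)
      (use U fip in simp_all)
  then obtain x where "x \<in> minty_set C D {} {} \<inter> \<Inter>(?U \<union> ?V)"
    unfolding ex_in_conv[symmetric] by (elim exE)
  then have x: "x \<in> minty_set C D {} {}" "\<And>v. v \<in> ?I \<Longrightarrow> x \<in> minty_set C D {v} {}"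
    "\<And>z. z \<in> ?K \<Longrightarrow> x \<in> minty_set C D {} {z}"
    by (simp_all only: Int_iff Inter_Un_distrib INT_iff)
  \<comment> \<open>The intersection was taken over test points of finite value; at the others
    Minty's inequality is trivial.\<close>
  have "P.minty (snd x) (fst x) v" if "v \<in> C" for v
    using x(2)[of v] that P.minty_infinite by (cases "\<psi> v < \<infinity>") (auto simp: minty_set_def)
  moreover have "Q.minty (fst x) (snd x) z" if "z \<in> D" for z
    using x(3)[of z] that Q.minty_infinite by (cases "\<theta> z < \<infinity>") (auto simp: minty_set_def)
  ultimately have "x \<in> minty_set C D C D" using x(1) by (simp add: minty_set_def)
  then show ?thesis using solutions_eq_minty_set[OF C(2,4,5) D(2,4,5)] by blast
qed

theorem solutions_nonempty_weakly_compact: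
  assumes refl: "reflexive_space TYPE('v)" "reflexive_space TYPE('e)"
    and C: "closed C" "convex C" "u0 \<in> C" "\<psi> u0 < \<infinity>"
    and D: "closed D" "convex D" "w0 \<in> D" "\<theta> w0 < \<infinity>"
  shows "solutions C D \<noteq> {} \<and> compactin weak_topology (solutions C D)"
proof -
  obtain M where M: "norm u0 \<le> M" "norm w0 \<le> M"
    and bound: "\<And>C D u w. convex C \<Longrightarrow> convex D \<Longrightarrow> u0 \<in> C \<Longrightarrow> w0 \<in> D \<Longrightarrow> (u, w) \<in> solutions C D
      \<Longrightarrow> norm u \<le> M \<and> norm w \<le> M"
    by (fact a_priori_bound[OF C(4) D(4)])
  have "solutions C D \<noteq> {}"
  proof -
    \<comment> \<open>The margin 1 leaves room to move in every direction from a solution, whose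
      components have norm at most \<open>M\<close>.\<close>
    define C' D' where "C' = C \<inter> cball 0 (M + 1)" and "D' = D \<inter> cball 0 (M + 1)"
    have C': "closed C'" "convex C'" "bounded C'" "u0 \<in> C'"
      using C M by (auto simp: C'_def intro: convex_Int bounded_Int)
    have D': "closed D'" "convex D'" "bounded D'" "w0 \<in> D'"
      using D M by (auto simp: D'_def intro: convex_Int bounded_Int)
    obtain u w where uw: "(u, w) \<in> solutions C' D'"
      using solutions_bounded_nonempty[OF refl C' C(4) D' D(4)] by fastforce
    have uM: "norm u \<le> M" "norm w \<le> M" using bound[OF C'(2) D'(2) C'(4) D'(4) uw] by auto
    have fin: "\<psi> u < \<infinity>" "\<theta> w < \<infinity>"
      using uw C'(4) D'(4) P.stampacchia_finite[OF _ C(4)] Q.stampacchia_finite[OF _ D(4)]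
      by (auto simp: solutions_def)
    \<comment> \<open>The factor \<open>1 / (1 + norm d)\<close> shortens any \<open>d\<close> to
      norm at most 1, so the moved point stays in the larger ball.\<close>
    have step: "0 < 1 / (1 + norm d)" "1 / (1 + norm d) \<le> 1"
      "norm (x + (1 / (1 + norm d)) *\<^sub>R d) \<le> M + 1" if "norm x \<le> M"
      for x d :: "'b::real_normed_vector"
    proof -
      have pos: "0 < 1 + norm d" by (simp add: add_pos_nonneg)
      then show "0 < 1 / (1 + norm d)" "1 / (1 + norm d) \<le> 1" by simp_all
      have "norm ((1 / (1 + norm d)) *\<^sub>R d) \<le> 1" using pos by (simp add: divide_le_eq)
      then show "norm (x + (1 / (1 + norm d)) *\<^sub>R d) \<le> M + 1"
        using norm_triangle_ineq[of x "(1 / (1 + norm d)) *\<^sub>R d"] that by linarith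
    qed
    have mem: "x + t *\<^sub>R (y - x) \<in> S" if "convex S" "x \<in> S" "y \<in> S" "0 < t" "t \<le> 1"
      for S :: "'b::real_normed_vector set" and x y t
      using convexD_alt[OF that(1-3), of t] that(4,5) by (simp add: algebra_simps)
    have "P.stampacchia w u v" if v: "v \<in> C" for v
    proof (rule P.stampacchia_extend[OF fin(1) step(1,2)[OF uM(1)]])
      have "u \<in> C" using uw by (simp add: solutions_def C'_def)
      then have "u + (1 / (1 + norm (v - u))) *\<^sub>R (v - u) \<in> C'"
        unfolding C'_def using mem[OF C(2) _ v] step[OF uM(1), of "v - u"] by simp
      then show "P.stampacchia w u (u + (1 / (1 + norm (v - u))) *\<^sub>R (v - u))"
        using uw by (simp add: solutions_def)
    qed
    moreover have "Q.stampacchia u w z" if z: "z \<in> D" for z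
    proof (rule Q.stampacchia_extend[OF fin(2) step(1,2)[OF uM(2)]])
      have "w \<in> D" using uw by (simp add: solutions_def D'_def)
      then have "w + (1 / (1 + norm (z - w))) *\<^sub>R (z - w) \<in> D'"
        unfolding D'_def using mem[OF D(2) _ z] step[OF uM(2), of "z - w"] by simp
      then show "Q.stampacchia u w (w + (1 / (1 + norm (z - w))) *\<^sub>R (z - w))"
        using uw by (simp add: solutions_def)
    qed
    ultimately have "(u, w) \<in> solutions C D" using uw by (simp add: solutions_def C'_def D'_def)
    then show ?thesis by blast
  qed
  moreover have bd: "bounded (solutions C D)"
    by (rule bounded_subset[OF bounded_Times[OF bounded_cball bounded_cball], of _ 0 M 0 M])
      (use bound[OF C(2) D(2) C(3) D(3)] in auto)
  then have "compactin weak_topology (solutions C D)"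
    unfolding solutions_eq_minty_set[OF C(2-4) D(2-4)]
    by (intro compactin_weak_closedin reflexive_space_prod refl closedin_minty_set C D)
  ultimately show ?thesis by blast
qed

end

theorem theorem2:
  fixes C :: "'v::banach set" and D :: "'e::banach set"
    and h :: "'v \<Rightarrow>\<^sub>L real" and l :: "'e \<Rightarrow>\<^sub>L real"
    and \<gamma>1 :: "'v \<Rightarrow>\<^sub>L 'x::banach" and \<gamma>2 :: "'e \<Rightarrow>\<^sub>L 'y::banach"
    and \<delta>1 :: "'e \<Rightarrow>\<^sub>L 'z1::banach" and \<delta>2 :: "'v \<Rightarrow>\<^sub>L 'z2::banach"
    and \<psi> :: "'v \<Rightarrow> ereal" and \<theta> :: "'e \<Rightarrow> ereal"
    and J :: "'z1 \<Rightarrow> 'x \<Rightarrow> real" and H :: "'z2 \<Rightarrow> 'y \<Rightarrow> real"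
    and A :: "'e \<Rightarrow> 'v \<Rightarrow> ('v \<Rightarrow>\<^sub>L real)" and B :: "'v \<Rightarrow> 'e \<Rightarrow> ('e \<Rightarrow>\<^sub>L real)"
  assumes reflexive_V: "reflexive_space TYPE('v)"
    and reflexive_E: "reflexive_space TYPE('e)"
    and C: "C \<noteq> {}" "closed C" "convex C"
    and D: "D \<noteq> {}" "closed D" "convex D"
    and compact_ops: "compact_operator \<gamma>1" "compact_operator \<gamma>2"
      "compact_operator \<delta>1" "compact_operator \<delta>2"
    and psi: "\<forall>u. \<psi> u \<noteq> -\<infinity>" "ereal_convex \<psi>" "lower_semicontinuous \<psi>"
      "{u. \<psi> u < \<infinity>} \<inter> C \<noteq> {}"
    and theta: "\<forall>w. \<theta> w \<noteq> -\<infinity>" "ereal_convex \<theta>" "lower_semicontinuous \<theta>"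
      "{w. \<theta> w < \<infinity>} \<inter> D \<noteq> {}"
    and J_i: "\<forall>w. locally_lipschitz (J w)"
    and J_ii: "\<exists>cJ\<ge>0. \<forall>w u. \<forall>\<xi> \<in> clarke_subgradient (J w) u.
      norm \<xi> \<le> cJ * (1 + norm u + norm w)"
    and J_iii: "\<forall>u v ws w. ws \<longlonglongrightarrow> w \<longrightarrow>
      limsup (\<lambda>n. clarke_derivative (J (ws n)) u v) \<le> clarke_derivative (J w) u v"
    and H_i: "\<forall>u. locally_lipschitz (H u)"
    and H_ii: "\<exists>cH\<ge>0. \<forall>u w. \<forall>\<eta> \<in> clarke_subgradient (H u) w.
      norm \<eta> \<le> cH * (1 + norm u + norm w)"
    and H_iii: "\<forall>w z us u. us \<longlonglongrightarrow> u \<longrightarrow>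
      limsup (\<lambda>n. clarke_derivative (H (us n)) w z) \<le> clarke_derivative (H u) w z"
    and A_i: "\<forall>w u v.
      Limsup (at 0) (\<lambda>t. ereal (blinfun_apply (A w (t *\<^sub>R v + (1 - t) *\<^sub>R u)) (v - u)))
        \<le> ereal (blinfun_apply (A w u) (v - u))"
    and A_ii: "\<forall>w. stable_pseudomonotone_wrt \<psi> {h}
      (\<lambda>u. {A w u + dual_adjoint \<gamma>1 \<xi> | \<xi>.
              \<xi> \<in> clarke_subgradient (J (blinfun_apply \<delta>1 w)) (blinfun_apply \<gamma>1 u)})"
    and A_iii: "\<forall>ws w us u v. weakly_tendsto ws w \<and> weakly_tendsto us u \<longrightarrow>
      limsup (\<lambda>n. ereal (blinfun_apply (A (ws n) v) (v - us n)))
        \<le> ereal (blinfun_apply (A w v) (v - u))"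
    and A_iv: "\<exists>bA>0. \<forall>w u. norm (A w u) \<le> bA * (1 + norm u + norm w)"
    and A_v: "\<exists>rA. property_R rA \<and> (\<forall>u w.
      ereal (blinfun_apply (A w u) u)
        - clarke_derivative (J (blinfun_apply \<delta>1 w)) (blinfun_apply \<gamma>1 u) (- blinfun_apply \<gamma>1 u)
        \<ge> ereal (rA (norm u) (norm w) * norm u))"
    and B_i: "\<forall>u z w.
      Limsup (at 0) (\<lambda>t. ereal (blinfun_apply (B u (t *\<^sub>R z + (1 - t) *\<^sub>R w)) (z - w)))
        \<le> ereal (blinfun_apply (B u w) (z - w))"
    and B_ii: "\<forall>u. stable_pseudomonotone_wrt \<theta> {l}
      (\<lambda>w. {B u w + dual_adjoint \<gamma>2 \<eta> | \<eta>.
              \<eta> \<in> clarke_subgradient (H (blinfun_apply \<delta>2 u)) (blinfun_apply \<gamma>2 w)})"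
    and B_iii: "\<forall>ws w us u z. weakly_tendsto ws w \<and> weakly_tendsto us u \<longrightarrow>
      limsup (\<lambda>n. ereal (blinfun_apply (B (us n) z) (z - ws n)))
        \<le> ereal (blinfun_apply (B u z) (z - w))"
    and B_iv: "\<exists>bB>0. \<forall>w u. norm (B u w) \<le> bB * (1 + norm u + norm w)"
    and B_v: "\<exists>rB. property_R rB \<and> (\<forall>u w.
      ereal (blinfun_apply (B u w) w)
        - clarke_derivative (H (blinfun_apply \<delta>2 u)) (blinfun_apply \<gamma>2 w) (- blinfun_apply \<gamma>2 w)
        \<ge> ereal (rB (norm w) (norm u) * norm w))"
  defines "S \<equiv> {(u, w). u \<in> C \<and> w \<in> D \<and>
      (\<forall>v\<in>C. ereal (blinfun_apply (A w u) (v - u))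
        + clarke_derivative (J (blinfun_apply \<delta>1 w)) (blinfun_apply \<gamma>1 u) (blinfun_apply \<gamma>1 (v - u))
        + \<psi> v \<ge> ereal (blinfun_apply h (v - u)) + \<psi> u) \<and>
      (\<forall>z\<in>D. ereal (blinfun_apply (B u w) (z - w))
        + clarke_derivative (H (blinfun_apply \<delta>2 u)) (blinfun_apply \<gamma>2 w) (blinfun_apply \<gamma>2 (z - w))
        + \<theta> z \<ge> ereal (blinfun_apply l (z - w)) + \<theta> w)}"
  shows "S \<noteq> {} \<and> compactin weak_topology S"
proof -
  interpret P: parametric_vhi h \<gamma>1 \<delta>1 \<psi> J A
  proof (rule parametric_vhi.intro, goal_cases)
    case (8 u v ws w)
    then show ?case using J_iii by blast
  next
    case (11 ws w us u v)
    then show ?case using A_iii by blast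
  qed (use compact_ops psi J_i J_ii A_i A_ii A_iv A_v in \<open>simp_all\<close>)
  interpret Q: parametric_vhi l \<gamma>2 \<delta>2 \<theta> H B
  proof (rule parametric_vhi.intro, goal_cases)
    \<comment> \<open>The norms come in the other order, since here \<open>w\<close> is the unknown
      and \<open>u\<close> the parameter.\<close>
    case 7
    then show ?case using H_ii by (simp add: add_ac)
  next
    case (8 u v ws w)
    then show ?case using H_iii by blast
  next
    case (11 ws w us u v)
    then show ?case using B_iii by blast
  next
    case 12
    obtain b where b: "b > 0" "\<And>u w. norm (B u w) \<le> b * (1 + norm u + norm w)"
      using B_iv by blast
    have "norm (B u w) \<le> b * (1 + norm w + norm u)" for u w
      using b(2)[of u w] by (simp add: add_ac)
    with b(1) show ?case by blast
  next
    case 13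
    then show ?case using B_v by blast
  qed (use compact_ops theta H_i B_i B_ii in \<open>simp_all\<close>)
  interpret coupled_vhi h l \<gamma>1 \<gamma>2 \<delta>1 \<delta>2 \<psi> \<theta> J H A B ..
  obtain u0 where u0: "u0 \<in> C" "\<psi> u0 < \<infinity>" using psi(4) by blast
  obtain w0 where w0: "w0 \<in> D" "\<theta> w0 < \<infinity>" using theta(4) by blast
  have "S = solutions C D"
    by (simp only: S_def solutions_def P.stampacchia_iff Q.stampacchia_iff)
  then show ?thesis
    using solutions_nonempty_weakly_compact[OF reflexive_V reflexive_E C(2,3) u0 D(2,3) w0] by simp
qed

end
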